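(* Let $\mathcal{C}$ be an extension-closed pseudovariety of finite groups and let $A$ and $B$ be $\mathcal{C}$-conjugacy separable groups. Then $A \wr B$ is $\mathcal{C}$-conjugacy separable if and only if $B \in \mathcal{C}$, or $A$ is abelian and $B$ is $\mathcal{C}$-cyclic subgroup separable. If $B \in \mathcal{C}$ (and $A$ is finitely generated), then $$\mathrm{Conj}_{A \wr B, \mathcal{C}}(n) \preceq \left(\mathrm{Conj}_{A,\mathcal{C}}(n)\right)^{|B|^3}.$$ Whenever $B$ is finitely generated and $\mathcal{C}$-cyclic subgroup separable, let $\Phi(n) = \mathrm{ShortC}_B(n) + n$ and $$\Psi(n) = \mathrm{RG}_{B,\mathcal{C}}(\Phi(n)) \cdot \left(\mathrm{Cyclic}_{B,\mathcal{C}}(\Phi(n))\right)^{\Phi(n)^2}.$$ If $A$ is an infinite, finitely generated abelian group and $B$ is a $\mathcal{C}$-cyclic subgroup separable finitely generated group, then $$\mathrm{Conj}_{A \wr B,\mathcal{C}}(n) \preceq \max\left\{\mathrm{Conj}_{B,\mathcal{C}}(n),\ \left(\Psi(n) \cdot \mathrm{Conj}_{A,\mathcal{C}}(\Psi(n) \cdot n)\right)^{(\Psi(n))^3}\right\}.$$ If $A$ is a finite abelian group and $B$ is a $\mathcal{C}$-cyclic subgroup separable finitely generated group, then $$\mathrm{Conj}_{A \wr B,\mathcal{C}}(n) \preceq \max\left\{\mathrm{Conj}_{B,\mathcal{C}}(n),\ \Psi(n) \cdot 2^{\Psi(n)}\right\}.$$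
   Context: An extension-closed pseudovariety of finite groups is a class $\mathcal{C}$ of finite groups closed under subgroups, finite direct products, quotients and extensions. For a group $G$, $\mathcal{N}_{\mathcal{C}}(G)$ denotes the set of normal subgroups $N$ of $G$ with $G/N \in \mathcal{C}$, and $\pi_N \colon G \to G/N$ is the projection. A subset $X \subseteq G$ is $\mathcal{C}$-separable in $G$ if for every $g \in G \setminus X$ there is $N \in \mathcal{N}_{\mathcal{C}}(G)$ with $\pi_N(g) \notin \pi_N(X)$. $G$ is $\mathcal{C}$-conjugacy separable (resp. $\mathcal{C}$-cyclic subgroup separable) if every conjugacy class (resp. every cyclic subgroup) of $G$ is $\mathcal{C}$-separable. The restricted wreath product is $A \wr B = \left(\bigoplus_{b \in B} A\right) \rtimes B$, where elements of $\bigoplus_{b\in B} A$ are finitely supported functions $f \colon B \to A$ and $(b\cdot f)(x) = f(b^{-1}x)$. For a nonempty proper $\mathcal{C}$-separable subset $X$ of $G$ and $g \in G\setminus X$, $\mathrm{D}_{G,\mathcal{C}}(X,g) = \min\{[G:N] : N \in \mathcal{N}_{\mathcal{C}}(G),\ \pi_N(g) \notin \pi_N(X)\}$. For a finitely generated group $G$ with finite generating set $S$, let $\|\cdot\|$ be the word length and $\mathrm{B}_G(n)$ the ball of radius $n$ about the identity; write $g^G$ for the conjugacy class of $g$. When $G$ has the relevant separability property, define - $\mathrm{Conj}_{G,\mathcal{C}}(n) = \max\{\mathrm{D}_{G,\mathcal{C}}(g^G,h) : h \notin g^G,\ \|g\|,\|h\| \le n\}$; - $\mathrm{Cyclic}_{G,\mathcal{C}}(n)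 = \max\{\mathrm{D}_{G,\mathcal{C}}(\langle g\rangle,h) : h \notin \langle g\rangle,\ \|g\|,\|h\| \le n\}$; - $\mathrm{RG}_{G,\mathcal{C}}(n) = \min\{[G:N] : N \in \mathcal{N}_{\mathcal{C}}(G),\ \pi_N|_{\mathrm{B}_G(n)} \text{ is injective}\}$; - $\mathrm{ShortC}_G(n) = \max\{ \min\{\|x\| : x^{-1}gx = h\} : g,h \text{ conjugate in } G,\ \|g\|,\|h\| \le n\}$. Finite generating sets are fixed and suppressed from the notation. For nondecreasing $f,g\colon \mathbb{N}\to\mathbb{N}$ (with $0 \in \mathbb{N}$), $f \preceq g$ means there is a constant $K \in \mathbb{N}$ with $f(n) \le K g(Kn)$ for all $n \in \mathbb{N}$.
   Formalization: The "only if" half of the equivalence is stated for nontrivial A, since it fails for trivial A (e.g. C the finite p-groups, B = ℤ); the "if" half and all bounds hold for every A. Maxima over empty sets are taken to be 1. *)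

theory Defs
  imports "HOL-Algebra.Product_Groups"
begin

section \<open>Classes of finite groups\<close>

text \<open>
  Every finite group is isomorphic to one whose carrier is a set of natural numbers. An
  isomorphism-closed class of finite groups is therefore represented by a set \<open>C\<close> of groups of
  type \<open>nat monoid\<close>, and a group over an arbitrary type belongs to the class iff it is isomorphic
  to a member of \<open>C\<close>.
\<close>

definition in_class :: "nat monoid set \<Rightarrow> ('a, 'm) monoid_scheme \<Rightarrow> bool"
  where "in_class C G \<longleftrightarrow> group G \<and> (\<exists>H\<in>C. G \<cong> H)"

text \<open>
  The empty product (\<open>I = {}\<close>) is allowed, so the trivial group always belongs to the class.
\<close>

definition pseudovariety :: "nat monoid set \<Rightarrow> bool"
  where "pseudovariety C \<longleftrightarrow>
    (\<forall>G\<in>C. group G \<and> finite (carrier G)) \<and>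
    (\<forall>G\<in>C. \<forall>H. subgroup H G \<longrightarrow> in_class C (G\<lparr>carrier := H\<rparr>)) \<and>
    (\<forall>(I :: nat set) F. finite I \<and> (\<forall>i\<in>I. F i \<in> C) \<longrightarrow> in_class C (product_group I F)) \<and>
    (\<forall>G\<in>C. \<forall>N. N \<lhd> G \<longrightarrow> in_class C (G Mod N))"

text \<open>
  An extension of a group in the class by a group in the class is finite, so it suffices to
  consider extensions \<open>G\<close> carried by natural numbers.
\<close>

definition extension_closed :: "nat monoid set \<Rightarrow> bool"
  where "extension_closed C \<longleftrightarrow>
    (\<forall>(G :: nat monoid) N. N \<lhd> G \<and> in_class C (G\<lparr>carrier := N\<rparr>) \<and> in_class C (G Mod N)
       \<longrightarrow> in_class C G)"


section \<open>Separability\<close>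

definition class_normals :: "nat monoid set \<Rightarrow> ('a, 'm) monoid_scheme \<Rightarrow> 'a set set"
  where "class_normals C G = {N. N \<lhd> G \<and> in_class C (G Mod N)}"

definition proj :: "('a, 'm) monoid_scheme \<Rightarrow> 'a set \<Rightarrow> 'a \<Rightarrow> 'a set"
  where "proj G N g = N #>\<^bsub>G\<^esub> g"

definition separable :: "nat monoid set \<Rightarrow> ('a, 'm) monoid_scheme \<Rightarrow> 'a set \<Rightarrow> bool"
  where "separable C G X \<longleftrightarrow> X \<subseteq> carrier G \<and>
    (\<forall>g \<in> carrier G - X. \<exists>N \<in> class_normals C G. proj G N g \<notin> proj G N ` X)"

definition conj_class :: "('a, 'm) monoid_scheme \<Rightarrow> 'a \<Rightarrow> 'a set"
  where "conj_class G g = {inv\<^bsub>G\<^esub> x \<otimes>\<^bsub>G\<^esub> g \<otimes>\<^bsub>G\<^esub> x | x. x \<in> carrier G}"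

definition conjugacy_separable :: "nat monoid set \<Rightarrow> ('a, 'm) monoid_scheme \<Rightarrow> bool"
  where "conjugacy_separable C G \<longleftrightarrow> (\<forall>g \<in> carrier G. separable C G (conj_class G g))"

definition cyclic_subgroup_separable :: "nat monoid set \<Rightarrow> ('a, 'm) monoid_scheme \<Rightarrow> bool"
  where "cyclic_subgroup_separable C G \<longleftrightarrow> (\<forall>g \<in> carrier G. separable C G (generate G {g}))"


section \<open>Restricted wreath products\<close>

text \<open>
  The base group \<open>sum_group (carrier B) (\<lambda>_. A)\<close> consists of the finitely supported functions
  from \<open>carrier B\<close> to \<open>carrier A\<close>, taken to be \<open>undefined\<close> outside \<open>carrier B\<close>; hence the
  restricted abstraction in the action.
\<close>

abbreviation wreath_base :: "('a, 'm) monoid_scheme \<Rightarrow> ('b, 'n) monoid_scheme \<Rightarrow> ('b \<Rightarrow> 'a) monoid"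
  where "wreath_base A B \<equiv> sum_group (carrier B) (\<lambda>_. A)"

definition wreath_action :: "('b, 'n) monoid_scheme \<Rightarrow> 'b \<Rightarrow> ('b \<Rightarrow> 'a) \<Rightarrow> 'b \<Rightarrow> 'a"
  where "wreath_action B b f = (\<lambda>x \<in> carrier B. f (inv\<^bsub>B\<^esub> b \<otimes>\<^bsub>B\<^esub> x))"

definition wreath ::
    "('a, 'm) monoid_scheme \<Rightarrow> ('b, 'n) monoid_scheme \<Rightarrow> (('b \<Rightarrow> 'a) \<times> 'b) monoid"
  where "wreath A B =
    \<lparr>carrier = carrier (wreath_base A B) \<times> carrier B,
     monoid.mult = (\<lambda>(f, b) (f', b').
        (f \<otimes>\<^bsub>wreath_base A B\<^esub> wreath_action B b f', b \<otimes>\<^bsub>B\<^esub> b')),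
     one = (\<one>\<^bsub>wreath_base A B\<^esub>, \<one>\<^bsub>B\<^esub>)\<rparr>"


section \<open>Word length and the quantifying functions\<close>

definition fin_gen_set :: "('a, 'm) monoid_scheme \<Rightarrow> 'a set \<Rightarrow> bool"
  where "fin_gen_set G S \<longleftrightarrow> finite S \<and> S \<subseteq> carrier G \<and> generate G S = carrier G"

definition word_length :: "('a, 'm) monoid_scheme \<Rightarrow> 'a set \<Rightarrow> 'a \<Rightarrow> nat"
  where "word_length G S g =
    (LEAST k. \<exists>w. length w = k \<and> set w \<subseteq> S \<union> m_inv G ` S \<and> foldr (\<otimes>\<^bsub>G\<^esub>) w \<one>\<^bsub>G\<^esub> = g)"

definition word_ball :: "('a, 'm) monoid_scheme \<Rightarrow> 'a set \<Rightarrow> nat \<Rightarrow> 'a set"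
  where "word_ball G S n = {g \<in> carrier G. word_length G S g \<le> n}"

text \<open>
  Below, \<open>Inf\<close> is used for the minimum of a possibly infinite nonempty set of natural numbers.
\<close>

definition depth :: "nat monoid set \<Rightarrow> ('a, 'm) monoid_scheme \<Rightarrow> 'a set \<Rightarrow> 'a \<Rightarrow> nat"
  where "depth C G X g =
    Inf {card (rcosets\<^bsub>G\<^esub> N) | N. N \<in> class_normals C G \<and> proj G N g \<notin> proj G N ` X}"

text \<open>
  The sets of depths maximised in the next two definitions are empty for the trivial group and
  for \<open>n = 0\<close>; the maximum is then taken to be 1, the index of the trivial quotient. As depths
  are indices of finite-index subgroups, hence at least 1, inserting 1 does not change the maximum
  of a nonempty set of depths.
\<close>

definition Conj_fun :: "nat monoid set \<Rightarrow> ('a, 'm) monoid_scheme \<Rightarrow> 'a set \<Rightarrow> nat \<Rightarrow> nat"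
  where "Conj_fun C G S n =
    Max (insert 1 {depth C G (conj_class G g) h | g h.
      g \<in> word_ball G S n \<and> h \<in> word_ball G S n \<and> h \<notin> conj_class G g})"

definition Cyclic_fun :: "nat monoid set \<Rightarrow> ('a, 'm) monoid_scheme \<Rightarrow> 'a set \<Rightarrow> nat \<Rightarrow> nat"
  where "Cyclic_fun C G S n =
    Max (insert 1 {depth C G (generate G {g}) h | g h.
      g \<in> word_ball G S n \<and> h \<in> word_ball G S n \<and> h \<notin> generate G {g}})"

definition RG_fun :: "nat monoid set \<Rightarrow> ('a, 'm) monoid_scheme \<Rightarrow> 'a set \<Rightarrow> nat \<Rightarrow> nat"
  where "RG_fun C G S n =
    Inf {card (rcosets\<^bsub>G\<^esub> N) | N. N \<in> class_normals C G \<and> inj_on (proj G N) (word_ball G S n)}"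

definition ShortC_fun :: "('a, 'm) monoid_scheme \<Rightarrow> 'a set \<Rightarrow> nat \<Rightarrow> nat"
  where "ShortC_fun G S n =
    Max {Inf {word_length G S x | x. x \<in> carrier G \<and> inv\<^bsub>G\<^esub> x \<otimes>\<^bsub>G\<^esub> g \<otimes>\<^bsub>G\<^esub> x = h} | g h.
      g \<in> word_ball G S n \<and> h \<in> word_ball G S n \<and> h \<in> conj_class G g}"

definition Phi_fun :: "('b, 'n) monoid_scheme \<Rightarrow> 'b set \<Rightarrow> nat \<Rightarrow> nat"
  where "Phi_fun B S n = ShortC_fun B S n + n"

definition Psi_fun :: "nat monoid set \<Rightarrow> ('b, 'n) monoid_scheme \<Rightarrow> 'b set \<Rightarrow> nat \<Rightarrow> nat"
  where "Psi_fun C B S n =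
    RG_fun C B S (Phi_fun B S n) * (Cyclic_fun C B S (Phi_fun B S n)) ^ ((Phi_fun B S n)\<^sup>2)"

definition preceq :: "(nat \<Rightarrow> nat) \<Rightarrow> (nat \<Rightarrow> nat) \<Rightarrow> bool"  (infix \<open>\<preceq>\<close> 50)
  where "f \<preceq> g \<longleftrightarrow> (\<exists>K::nat. \<forall>n. f n \<le> K * g (K * n))"

end

theory Submission
  imports Defs "HOL-Algebra.Multiplicative_Group"
begin

text \<open>
  Write elements of the wreath product as pairs \<open>(f, b)\<close>. Two pairs \<open>(f, b)\<close> and \<open>(f', b')\<close>
  are conjugate iff some \<open>c\<close> with \<open>b c = c b'\<close> matches their orbit data, where the orbit data of
  \<open>(f, b)\<close> attaches to each right coset of the cyclic group \<open>\<langle>b\<rangle>\<close> the product of the values of \<open>f\<close>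
  along that coset.

  If \<open>A\<close> is abelian, this product (\<open>mass\<close>) is an element of \<open>A\<close>, and the criterion
  (\<open>conj_in_wreath_abelian_iff\<close>) holds for infinite cosets as well, because moving a value of
  \<open>f\<close> along its coset only changes \<open>f\<close> by a coboundary. To separate two non-conjugate pairs whose
  top parts are conjugate, push both forward to a wreath product of quotients \<open>A/N\<close> and \<open>B/M\<close>.
  A conjugator in that quotient is only a conjugator modulo \<open>M\<close>, but it has to carry a fixed coset
  of nontrivial mass, say that of \<open>x\<^sub>0\<close>, to the coset of some point \<open>y\<close> in the support of \<open>f'\<close>. So it
  may be replaced by \<open>x\<^sub>0 y\<^sup>-\<^sup>1\<close>, which leaves finitely many candidates, and for each of them it is
  enough to keep one difference visible in the quotient (\<open>push_not_conj\<close>). With supports of size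
  \<open>n\<close> this needs \<open>O(n\<^sup>2)\<close> separations of an element from a cyclic subgroup of \<open>B\<close>, injectivity on a
  ball of linear radius in \<open>B\<close>, and \<open>O(n)\<close> separations of elements of \<open>A\<close> (\<open>separating_tests\<close>). Cyclic
  subgroup separability of \<open>B\<close> provides the quotient, and counting gives both bounds for abelian
  \<open>A\<close>.

  If \<open>B\<close> belongs to the class, the product along a coset is taken in cyclic order (\<open>twist\<close>) and is
  determined up to conjugacy in \<open>A\<close>. There are at most \<open>|B|\<close> candidates \<open>c\<close>, each refuted by one
  quotient of \<open>A\<close>, and the common quotient \<open>A/N\<close> gives the finite group \<open>A/N wr B\<close> of order
  \<open>|A/N| ^ |B| * |B|\<close> (\<open>finite_top_separation\<close>).

  Conversely, let the wreath product be conjugacy separable. If \<open>B\<close> is not in the class, it is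
  infinite, so that every quotient in the class identifies two points of \<open>B\<close>. Copies of \<open>A\<close> at
  different points commute, hence commutators of \<open>A\<close> die in every such quotient
  (\<open>nonabelian_necessary\<close>). If \<open>h\<close> lies outside \<open>\<langle>b\<rangle>\<close> but cannot be separated from it,
  then moving a value \<open>a \<noteq> 1\<close> from the point \<open>1\<close> to \<open>h\<close> changes the conjugacy class of a pair
  with top part \<open>b\<close>, although no quotient in the class notices (\<open>abelian_necessary\<close>).
\<close>

section \<open>Membership in the class\<close>

lemma in_class_group: "in_class C G \<Longrightarrow> group G"
  by (simp add: in_class_def)

lemma in_class_finite:
  assumes "pseudovariety C" "in_class C G"
  shows "finite (carrier G)"
proof -
  obtain H where "H \<in> C" "G \<cong> H" using assms(2) by (auto simp: in_class_def)
  then show ?thesis using assms(1) iso_finite[of G H] by (simp add: pseudovariety_def)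
qed

text \<open>
  Closure under subgroups is postulated only for the chosen representatives on the natural numbers.
  This form speaks about arbitrary groups, and most membership proofs below reduce to it.
\<close>

lemma in_class_embed:
  assumes C: "pseudovariety C" and H: "in_class C H" and G: "group G"
    and \<phi>: "\<phi> \<in> hom G H" "inj_on \<phi> (carrier G)"
  shows "in_class C G"
proof -
  obtain H' \<psi> where H': "H' \<in> C" "\<psi> \<in> iso H H'"
    using H unfolding in_class_def is_iso_def by blast
  have grH': "group H'" using C H' by (auto simp: pseudovariety_def)
  define \<chi> where "\<chi> = \<psi> \<circ> \<phi>"
  have \<psi>: "\<psi> \<in> hom H H'" "inj_on \<psi> (carrier H)"
    using H'(2) by (auto simp: iso_def bij_betw_def)
  have \<chi>: "\<chi> \<in> hom G H'" unfolding \<chi>_def using \<phi>(1) \<psi>(1) by (rule hom_compose)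
  have inj: "inj_on \<chi> (carrier G)"
    unfolding \<chi>_def using \<phi> \<psi>(2) by (meson comp_inj_on hom_carrier inj_on_subset)
  interpret group_hom G H' \<chi> using G grH' \<chi> by (simp add: group_hom_def group_hom_axioms_def)
  have sub: "subgroup (\<chi> ` carrier G) H'" by (rule img_is_subgroup)
  then have "in_class C (H'\<lparr>carrier := \<chi> ` carrier G\<rparr>)"
    using C H'(1) by (auto simp: pseudovariety_def)
  then obtain H'' where H'': "H'' \<in> C" "H'\<lparr>carrier := \<chi> ` carrier G\<rparr> \<cong> H''"
    unfolding in_class_def by blast
  have "\<chi> \<in> iso G (H'\<lparr>carrier := \<chi> ` carrier G\<rparr>)"
    using inj \<chi> by (auto simp: iso_def hom_def bij_betw_def)
  then have "G \<cong> H''" using H''(2) iso_set_trans unfolding is_iso_def by blast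
  then show ?thesis using H''(1) G unfolding in_class_def by blast
qed

lemma in_class_iso:
  assumes "pseudovariety C" "in_class C H" "group G" "G \<cong> H"
  shows "in_class C G"
  using assms in_class_embed[of C H G] by (auto simp: is_iso_def iso_def bij_betw_def)

lemma in_class_trivial:
  assumes C: "pseudovariety C" and G: "group G" "carrier G = {\<one>\<^bsub>G\<^esub>}"
  shows "in_class C G"
proof -
  have "in_class C (product_group ({}::nat set) (\<lambda>_. undefined :: nat monoid))"
  proof -
    have "\<forall>(I :: nat set) F. finite I \<and> (\<forall>i\<in>I. F i \<in> C) \<longrightarrow> in_class C (product_group I F)"
      using C unfolding pseudovariety_def by (elim conjE)
    from this[rule_format, of "{}" "\<lambda>_. undefined :: nat monoid"] show ?thesis by simp
  qed
  moreover have "(\<lambda>_. \<one>\<^bsub>product_group ({}::nat set) (\<lambda>_. undefined :: nat monoid)\<^esub>)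
      \<in> hom G (product_group ({}::nat set) (\<lambda>_. undefined :: nat monoid))"
    by (auto simp: hom_def)
  ultimately show ?thesis
    using in_class_embed[OF C _ G(1)] by (simp add: G(2))
qed

lemma in_class_product:
  assumes C: "pseudovariety C" and I: "finite (I::'i set)" and F: "\<And>i. i \<in> I \<Longrightarrow> in_class C (F i)"
  shows "in_class C (product_group I F)"
proof -
  have gF: "\<And>i. i \<in> I \<Longrightarrow> group (F i)" using F in_class_group by blast
  obtain e :: "'i \<Rightarrow> nat" where e: "inj_on e I"
    using finite_imp_inj_to_nat_seg[OF I] by blast
  have "\<forall>i\<in>I. \<exists>H \<psi>. H \<in> C \<and> \<psi> \<in> iso (F i) H"
    using F unfolding in_class_def is_iso_def by blast
  then obtain H \<psi> where H: "\<And>i. i \<in> I \<Longrightarrow> H i \<in> C" and \<psi>: "\<And>i. i \<in> I \<Longrightarrow> \<psi> i \<in> iso (F i) (H i)"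
    by metis
  define d where "d = the_inv_into I e"
  have d: "\<And>i. i \<in> I \<Longrightarrow> d (e i) = i" using e by (simp add: d_def the_inv_into_f_f)
  define P where "P = product_group (e ` I) (\<lambda>j. H (d j))"
  have P: "in_class C P"
    using C I H d unfolding pseudovariety_def P_def by (simp add: )
  define \<chi> where "\<chi> f = (\<lambda>j\<in>e ` I. \<psi> (d j) (f (d j)))" for f
  have \<chi>: "\<chi> \<in> hom (product_group I F) P"
    using \<psi> d unfolding P_def \<chi>_def
    by (auto simp: hom_def iso_def PiE_iff fun_eq_iff Pi_iff)
  have inj: "inj_on \<chi> (carrier (product_group I F))"
  proof (rule inj_onI)
    fix f g assume f: "f \<in> carrier (product_group I F)" and g: "g \<in> carrier (product_group I F)" and eq: "\<chi> f = \<chi> g"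
    have "f i = g i" if i: "i \<in> I" for i
    proof -
      have "\<psi> i (f i) = \<psi> i (g i)" using fun_cong[OF eq, of "e i"] i d by (simp add: \<chi>_def)
      moreover have "inj_on (\<psi> i) (carrier (F i))" using \<psi>[OF i] by (auto simp: iso_def bij_betw_def)
      moreover have "f i \<in> carrier (F i)" "g i \<in> carrier (F i)" using f g i by (auto simp: PiE_iff)
      ultimately show ?thesis by (simp add: inj_on_def)
    qed
    then show "f = g" using f g by (auto intro: PiE_ext)
  qed
  show ?thesis by (rule in_class_embed[OF C P _ \<chi> inj]) (simp add: gF)
qed

text \<open>
  Extension closure is postulated for groups of natural numbers, so \<open>G\<close> is first copied to a group on
  an initial part of the naturals. Giving the quotient through a homomorphism to a member \<open>Q\<close> spares
  the identification of \<open>Q\<close> with \<open>G\<close> modulo the kernel.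
\<close>

lemma in_class_extension:
  assumes C: "pseudovariety C" "extension_closed C" and G: "group G" "finite (carrier G)"
    and Q: "in_class C Q" and \<phi>: "\<phi> \<in> hom G Q"
    and K: "in_class C (G\<lparr>carrier := kernel G Q \<phi>\<rparr>)"
  shows "in_class C G"
proof -
  interpret G: group G by (rule G(1))
  interpret Q: group Q using Q by (rule in_class_group)
  obtain e :: "'a \<Rightarrow> nat" where e: "inj_on e (carrier G)"
    using finite_imp_inj_to_nat_seg[OF G(2)] by blast
  define d where "d = the_inv_into (carrier G) e"
  have d: "\<And>i. i \<in> carrier G \<Longrightarrow> d (e i) = i" using e by (simp add: d_def the_inv_into_f_f)
  define G' where "G' = \<lparr>carrier = e ` carrier G, monoid.mult = (\<lambda>x y. e (d x \<otimes>\<^bsub>G\<^esub> d y)), one = e \<one>\<^bsub>G\<^esub>\<rparr>"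
  have iso: "e \<in> iso G G'"
    using e d by (auto simp: iso_def hom_def bij_betw_def G'_def)
  have "monoid G'"
    by (rule monoidI) (use d in \<open>auto simp: G'_def G.m_assoc\<close>)
  then have grG': "group G'"
    using G.iso_imp_group iso by (auto simp: is_iso_def)
  then interpret G': group G' .
  define \<phi>' where "\<phi>' = \<phi> \<circ> d"
  have \<phi>': "\<phi>' \<in> hom G' Q"
    using \<phi> d by (auto simp: hom_def \<phi>'_def G'_def)
  interpret \<phi>': group_hom G' Q \<phi>'
    using \<phi>' by (simp add: group_hom_def group_hom_axioms_def G'.group_axioms Q.group_axioms)
  interpret \<phi>: group_hom G Q \<phi>
    using \<phi> by (simp add: group_hom_def group_hom_axioms_def G.group_axioms Q.group_axioms)
  have "in_class C (G' Mod kernel G' Q \<phi>')"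
    using in_class_embed[OF C(1) Q] normal.factorgroup_is_group[OF \<phi>'.normal_kernel] \<phi>'.FactGroup_hom \<phi>'.FactGroup_inj_on
    by blast
  moreover have "in_class C (G'\<lparr>carrier := kernel G' Q \<phi>'\<rparr>)"
  proof (rule in_class_embed[OF C(1) K])
    show "group (G'\<lparr>carrier := kernel G' Q \<phi>'\<rparr>)"
      using \<phi>'.subgroup_kernel by (simp add: G'.subgroup_imp_group)
    show "d \<in> hom (G'\<lparr>carrier := kernel G' Q \<phi>'\<rparr>) (G\<lparr>carrier := kernel G Q \<phi>\<rparr>)"
      using d by (auto simp: hom_def kernel_def \<phi>'_def G'_def)
    show "inj_on d (carrier (G'\<lparr>carrier := kernel G' Q \<phi>'\<rparr>))"
      using d by (auto simp: inj_on_def kernel_def G'_def)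
  qed
  ultimately have "in_class C G'"
    using C(2) \<phi>'.normal_kernel unfolding extension_closed_def by blast
  then show ?thesis
    using in_class_iso[OF C(1) _ G(1)] iso by (auto simp: is_iso_def)
qed

section \<open>Separating quotients\<close>

lemma proj_hom:
  assumes "N \<lhd> G" shows "proj G N \<in> hom G (G Mod N)"
  using normal.r_coset_hom_Mod[OF assms] by (simp add: proj_def[abs_def])

lemma proj_eq_iff:
  assumes "group G" "subgroup N G" "x \<in> carrier G" "y \<in> carrier G"
  shows "proj G N x = proj G N y \<longleftrightarrow> x \<otimes>\<^bsub>G\<^esub> inv\<^bsub>G\<^esub> y \<in> N"
proof -
  interpret group G by fact
  show ?thesis unfolding proj_def
    by (metis assms(2-4) rcos_self repr_independence repr_independenceD subgroup.rcos_module is_group)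
qed

lemma class_normalsD:
  assumes "N \<in> class_normals C G"
  shows "N \<lhd> G" "in_class C (G Mod N)" "subgroup N G"
  using assms by (auto simp: class_normals_def normal_imp_subgroup)

lemma carrier_Mod: "carrier (G Mod N) = rcosets\<^bsub>G\<^esub> N"
  by (simp add: FactGroup_def)

lemma carrier_Mod_proj: "carrier (G Mod N) = proj G N ` carrier G"
  by (simp add: carrier_FactGroup proj_def[abs_def])

abbreviation "quot_card G N \<equiv> card (rcosets\<^bsub>G\<^esub> N)"

lemma class_normals_index:
  assumes "pseudovariety C" "group G" "N \<in> class_normals C G"
  shows "finite (rcosets\<^bsub>G\<^esub> N)" "quot_card G N \<ge> 1"
proof -
  show f: "finite (rcosets\<^bsub>G\<^esub> N)"
    using in_class_finite[OF assms(1)] class_normalsD(2)[OF assms(3)] by (metis carrier_Mod)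
  have "rcosets\<^bsub>G\<^esub> N \<noteq> {}"
    using carrier_Mod_proj[of G N] monoid.one_closed[OF group.is_monoid[OF assms(2)]] by (metis carrier_Mod empty_iff image_eqI)
  then show "quot_card G N \<ge> 1" using f by (simp add: Suc_leI card_gt_0_iff)
qed

text \<open>
  The source of all separating quotients: a homomorphism to a member of the class.
\<close>

lemma kernel_class_normal:
  assumes C: "pseudovariety C" and G: "group G" and Q: "in_class C Q" and \<phi>: "\<phi> \<in> hom G Q"
  shows "kernel G Q \<phi> \<in> class_normals C G" "quot_card G (kernel G Q \<phi>) \<le> order Q"
proof -
  interpret group_hom G Q \<phi>
    using G Q \<phi> by (simp add: group_hom_def group_hom_axioms_def in_class_group)
  have "in_class C (G Mod kernel G Q \<phi>)"
    using in_class_embed[OF C Q] normal.factorgroup_is_group[OF normal_kernel] FactGroup_hom FactGroup_inj_on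
    by blast
  then show "kernel G Q \<phi> \<in> class_normals C G"
    using normal_kernel by (simp add: class_normals_def)
  show "quot_card G (kernel G Q \<phi>) \<le> order Q"
    using card_inj_on_le[OF FactGroup_inj_on hom_carrier[OF FactGroup_hom]] in_class_finite[OF C Q]
    by (metis carrier_Mod order_def)
qed

lemma proj_kernel_eq_iff:
  assumes "group G" "group Q" "\<phi> \<in> hom G Q" "x \<in> carrier G" "y \<in> carrier G"
  shows "proj G (kernel G Q \<phi>) x = proj G (kernel G Q \<phi>) y \<longleftrightarrow> \<phi> x = \<phi> y"
proof -
  interpret group_hom G Q \<phi>
    using assms by (simp add: group_hom_def group_hom_axioms_def)
  have "x \<otimes>\<^bsub>G\<^esub> inv\<^bsub>G\<^esub> y \<in> kernel G Q \<phi> \<longleftrightarrow> \<phi> x \<otimes>\<^bsub>Q\<^esub> inv\<^bsub>Q\<^esub> \<phi> y = \<one>\<^bsub>Q\<^esub>"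
    using assms by (simp add: kernel_def)
  also have "\<dots> \<longleftrightarrow> \<phi> x = \<phi> y"
    using assms by (metis H.inv_equality H.inv_inv H.r_inv hom_closed H.inv_closed)
  finally show ?thesis using proj_eq_iff[OF assms(1) subgroup_kernel] assms by simp
qed

text \<open>
  The quotient by the intersection embeds into the product of the two quotients.
\<close>

lemma class_normals_Int:
  assumes C: "pseudovariety C" and G: "group G"
    and N: "N \<in> class_normals C G" "N' \<in> class_normals C G"
  shows "N \<inter> N' \<in> class_normals C G"
    "quot_card G (N \<inter> N') \<le> quot_card G N * quot_card G N'"
proof -
  interpret group G by fact
  interpret N: normal N G using N(1) by (rule class_normalsD)
  interpret N': normal N' G using N(2) by (rule class_normalsD)
  define F where "F i = (if i then G Mod N else G Mod N')" for i
  have F: "in_class C (product_group UNIV F)"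
    by (rule in_class_product[OF C]) (auto simp: F_def N class_normalsD)
  define \<phi> where "\<phi> g = (\<lambda>i. if i then proj G N g else proj G N' g)" for g
  have 1: "proj G N \<in> hom G (G Mod N)" and 2: "proj G N' \<in> hom G (G Mod N')"
    using N by (simp_all add: class_normalsD(1) proj_hom)
  have \<phi>: "\<phi> \<in> hom G (product_group UNIV F)"
    using 1 2 by (auto simp: hom_def \<phi>_def F_def fun_eq_iff PiE_iff)
  have n: "N \<inter> N' \<lhd> G" using N.normal_axioms N'.normal_axioms by (simp add: normal_subgroup_intersect)
  have "g \<in> kernel G (product_group UNIV F) \<phi> \<longleftrightarrow> g \<in> N \<inter> N'" for g
  proof -
    have *: "N #>\<^bsub>G\<^esub> g = N \<longleftrightarrow> g \<in> N" "N' #>\<^bsub>G\<^esub> g = N' \<longleftrightarrow> g \<in> N'" if "g \<in> carrier G"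
      using that by (metis N.rcos_const N.subgroup_axioms is_group rcos_self)
       (metis that N'.rcos_const N'.subgroup_axioms is_group rcos_self)
    show ?thesis using * N.subset
      by (auto simp: kernel_def \<phi>_def F_def fun_eq_iff proj_def split: if_splits)
  qed
  then have k: "kernel G (product_group UNIV F) \<phi> = N \<inter> N'" by blast
  show "N \<inter> N' \<in> class_normals C G" using kernel_class_normal(1)[OF C G F \<phi>] k by simp
  have "order (product_group UNIV F) = quot_card G N * quot_card G N'"
    by (simp add: order_def card_PiE UNIV_bool F_def carrier_Mod)
  then show "quot_card G (N \<inter> N') \<le> quot_card G N * quot_card G N'"
    using kernel_class_normal(2)[OF C G F \<phi>] k by simp
qed

lemma carrier_class_normal:
  assumes C: "pseudovariety C" and G: "group G"
  shows "carrier G \<in> class_normals C G" "quot_card G (carrier G) = 1"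
proof -
  interpret group G by fact
  have n: "carrier G \<lhd> G" by (rule normal_self)
  have c: "rcosets\<^bsub>G\<^esub> (carrier G) = {carrier G}"
    using carrier_FactGroup[of G "carrier G"] coset_join2[OF _ subgroup_self] one_closed
    by (auto simp: carrier_Mod RCOSETS_def)
  then show "quot_card G (carrier G) = 1" by simp
  have "in_class C (G Mod carrier G)"
    using in_class_trivial[OF C normal.factorgroup_is_group[OF n]] c by (simp add: carrier_Mod)
  then show "carrier G \<in> class_normals C G" using n by (simp add: class_normals_def)
qed

text \<open>
  Finitely many separation demands \<open>P j\<close> that survive shrinking the normal subgroup are met at once by
  intersecting. Each intersection at most multiplies the index by \<open>k\<close>.
\<close>

lemma class_normals_INT:
  assumes C: "pseudovariety C" and G: "group G" and "finite J"
    and "\<And>j. j \<in> J \<Longrightarrow> \<exists>N \<in> class_normals C G. quot_card G N \<le> k \<and> P j N"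
    and "\<And>j N N'. j \<in> J \<Longrightarrow> P j N \<Longrightarrow> N' \<subseteq> N \<Longrightarrow> N \<in> class_normals C G \<Longrightarrow> N' \<in> class_normals C G \<Longrightarrow> P j N'"
  shows "\<exists>N \<in> class_normals C G. quot_card G N \<le> k ^ card J \<and> (\<forall>j\<in>J. P j N)"
  using assms(3,4,5)
proof (induction J rule: finite_induct)
  case empty
  then show ?case using carrier_class_normal[OF C G] by force
next
  case (insert j J)
  note mono = insert.prems(2)
  have "\<exists>N \<in> class_normals C G. quot_card G N \<le> k ^ card J \<and> (\<forall>j\<in>J. P j N)"
    by (rule insert.IH) (erule insert.prems(1)[OF insertI2], erule mono[OF insertI2])
  then obtain N where N: "N \<in> class_normals C G" "quot_card G N \<le> k ^ card J" "\<forall>j\<in>J. P j N"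
    by blast
  obtain N' where N': "N' \<in> class_normals C G" "quot_card G N' \<le> k" "P j N'"
    using insert.prems(1)[OF insertI1] by blast
  note I = class_normals_Int[OF C G N'(1) N(1)]
  have "quot_card G (N' \<inter> N) \<le> k * k ^ card J"
    using I(2) mult_le_mono[OF N'(2) N(2)] by linarith
  then have "quot_card G (N' \<inter> N) \<le> k ^ card (insert j J)"
    using insert.hyps by simp
  moreover have "\<forall>i \<in> insert j J. P i (N' \<inter> N)"
  proof
    fix i assume i: "i \<in> insert j J"
    show "P i (N' \<inter> N)"
    proof (cases "i = j")
      case True
      then show ?thesis using mono[OF insertI1 N'(3) _ N'(1) I(1)] by simp
    next
      case False
      then have "P i N" using i N(3) by simp
      then show ?thesis using mono[OF i _ _ N(1) I(1)] by simp
    qed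
  qed
  ultimately show ?case using I(1) by (intro bexI[of _ "N' \<inter> N"] conjI)
qed

lemma proj_mono_eq:
  assumes "group G" "subgroup N G" "subgroup N' G" "N' \<subseteq> N" "x \<in> carrier G" "y \<in> carrier G"
    "proj G N' x = proj G N' y"
  shows "proj G N x = proj G N y"
  using assms by (auto simp: proj_eq_iff)

lemma proj_not_in_image_mono:
  assumes "group G" "N \<in> class_normals C G" "N' \<in> class_normals C G" "N' \<subseteq> N" "x \<in> carrier G" "X \<subseteq> carrier G"
    "proj G N x \<notin> proj G N ` X"
  shows "proj G N' x \<notin> proj G N' ` X"
proof
  assume "proj G N' x \<in> proj G N' ` X"
  then obtain y where y: "y \<in> X" "proj G N' x = proj G N' y" by blast
  then have "proj G N x = proj G N y"
    using proj_mono_eq[OF assms(1) class_normalsD(3)[OF assms(2)] class_normalsD(3)[OF assms(3)] assms(4,5)] assms(6)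
    by blast
  then show False using assms(7) y(1) by blast
qed

section \<open>Conjugacy and quotients\<close>

text \<open>
  Conjugacy written without inverses, since inverses in a wreath product are awkward to compute.
\<close>

definition conj_in :: "('a, 'm) monoid_scheme \<Rightarrow> 'a \<Rightarrow> 'a \<Rightarrow> bool"
  where "conj_in G g h \<longleftrightarrow> (\<exists>x\<in>carrier G. g \<otimes>\<^bsub>G\<^esub> x = x \<otimes>\<^bsub>G\<^esub> h)"

lemma (in group) inv_conj_eq_iff:
  assumes "g \<in> carrier G" "h \<in> carrier G" "x \<in> carrier G"
  shows "inv x \<otimes> g \<otimes> x = h \<longleftrightarrow> g \<otimes> x = x \<otimes> h"
proof
  assume "inv x \<otimes> g \<otimes> x = h"
  then have "x \<otimes> h = x \<otimes> (inv x \<otimes> g \<otimes> x)" by simp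
  also have "\<dots> = (x \<otimes> inv x) \<otimes> (g \<otimes> x)" using assms by (simp only: m_assoc m_closed inv_closed)
  finally show "g \<otimes> x = x \<otimes> h" using assms by simp
next
  assume e: "g \<otimes> x = x \<otimes> h"
  have "inv x \<otimes> g \<otimes> x = inv x \<otimes> (g \<otimes> x)" using assms by (simp add: m_assoc)
  also have "\<dots> = (inv x \<otimes> x) \<otimes> h" unfolding e using assms by (simp only: m_assoc m_closed inv_closed)
  finally show "inv x \<otimes> g \<otimes> x = h" using assms by simp
qed

lemma conj_class_iff:
  assumes "group G" "g \<in> carrier G" "h \<in> carrier G"
  shows "h \<in> conj_class G g \<longleftrightarrow> conj_in G g h"
  using group.inv_conj_eq_iff[OF assms] unfolding conj_class_def conj_in_def by blast

lemma conj_class_subset: "group G \<Longrightarrow> g \<in> carrier G \<Longrightarrow> conj_class G g \<subseteq> carrier G"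
  unfolding conj_class_def by (auto intro!: group.subgroup_self monoid.m_closed group.inv_closed simp: group.is_monoid)

lemma conj_classD:
  assumes "group G" "g \<in> carrier G" "k \<in> conj_class G g"
  shows "k \<in> carrier G" "conj_in G g k"
proof -
  show "k \<in> carrier G" using assms(3) conj_class_subset[OF assms(1,2)] by (rule rev_subsetD)
  then show "conj_in G g k" using conj_class_iff[OF assms(1,2)] assms(3) by simp
qed

lemma conj_in_sym:
  assumes G: "group G" and "g \<in> carrier G" "h \<in> carrier G" "conj_in G g h"
  shows "conj_in G h g"
proof -
  interpret group G by fact
  obtain x where x: "x \<in> carrier G" "g \<otimes>\<^bsub>G\<^esub> x = x \<otimes>\<^bsub>G\<^esub> h" using assms by (auto simp: conj_in_def)
  then have "h = inv\<^bsub>G\<^esub> x \<otimes>\<^bsub>G\<^esub> g \<otimes>\<^bsub>G\<^esub> x" using inv_conj_eq_iff assms by metis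
  then have "h \<otimes>\<^bsub>G\<^esub> inv\<^bsub>G\<^esub> x = inv\<^bsub>G\<^esub> x \<otimes>\<^bsub>G\<^esub> g \<otimes>\<^bsub>G\<^esub> x \<otimes>\<^bsub>G\<^esub> inv\<^bsub>G\<^esub> x" by simp
  also have "\<dots> = inv\<^bsub>G\<^esub> x \<otimes>\<^bsub>G\<^esub> g" using x(1) assms(2) inv_closed[OF x(1)] by (simp only: m_assoc m_closed r_inv r_one)
  finally have "h \<otimes>\<^bsub>G\<^esub> inv\<^bsub>G\<^esub> x = inv\<^bsub>G\<^esub> x \<otimes>\<^bsub>G\<^esub> g" .
  then show ?thesis using x unfolding conj_in_def by (intro bexI[of _ "inv\<^bsub>G\<^esub> x"]) auto
qed

lemma conj_in_hom:
  assumes "\<phi> \<in> hom G H" "g \<in> carrier G" "h \<in> carrier G" "conj_in G g h"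
  shows "conj_in H (\<phi> g) (\<phi> h)"
proof -
  obtain x where x: "x \<in> carrier G" "g \<otimes>\<^bsub>G\<^esub> x = x \<otimes>\<^bsub>G\<^esub> h" using assms by (auto simp: conj_in_def)
  then have "\<phi> g \<otimes>\<^bsub>H\<^esub> \<phi> x = \<phi> x \<otimes>\<^bsub>H\<^esub> \<phi> h" using assms by (metis hom_mult)
  then show ?thesis using x assms unfolding conj_in_def by (metis hom_in_carrier)
qed

lemma proj_conj_class_iff:
  assumes G: "group G" and N: "N \<lhd> G" and g: "g \<in> carrier G" "h \<in> carrier G"
  shows "proj G N h \<in> proj G N ` conj_class G g \<longleftrightarrow> conj_in (G Mod N) (proj G N g) (proj G N h)"
proof
  assume "proj G N h \<in> proj G N ` conj_class G g"
  then obtain k where k: "k \<in> conj_class G g" "proj G N h = proj G N k" by blast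
  note conj_classD[OF G g(1) k(1)]
  then show "conj_in (G Mod N) (proj G N g) (proj G N h)"
    using conj_in_hom[OF proj_hom[OF N] g(1)] k by simp
next
  interpret group G by fact
  interpret N: normal N G by fact
  interpret Q: group "G Mod N" by (rule N.factorgroup_is_group)
  interpret p: group_hom G "G Mod N" "proj G N"
    using proj_hom[OF N] by (simp add: group_hom_def group_hom_axioms_def is_group Q.is_group)
  assume "conj_in (G Mod N) (proj G N g) (proj G N h)"
  then obtain x where x: "x \<in> carrier G"
    "proj G N g \<otimes>\<^bsub>G Mod N\<^esub> proj G N x = proj G N x \<otimes>\<^bsub>G Mod N\<^esub> proj G N h"
    unfolding conj_in_def by (auto simp: carrier_Mod_proj)
  then have "proj G N h = proj G N (inv\<^bsub>G\<^esub> x \<otimes>\<^bsub>G\<^esub> g \<otimes>\<^bsub>G\<^esub> x)"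
    using Q.inv_conj_eq_iff[of "proj G N g" "proj G N h" "proj G N x"] g p.hom_closed
    by (simp del: mult_FactGroup)
  then show "proj G N h \<in> proj G N ` conj_class G g" using x unfolding conj_class_def by blast
qed

abbreviation conj_separated_within ::
    "nat monoid set \<Rightarrow> ('a, 'm) monoid_scheme \<Rightarrow> nat \<Rightarrow> 'a \<Rightarrow> 'a \<Rightarrow> bool"
  where "conj_separated_within C G k g h \<equiv>
    \<exists>N\<in>class_normals C G. quot_card G N \<le> k \<and> proj G N h \<notin> proj G N ` conj_class G g"

lemma conj_separated_by_hom:
  assumes C: "pseudovariety C" and G: "group G" and Q: "in_class C Q" and \<phi>: "\<phi> \<in> hom G Q"
    and g: "g \<in> carrier G" "h \<in> carrier G" and n: "\<not> conj_in Q (\<phi> g) (\<phi> h)"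
  shows "conj_separated_within C G (order Q) g h"
proof (intro bexI conjI)
  let ?K = "kernel G Q \<phi>"
  show "?K \<in> class_normals C G" "quot_card G ?K \<le> order Q"
    using kernel_class_normal[OF C G Q \<phi>] by auto
  show "proj G ?K h \<notin> proj G ?K ` conj_class G g"
  proof
    assume "proj G ?K h \<in> proj G ?K ` conj_class G g"
    then obtain k where k: "k \<in> conj_class G g" "proj G ?K h = proj G ?K k" by blast
    note k' = conj_classD[OF G g(1) k(1)]
    have "\<phi> h = \<phi> k" using k(2) proj_kernel_eq_iff[OF G in_class_group[OF Q] \<phi> g(2) k'(1)] by simp
    then show False using conj_in_hom[OF \<phi> g(1) k'] n by simp
  qed
qed

section \<open>The wreath product as a group\<close>

definition supp :: "('a, 'm) monoid_scheme \<Rightarrow> ('b, 'n) monoid_scheme \<Rightarrow> ('b \<Rightarrow> 'a) \<Rightarrow> 'b set"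
  where "supp A B f = {x \<in> carrier B. f x \<noteq> \<one>\<^bsub>A\<^esub>}"

lemma base_carrier:
  assumes "group A"
  shows "f \<in> carrier (wreath_base A B) \<longleftrightarrow>
    f \<in> extensional (carrier B) \<and> (\<forall>x\<in>carrier B. f x \<in> carrier A) \<and> finite (supp A B f)"
  using assms by (auto simp: carrier_sum_group PiE_iff supp_def)

locale wreath_pair = A: group A + B: group B
  for A :: "('a, 'm) monoid_scheme" and B :: "('b, 'n) monoid_scheme" (structure)
begin

abbreviation "base \<equiv> carrier (wreath_base A B)"

abbreviation "W \<equiv> wreath A B"

abbreviation base_mult :: "('b \<Rightarrow> 'a) \<Rightarrow> ('b \<Rightarrow> 'a) \<Rightarrow> 'b \<Rightarrow> 'a"  (infixl \<open>\<odot>\<close> 70)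
  where "f \<odot> g \<equiv> f \<otimes>\<^bsub>wreath_base A B\<^esub> g"

lemma base_group: "group (wreath_base A B)"
  by (simp add: A.is_group)

lemma base_mem: "f \<in> base \<Longrightarrow> x \<in> carrier B \<Longrightarrow> f x \<in> carrier A"
  by (simp add: base_carrier A.is_group)

lemma base_eqI:
  assumes "f \<in> base" "g \<in> base" "\<And>x. x \<in> carrier B \<Longrightarrow> f x = g x"
  shows "f = g"
  using assms by (auto simp: base_carrier A.is_group intro: extensionalityI)

lemma supp_finite: "f \<in> base \<Longrightarrow> finite (supp A B f)"
  by (simp add: base_carrier A.is_group)

lemma supp_mult: "supp A B (f \<odot> g) \<subseteq> supp A B f \<union> supp A B g"
  by (auto simp: supp_def)

lemma base_mult_closed:
  "f \<in> base \<Longrightarrow> g \<in> base \<Longrightarrow>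
    f \<odot> g \<in> base"
  by (rule monoid.m_closed[OF group.is_monoid[OF base_group]])

lemma action_apply: "x \<in> carrier B \<Longrightarrow> wreath_action B b f x = f (inv b \<otimes> x)"
  by (simp add: wreath_action_def)

lemma supp_action:
  assumes "b \<in> carrier B"
  shows "supp A B (wreath_action B b f) = (\<lambda>x. b \<otimes> x) ` supp A B f"
proof
  show "supp A B (wreath_action B b f) \<subseteq> (\<lambda>x. b \<otimes> x) ` supp A B f"
  proof
    fix x assume x: "x \<in> supp A B (wreath_action B b f)"
    then have "inv b \<otimes> x \<in> supp A B f" "x \<in> carrier B" using assms by (auto simp: supp_def action_apply)
    moreover have "x = b \<otimes> (inv b \<otimes> x)" using assms calculation by (simp add: B.m_assoc[symmetric])
    ultimately show "x \<in> (\<lambda>x. b \<otimes> x) ` supp A B f" by blast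
  qed
  show "(\<lambda>x. b \<otimes> x) ` supp A B f \<subseteq> supp A B (wreath_action B b f)"
    using assms by (auto simp: supp_def action_apply B.m_assoc[symmetric])
qed

lemma action_closed:
  assumes "b \<in> carrier B" "f \<in> base"
  shows "wreath_action B b f \<in> base"
  using assms supp_action[OF assms(1), of f]
  by (auto simp: base_carrier A.is_group) (auto simp: wreath_action_def)

lemma action_mult:
  assumes "b \<in> carrier B"
  shows "wreath_action B b (f \<odot> g) = wreath_action B b f \<odot> wreath_action B b g"
  using assms by (auto simp: wreath_action_def fun_eq_iff)

lemma action_action:
  assumes "b \<in> carrier B" "c \<in> carrier B"
  shows "wreath_action B b (wreath_action B c f) = wreath_action B (b \<otimes> c) f"
  using assms by (auto simp: wreath_action_def fun_eq_iff B.inv_mult_group B.m_assoc)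

lemma action_one: "f \<in> base \<Longrightarrow> wreath_action B \<one> f = f"
  by (rule base_eqI) (auto simp: action_closed action_apply)

lemma carrier_wreath: "carrier W = base \<times> carrier B"
  by (simp add: wreath_def)

lemma mult_wreath: "(f, b) \<otimes>\<^bsub>W\<^esub> (f', b') = (f \<odot> wreath_action B b f', b \<otimes> b')"
  by (simp add: wreath_def del: mult_sum_group)

lemma one_wreath: "\<one>\<^bsub>W\<^esub> = (\<one>\<^bsub>wreath_base A B\<^esub>, \<one>)"
  by (simp add: wreath_def del: one_sum_group)

lemma wreath_group: "group W"
proof -
  interpret N: group "wreath_base A B" by (rule base_group)
  show ?thesis
  proof (rule groupI)
    fix x y assume "x \<in> carrier W" "y \<in> carrier W"
    then show "x \<otimes>\<^bsub>W\<^esub> y \<in> carrier W"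
      by (cases x; cases y) (simp add: carrier_wreath mult_wreath action_closed del: mult_sum_group)
  next
    show "\<one>\<^bsub>W\<^esub> \<in> carrier W"
      by (simp add: carrier_wreath one_wreath del: one_sum_group)
  next
    fix x y z assume "x \<in> carrier W" "y \<in> carrier W" "z \<in> carrier W"
    then show "x \<otimes>\<^bsub>W\<^esub> y \<otimes>\<^bsub>W\<^esub> z = x \<otimes>\<^bsub>W\<^esub> (y \<otimes>\<^bsub>W\<^esub> z)"
      by (cases x; cases y; cases z)
        (simp add: carrier_wreath mult_wreath action_closed action_mult action_action N.m_assoc B.m_assoc del: mult_sum_group)
  next
    fix x assume "x \<in> carrier W"
    then show "\<one>\<^bsub>W\<^esub> \<otimes>\<^bsub>W\<^esub> x = x"
      by (cases x) (simp add: carrier_wreath mult_wreath one_wreath action_one del: mult_sum_group one_sum_group)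
  next
    fix x assume x: "x \<in> carrier W"
    then obtain f b where fb: "x = (f, b)" "f \<in> base" "b \<in> carrier B"
      by (cases x) (auto simp: carrier_wreath)
    let ?g = "wreath_action B (inv b) (inv\<^bsub>wreath_base A B\<^esub> f)"
    have g: "?g \<in> base" using fb by (simp add: action_closed del: inv_sum_group)
    have "?g \<odot> wreath_action B (inv b) f = wreath_action B (inv b) (inv\<^bsub>wreath_base A B\<^esub> f \<odot> f)"
      using fb by (simp only: action_mult B.inv_closed)
    also have "\<dots> = \<one>\<^bsub>wreath_base A B\<^esub>"
      using fb by (simp only: N.l_inv) (auto simp: wreath_action_def fun_eq_iff)
    finally have "(?g, inv b) \<otimes>\<^bsub>W\<^esub> x = \<one>\<^bsub>W\<^esub>"
      using fb by (simp add: mult_wreath one_wreath del: mult_sum_group one_sum_group inv_sum_group)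
    then show "\<exists>y\<in>carrier W. y \<otimes>\<^bsub>W\<^esub> x = \<one>\<^bsub>W\<^esub>"
      using g fb by (intro bexI[of _ "(?g, inv b)"]) (simp_all add: carrier_wreath)
  qed
qed

lemma conj_in_wreath_iff:
  assumes "f \<in> base" "b \<in> carrier B" "f' \<in> base" "b' \<in> carrier B"
  shows "conj_in W (f, b) (f', b') \<longleftrightarrow>
    (\<exists>c\<in>carrier B. b \<otimes> c = c \<otimes> b' \<and>
      (\<exists>k\<in>base.
        f \<odot> wreath_action B b k = k \<odot> wreath_action B c f'))"
  unfolding conj_in_def carrier_wreath by (auto simp: mult_wreath simp del: mult_sum_group)

lemma snd_hom: "snd \<in> hom W B"
  by (auto simp: hom_def carrier_wreath mult_wreath)

text \<open>
  The identity of the base under a name of its own, since the simplifier unfolds the identity of a sum group.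
\<close>

definition const_one :: "'b \<Rightarrow> 'a" where "const_one = (\<lambda>x\<in>carrier B. \<one>\<^bsub>A\<^esub>)"

lemma const_one: "const_one = \<one>\<^bsub>wreath_base A B\<^esub>" by (simp add: const_one_def)

lemma const_one_mem: "const_one \<in> base"
  unfolding const_one by (rule monoid.one_closed[OF group.is_monoid[OF base_group]])

lemma action_const_one: "b \<in> carrier B \<Longrightarrow> wreath_action B b const_one = const_one"
  by (auto simp: wreath_action_def const_one_def fun_eq_iff)

lemma base_mult_const_one:
  "f \<in> base \<Longrightarrow> f \<odot> const_one = f"
  "f \<in> base \<Longrightarrow> const_one \<odot> f = f"
proof -
  interpret N: group "wreath_base A B" by (rule base_group)
  show "f \<in> base \<Longrightarrow> f \<odot> const_one = f"
    "f \<in> base \<Longrightarrow> const_one \<odot> f = f"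
    unfolding const_one by (simp_all del: mult_sum_group one_sum_group)
qed

definition delta :: "'b \<Rightarrow> 'a \<Rightarrow> 'b \<Rightarrow> 'a"
  where "delta x a = (\<lambda>y\<in>carrier B. if y = x then a else \<one>\<^bsub>A\<^esub>)"

lemma supp_delta: "supp A B (delta x a) \<subseteq> {x}"
  by (auto simp: supp_def delta_def)

lemma delta_mem: "a \<in> carrier A \<Longrightarrow> delta x a \<in> base"
  using finite_subset[OF supp_delta] by (auto simp: base_carrier A.is_group) (auto simp: delta_def)

lemma delta_apply: "y \<in> carrier B \<Longrightarrow> delta x a y = (if y = x then a else \<one>\<^bsub>A\<^esub>)"
  by (simp add: delta_def)

lemma action_delta:
  assumes "b \<in> carrier B" "x \<in> carrier B"
  shows "wreath_action B b (delta x a) = delta (b \<otimes> x) a"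
  using assms by (auto simp: wreath_action_def delta_def fun_eq_iff B.m_assoc[symmetric] B.inv_solve_left)

lemma top_embed_hom: "(\<lambda>b. (const_one, b)) \<in> hom B W"
  by (rule homI) (simp_all add: carrier_wreath mult_wreath const_one_mem action_const_one base_mult_const_one del: mult_sum_group)

lemma wreath_hom:
  assumes P: "wreath_pair A' B'" and \<psi>: "\<psi> \<in> hom (wreath_base A B) (wreath_base A' B')" and \<phi>: "\<phi> \<in> hom B B'"
    and eqv: "\<And>b f. b \<in> carrier B \<Longrightarrow> f \<in> base \<Longrightarrow> \<psi> (wreath_action B b f) = wreath_action B' (\<phi> b) (\<psi> f)"
  shows "(\<lambda>(f, b). (\<psi> f, \<phi> b)) \<in> hom W (wreath A' B')"
proof -
  interpret P': wreath_pair A' B' by (rule P)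
  show ?thesis
    by (rule homI)
     (auto simp: carrier_wreath P'.carrier_wreath mult_wreath P'.mult_wreath eqv action_closed hom_mult[OF \<psi>] hom_mult[OF \<phi>]
        hom_in_carrier[OF \<psi>] hom_in_carrier[OF \<phi>] simp del: mult_sum_group)
qed

lemma order_wreath:
  assumes "finite (carrier B)"
  shows "order W = order A ^ order B * order B"
proof -
  have "base = (\<Pi>\<^sub>E x\<in>carrier B. carrier A)"
    using assms by (auto simp: carrier_sum_group A.is_group)
  then show ?thesis
    by (simp add: order_def carrier_wreath card_cartesian_product card_PiE[OF assms])
qed

text \<open>
  The projection to \<open>B\<close> exhibits the wreath product as an extension of \<open>B\<close> by a power of \<open>A\<close>.
\<close>

lemma in_class_wreath:
  assumes C: "pseudovariety C" "extension_closed C" and A: "in_class C A" and B: "in_class C B"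
  shows "in_class C W"
proof -
  have fin: "finite (carrier A)" "finite (carrier B)" using A B in_class_finite[OF C(1)] by auto
  interpret W: group "W" by (rule wreath_group)
  have c: "base = (\<Pi>\<^sub>E x\<in>carrier B. carrier A)"
    using fin by (auto simp: carrier_sum_group A.is_group)
  have fW: "finite (carrier W)"
    by (simp add: carrier_wreath c fin finite_PiE)
  interpret s: group_hom "W" B snd
    using snd_hom by (simp add: group_hom_def group_hom_axioms_def W.is_group B.is_group)
  have P: "in_class C (product_group (carrier B) (\<lambda>_. A))"
    by (rule in_class_product[OF C(1) fin(2) A])
  have "in_class C (W\<lparr>carrier := kernel W B snd\<rparr>)"
  proof (rule in_class_embed[OF C(1) P])
    show "group (W\<lparr>carrier := kernel W B snd\<rparr>)"
      using s.subgroup_kernel by (simp add: W.subgroup_imp_group)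
    show "fst \<in> hom (W\<lparr>carrier := kernel W B snd\<rparr>) (product_group (carrier B) (\<lambda>_. A))"
      using c by (auto simp: hom_def kernel_def carrier_wreath mult_wreath action_one simp del: mult_sum_group)
        (simp_all)
    show "inj_on fst (carrier (W\<lparr>carrier := kernel W B snd\<rparr>))"
      by (auto simp: inj_on_def kernel_def carrier_wreath)
  qed
  then show ?thesis by (rule in_class_extension[OF C wreath_group fW B snd_hom])
qed

end

section \<open>Conjugacy in wreath products with abelian base\<close>

locale wreath_abelian = wreath_pair A B
  for A :: "('a, 'm) monoid_scheme" and B :: "('b, 'n) monoid_scheme" (structure) +
  assumes comm: "comm_group A"
begin

sublocale A: comm_group A by (rule comm)

abbreviation "cyc b \<equiv> generate B {b}"

lemma base_comm_group: "comm_group (wreath_base A B)"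
proof (rule group.group_comm_groupI[OF base_group])
  fix f g assume "f \<in> base" "g \<in> base"
  then show "f \<odot> g = g \<odot> f"
    by (auto simp: fun_eq_iff base_mem A.m_comm)
qed

sublocale N: comm_group "wreath_base A B" by (rule base_comm_group)

text \<open>
  The product is restricted to the support because the sets \<open>Z\<close> of interest, cosets of cyclic subgroups
  of \<open>B\<close>, are infinite in general.
\<close>

definition mass :: "('b \<Rightarrow> 'a) \<Rightarrow> 'b set \<Rightarrow> 'a"
  where "mass f Z = finprod A f (Z \<inter> supp A B f)"

lemma base_funcset: "f \<in> base \<Longrightarrow> F \<subseteq> carrier B \<Longrightarrow> f \<in> F \<rightarrow> carrier A"
  by (auto simp: base_mem)

lemma mass_closed: "f \<in> base \<Longrightarrow> mass f Z \<in> carrier A"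
  unfolding mass_def by (rule A.finprod_closed) (auto simp: base_mem supp_def)

lemma mass_superset:
  assumes "f \<in> base" "finite F" "Z \<inter> supp A B f \<subseteq> F" "F \<subseteq> Z \<inter> carrier B"
  shows "mass f Z = finprod A f F"
  unfolding mass_def
  by (rule A.finprod_mono_neutral_cong_left) (use assms in \<open>auto simp: supp_def base_mem\<close>)

lemma mass_cong: "Z \<inter> supp A B f = Z' \<inter> supp A B f \<Longrightarrow> mass f Z = mass f Z'"
  by (simp add: mass_def)

lemma mass_mult:
  assumes f: "f \<in> base" and g: "g \<in> base"
  shows "mass (f \<odot> g) Z = mass f Z \<otimes>\<^bsub>A\<^esub> mass g Z"
proof -
  let ?F = "Z \<inter> (supp A B f \<union> supp A B g)"
  have F: "finite ?F" "?F \<subseteq> carrier B" using supp_finite assms by (auto simp: supp_def)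
  have "mass (f \<odot> g) Z = finprod A (f \<odot> g) ?F"
    by (rule mass_superset) (use F supp_mult in \<open>auto simp: base_mult_closed f g simp del: mult_sum_group\<close>)
  also have "\<dots> = finprod A (\<lambda>x. f x \<otimes>\<^bsub>A\<^esub> g x) ?F"
    by (rule A.finprod_cong') (use F in \<open>auto simp: base_mem f g\<close>)
  also have "\<dots> = finprod A f ?F \<otimes>\<^bsub>A\<^esub> finprod A g ?F"
    by (rule A.finprod_multf) (use F in \<open>auto simp: base_mem f g\<close>)
  also have "finprod A f ?F = mass f Z"
    by (rule mass_superset[symmetric]) (use F f in auto)
  also have "finprod A g ?F = mass g Z"
    by (rule mass_superset[symmetric]) (use F g in auto)
  finally show ?thesis .
qed

lemma mass_action:
  assumes b: "b \<in> carrier B" and f: "f \<in> base"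
  shows "mass (wreath_action B b f) Z = mass f {x \<in> carrier B. b \<otimes> x \<in> Z}"
proof -
  let ?S = "{x \<in> carrier B. b \<otimes> x \<in> Z} \<inter> supp A B f"
  have e: "Z \<inter> supp A B (wreath_action B b f) = (\<lambda>x. b \<otimes> x) ` ?S"
    unfolding supp_action[OF b] by (auto simp: supp_def)
  have "mass (wreath_action B b f) Z = finprod A (\<lambda>x. wreath_action B b f (b \<otimes> x)) ?S"
    unfolding mass_def e
    by (rule A.finprod_reindex)
      (use b f in \<open>auto simp: inj_on_def supp_def action_apply B.m_assoc[symmetric] base_mem\<close>)
  also have "\<dots> = finprod A f ?S"
    by (rule A.finprod_cong') (use b f in \<open>auto simp: supp_def action_apply B.m_assoc[symmetric] base_mem\<close>)
  finally show ?thesis by (simp add: mass_def)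
qed

lemma mass_const_one: "mass const_one Z = \<one>\<^bsub>A\<^esub>"
proof -
  have "supp A B const_one = {}" by (auto simp: supp_def const_one_def)
  then show ?thesis by (simp add: mass_def)
qed

lemma mass_delta:
  assumes "a \<in> carrier A" "x \<in> carrier B"
  shows "mass (delta x a) Z = (if x \<in> Z then a else \<one>\<^bsub>A\<^esub>)"
proof -
  have "mass (delta x a) Z = finprod A (delta x a) (if x \<in> Z then {x} else {})"
    using supp_delta[of x a] assms by (intro mass_superset) (auto simp: delta_mem)
  also have "\<dots> = (if x \<in> Z then a else \<one>\<^bsub>A\<^esub>)"
    using assms by (simp add: delta_apply)
  finally show ?thesis .
qed

lemma cyc_subgroup: "b \<in> carrier B \<Longrightarrow> subgroup (cyc b) B"
  by (rule B.generate_is_subgroup) simp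

lemma cyc_closed: "b \<in> carrier B \<Longrightarrow> t \<in> cyc b \<Longrightarrow> t \<in> carrier B"
  using cyc_subgroup subgroup.mem_carrier by metis

lemma cyc_coset_iff:
  assumes "b \<in> carrier B" "z \<in> carrier B" "x \<in> carrier B"
  shows "x \<in> cyc b #> z \<longleftrightarrow> x \<otimes> inv z \<in> cyc b"
  using subgroup.rcos_module[OF cyc_subgroup[OF assms(1)] B.is_group assms(2,3)] .

lemma cyc_coset_carrier: "b \<in> carrier B \<Longrightarrow> z \<in> carrier B \<Longrightarrow> cyc b #> z \<subseteq> carrier B"
  by (rule B.r_coset_subset_G) (auto simp: cyc_closed)

lemma cyc_coset_left:
  assumes "b \<in> carrier B" "z \<in> carrier B" "x \<in> carrier B" "t \<in> cyc b"
  shows "t \<otimes> x \<in> cyc b #> z \<longleftrightarrow> x \<in> cyc b #> z"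
proof -
  have t: "t \<in> carrier B" using assms cyc_closed by blast
  have "t \<otimes> x \<otimes> inv z \<in> cyc b \<longleftrightarrow> x \<otimes> inv z \<in> cyc b"
  proof
    assume "t \<otimes> x \<otimes> inv z \<in> cyc b"
    then have "inv t \<otimes> (t \<otimes> x \<otimes> inv z) \<in> cyc b"
      using cyc_subgroup[OF assms(1)] assms(4) by (metis subgroup.m_closed subgroup.m_inv_closed)
    then show "x \<otimes> inv z \<in> cyc b" using assms t by (simp add: B.m_assoc[symmetric])
  next
    assume "x \<otimes> inv z \<in> cyc b"
    then have "t \<otimes> (x \<otimes> inv z) \<in> cyc b"
      using cyc_subgroup[OF assms(1)] assms(4) by (metis subgroup.m_closed)
    then show "t \<otimes> x \<otimes> inv z \<in> cyc b" using assms t by (simp add: B.m_assoc)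
  qed
  then show ?thesis using assms t by (simp add: cyc_coset_iff)
qed

lemma cyc_self: "b \<in> cyc b" by (simp add: generate.incl)

lemma cyc_conj_iff:
  assumes b: "b \<in> carrier B" "b' \<in> carrier B" and c: "c \<in> carrier B" "b \<otimes> c = c \<otimes> b'"
    and y: "y \<in> carrier B"
  shows "c \<otimes> y \<otimes> inv c \<in> cyc b \<longleftrightarrow> y \<in> cyc b'"
proof -
  define \<kappa> where "\<kappa> y = c \<otimes> y \<otimes> inv c" for y
  have h: "\<kappa> \<in> hom B B"
  proof (rule homI)
    fix x y assume xy: "x \<in> carrier B" "y \<in> carrier B"
    have "\<kappa> x \<otimes> \<kappa> y = c \<otimes> x \<otimes> (inv c \<otimes> c) \<otimes> y \<otimes> inv c"
      unfolding \<kappa>_def using xy c by (simp only: B.m_assoc B.m_closed B.inv_closed)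
    then show "\<kappa> (x \<otimes> y) = \<kappa> x \<otimes> \<kappa> y" using xy c by (simp add: \<kappa>_def B.m_assoc)
  qed (use c in \<open>simp add: \<kappa>_def\<close>)
  interpret \<kappa>: group_hom B B \<kappa> using h by (simp add: group_hom_def group_hom_axioms_def B.is_group)
  have "\<kappa> b' = b" using b c by (simp add: \<kappa>_def flip: c(2)) (simp add: B.m_assoc)
  then have im: "\<kappa> ` cyc b' = cyc b" using \<kappa>.generate_img[of "{b'}"] b by simp
  have inj: "inj_on \<kappa> (carrier B)" using c by (auto simp: inj_on_def \<kappa>_def)
  show ?thesis
    unfolding \<kappa>_def[symmetric] im[symmetric]
    using inj_on_image_mem_iff[OF inj y, of "cyc b'"] cyc_closed[OF b(2)] by blast
qed

text \<open>
  Translation by \<open>b\<close> permutes each right coset of \<open>\<langle>b\<rangle>\<close>.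
\<close>

lemma mass_coset_action_invariant:
  assumes "b \<in> carrier B" "z \<in> carrier B" "k \<in> base"
  shows "mass (wreath_action B b k) (cyc b #> z) = mass k (cyc b #> z)"
  using assms cyc_coset_left[OF assms(1,2) _ cyc_self] cyc_coset_carrier[OF assms(1,2)]
  by (simp add: mass_action) (intro mass_cong, auto)

text \<open>
  If \<open>b c = c b'\<close>, then left translation by \<open>c\<close> maps the coset of \<open>z\<close> under \<open>\<langle>b'\<rangle>\<close> onto the coset of
  \<open>c z\<close> under \<open>\<langle>b\<rangle>\<close>.
\<close>

lemma mass_coset_conj:
  assumes b: "b \<in> carrier B" "b' \<in> carrier B" and c: "c \<in> carrier B" "b \<otimes> c = c \<otimes> b'"
    and z: "z \<in> carrier B" and f: "f \<in> base"
  shows "mass (wreath_action B c f) (cyc b #> (c \<otimes> z)) = mass f (cyc b' #> z)"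
proof -
  have "c \<otimes> x \<in> cyc b #> (c \<otimes> z) \<longleftrightarrow> x \<in> cyc b' #> z" if x: "x \<in> carrier B" for x
  proof -
    have "c \<otimes> x \<otimes> inv (c \<otimes> z) = c \<otimes> (x \<otimes> inv z) \<otimes> inv c"
      using x c z by (simp add: B.inv_mult_group B.m_assoc)
    then show ?thesis
      using x c z b cyc_conj_iff[OF b c, of "x \<otimes> inv z"] by (simp add: cyc_coset_iff)
  qed
  then show ?thesis
    unfolding mass_action[OF c(1) f] using cyc_coset_carrier[OF b(2) z] by (intro mass_cong) auto
qed

text \<open>
  Coboundaries for the action of \<open>b\<close>: the base elements \<open>k (b \<cdot> k)\<^sup>-\<^sup>1\<close>. Conjugating \<open>(f, b)\<close> by base elements
  changes \<open>f\<close> exactly by coboundaries.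
\<close>

definition cob :: "'b \<Rightarrow> ('b \<Rightarrow> 'a) set"
  where "cob b = {g \<in> base. \<exists>k\<in>base. g \<odot> wreath_action B b k = k}"

lemma mass_cob:
  assumes "b \<in> carrier B" "g \<in> cob b" "z \<in> carrier B"
  shows "mass g (cyc b #> z) = \<one>\<^bsub>A\<^esub>"
proof -
  obtain k where k: "g \<in> base" "k \<in> base" "g \<odot> wreath_action B b k = k"
    using assms by (auto simp: cob_def)
  have "mass g (cyc b #> z) \<otimes>\<^bsub>A\<^esub> mass k (cyc b #> z) = mass k (cyc b #> z)"
    using mass_mult[OF k(1) action_closed[OF assms(1) k(2)], of "cyc b #> z"]
      mass_coset_action_invariant[OF assms(1,3) k(2)] by (simp only: k(3))
  then show ?thesis using mass_closed k by simp
qed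

lemma cob_mult:
  assumes b: "b \<in> carrier B" and "g \<in> cob b" "h \<in> cob b"
  shows "g \<odot> h \<in> cob b"
proof -
  obtain k l where k: "g \<in> base" "k \<in> base" "g \<odot> wreath_action B b k = k"
    and l: "h \<in> base" "l \<in> base" "h \<odot> wreath_action B b l = l"
    using assms by (auto simp: cob_def simp del: mult_sum_group)
  note [simp del] = mult_sum_group
  have "g \<odot> h \<odot> wreath_action B b (k \<odot> l)
    = (g \<odot> wreath_action B b k) \<odot> (h \<odot> wreath_action B b l)"
    using k(1,2) l(1,2) action_closed[OF b] by (simp add: action_mult[OF b] N.m_ac)
  also have "\<dots> = k \<odot> l" using k l by simp
  finally show ?thesis using k l unfolding cob_def by (auto intro!: bexI[of _ "k \<odot> l"])
qed

lemma cob_one: "b \<in> carrier B \<Longrightarrow> const_one \<in> cob b"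
proof -
  assume b: "b \<in> carrier B"
  have "const_one \<odot> wreath_action B b const_one = const_one"
    by (simp only: action_const_one[OF b] base_mult_const_one(1)[OF const_one_mem])
  then show "const_one \<in> cob b" using const_one_mem unfolding cob_def by blast
qed

text \<open>
  Moving a value \<open>a\<close> from \<open>x\<close> to \<open>b x\<close> is the coboundary of \<open>delta x a\<close>. Being movable is an
  equivalence relation on points, so a value may be moved along a whole coset.
\<close>

lemma cob_transfer:
  assumes b: "b \<in> carrier B" and t: "t \<in> cyc b" and x: "x \<in> carrier B" and a: "a \<in> carrier A"
  shows "delta x a \<odot> delta (t \<otimes> x) (inv\<^bsub>A\<^esub> a) \<in> cob b"
proof -
  note [simp del] = mult_sum_group
  define R where "R x y \<longleftrightarrow> (\<forall>a\<in>carrier A. delta x a \<odot> delta y (inv\<^bsub>A\<^esub> a) \<in> cob b)" for x y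
  have canc: "delta y (inv\<^bsub>A\<^esub> a) \<odot> delta y a = const_one" if "a \<in> carrier A" for y a
    using that by (auto simp: mult_sum_group delta_def const_one_def fun_eq_iff)
  have Rrefl: "R x x" for x
    unfolding R_def using canc cob_one[OF b] delta_mem by (auto simp: N.m_comm)
  have Rsym: "R y x" if "R x y" for x y
    unfolding R_def
  proof
    fix a assume a: "a \<in> carrier A"
    then have "delta x (inv\<^bsub>A\<^esub> a) \<odot> delta y (inv\<^bsub>A\<^esub> (inv\<^bsub>A\<^esub> a)) \<in> cob b"
      using that unfolding R_def by blast
    then show "delta y a \<odot> delta x (inv\<^bsub>A\<^esub> a) \<in> cob b"
      using a by (simp add: N.m_comm delta_mem)
  qed
  have Rtrans: "R x z" if "R x y" "R y z" for x y z
    unfolding R_def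
  proof
    fix a assume a: "a \<in> carrier A"
    note d = delta_mem[OF a] delta_mem[OF A.inv_closed[OF a]]
    have "(delta x a \<odot> delta y (inv\<^bsub>A\<^esub> a)) \<odot>
       (delta y a \<odot> delta z (inv\<^bsub>A\<^esub> a)) \<in> cob b"
      using that a cob_mult[OF b] unfolding R_def by blast
    also have "(delta x a \<odot> delta y (inv\<^bsub>A\<^esub> a)) \<odot>
       (delta y a \<odot> delta z (inv\<^bsub>A\<^esub> a))
      = (delta x a \<odot> delta z (inv\<^bsub>A\<^esub> a)) \<odot> (delta y (inv\<^bsub>A\<^esub> a) \<odot> delta y a)"
      using d by (simp add: N.m_ac)
    also have "\<dots> = delta x a \<odot> delta z (inv\<^bsub>A\<^esub> a)"
      unfolding canc[OF a] using d by (simp add: base_mult_const_one)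
    finally show "delta x a \<odot> delta z (inv\<^bsub>A\<^esub> a) \<in> cob b" .
  qed
  have Rb: "R x (b \<otimes> x)" if x: "x \<in> carrier B" for x
    unfolding R_def
  proof
    fix a assume a: "a \<in> carrier A"
    note d = delta_mem[OF a] delta_mem[OF A.inv_closed[OF a]]
    have "delta x a \<odot> delta (b \<otimes> x) (inv\<^bsub>A\<^esub> a) \<odot> wreath_action B b (delta x a) = delta x a"
      using d by (simp add: action_delta[OF b x] N.m_assoc canc[OF a] base_mult_const_one)
    then show "delta x a \<odot> delta (b \<otimes> x) (inv\<^bsub>A\<^esub> a) \<in> cob b"
      using d unfolding cob_def by (auto intro!: bexI[of _ "delta x a"])
  qed
  have "R x (t \<otimes> x)" if "x \<in> carrier B" for x
    using t that
  proof (induction t arbitrary: x rule: generate.induct)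
    case one
    then show ?case using Rrefl by simp
  next
    case (incl h)
    then show ?case using Rb by simp
  next
    case (inv h)
    then have h: "h = b" by simp
    have "R (inv b \<otimes> x) (b \<otimes> (inv b \<otimes> x))" using Rb b inv by simp
    also have "b \<otimes> (inv b \<otimes> x) = x" using b inv by (simp add: B.m_assoc[symmetric])
    finally show ?case using Rsym h by simp
  next
    case (eng h1 h2)
    have h: "h1 \<in> carrier B" "h2 \<in> carrier B" using eng cyc_closed[OF b] by auto
    have "R x (h2 \<otimes> x)" "R (h2 \<otimes> x) (h1 \<otimes> (h2 \<otimes> x))"
      using eng h by simp_all
    then have "R x (h1 \<otimes> (h2 \<otimes> x))" by (rule Rtrans)
    then show ?case using h eng.prems by (simp add: B.m_assoc)
  qed
  then show ?thesis using x a unfolding R_def by blast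
qed

text \<open>
  A nontrivial value cannot be alone in its coset when all coset products vanish. Moving it onto another
  support point of the same coset shrinks the support, which drives the induction.
\<close>

lemma cobI_mass:
  assumes b: "b \<in> carrier B" and g: "g \<in> base" and "\<And>z. z \<in> carrier B \<Longrightarrow> mass g (cyc b #> z) = \<one>\<^bsub>A\<^esub>"
  shows "g \<in> cob b"
  using g assms(3)
proof (induction "card (supp A B g)" arbitrary: g rule: less_induct)
  case less
  note g = less.prems(1)
  note [simp del] = mult_sum_group
  show ?case
  proof (cases "supp A B g = {}")
    case True
    then have "g = const_one"
      by (intro base_eqI[OF g const_one_mem]) (auto simp: supp_def const_one_def)
    then show ?thesis using cob_one[OF b] by simp
  next
    case False
    then obtain x where x: "x \<in> supp A B g" by blast
    then have xB: "x \<in> carrier B" and gx: "g x \<in> carrier A" "g x \<noteq> \<one>\<^bsub>A\<^esub>" by (auto simp: supp_def g base_mem)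
    have xx: "x \<in> cyc b #> x" using xB b by (simp add: cyc_coset_iff generate.one)
    have "\<exists>y \<in> supp A B g. y \<in> cyc b #> x \<and> y \<noteq> x"
    proof (rule ccontr)
      assume "\<not> ?thesis"
      then have "(cyc b #> x) \<inter> supp A B g = {x}" using x xx by blast
      then have "mass g (cyc b #> x) = g x" using gx by (simp add: mass_def)
      then show False using less.prems(2)[OF xB] gx by simp
    qed
    then obtain y where y: "y \<in> supp A B g" "y \<in> cyc b #> x" "y \<noteq> x" by blast
    then have yB: "y \<in> carrier B" by (simp add: supp_def)
    define t where "t = y \<otimes> inv x"
    have t: "t \<in> cyc b" "t \<otimes> x = y" using y(2) yB xB b unfolding t_def
      by (simp_all add: cyc_coset_iff B.m_assoc)
    define a where "a = g x"
    have a: "a \<in> carrier A" using gx by (simp add: a_def)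
    define u where "u = delta x a \<odot> delta y (inv\<^bsub>A\<^esub> a)"
    define v where "v = delta x (inv\<^bsub>A\<^esub> a) \<odot> delta y a"
    have u: "u \<in> cob b" unfolding u_def using cob_transfer[OF b t(1) xB a] t(2) by simp
    have v: "v \<in> cob b" unfolding v_def using cob_transfer[OF b t(1) xB A.inv_closed[OF a]] t(2) a by simp
    have uvb: "u \<in> base" "v \<in> base" using u v by (auto simp: cob_def)
    have uv: "v \<odot> u = const_one"
      using a xB yB y(3) by (auto simp: u_def v_def mult_sum_group fun_eq_iff const_one_def delta_def)
    define g' where "g' = g \<odot> v"
    have g': "g' \<in> base" unfolding g'_def using g uvb by simp
    have m: "mass g' (cyc b #> z) = \<one>\<^bsub>A\<^esub>" if "z \<in> carrier B" for z
      unfolding g'_def using mass_mult[OF g uvb(2)] mass_cob[OF b v that] less.prems(2)[OF that] by simp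
    have "supp A B g' \<subseteq> supp A B g - {x}"
    proof
      fix w assume w: "w \<in> supp A B g'"
      then have wB: "w \<in> carrier B" by (simp add: supp_def)
      have gw: "g' w = g w \<otimes>\<^bsub>A\<^esub> (delta x (inv\<^bsub>A\<^esub> a) w \<otimes>\<^bsub>A\<^esub> delta y a w)"
        using wB by (simp add: g'_def v_def mult_sum_group)
      have "w \<noteq> x" using w gw xB y(3) a by (auto simp: supp_def delta_apply a_def)
      moreover have "w \<in> supp A B g"
      proof (cases "w = y")
        case True then show ?thesis using y by simp
      next
        case False
        then have "g' w = g w" using gw wB \<open>w \<noteq> x\<close> base_mem[OF g wB] by (simp add: delta_apply)
        then show ?thesis using w by (simp add: supp_def)
      qed
      ultimately show "w \<in> supp A B g - {x}" by blast
    qed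
    then have "supp A B g' \<subset> supp A B g" using x by blast
    then have "card (supp A B g') < card (supp A B g)" by (rule psubset_card_mono[OF supp_finite[OF g]])
    then have "g' \<in> cob b" using less.hyps g' m by blast
    then have "g' \<odot> u \<in> cob b" using u by (rule cob_mult[OF b])
    also have "g' \<odot> u = g"
      unfolding g'_def using g uvb uv by (simp add: N.m_assoc base_mult_const_one)
    finally show ?thesis .
  qed
qed

text \<open>
  The element \<open>c\<close> is the top part of a conjugator. Given \<open>c\<close>, a base part exists iff \<open>f\<close> and the
  translate of \<open>f'\<close> by \<open>c\<close> differ by a coboundary, that is, have equal coset products.
\<close>

theorem conj_in_wreath_abelian_iff:
  assumes f: "f \<in> base" and b: "b \<in> carrier B" and f': "f' \<in> base" and b': "b' \<in> carrier B"
  shows "conj_in W (f, b) (f', b') \<longleftrightarrow>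
    (\<exists>c\<in>carrier B. b \<otimes> c = c \<otimes> b' \<and>
      (\<forall>z\<in>carrier B. mass f (cyc b #> (c \<otimes> z)) = mass f' (cyc b' #> z)))"
proof -
  note [simp del] = mult_sum_group
  have "(\<exists>k\<in>base. f \<odot> wreath_action B b k = k \<odot> wreath_action B c f')
    \<longleftrightarrow> (\<forall>z\<in>carrier B. mass f (cyc b #> (c \<otimes> z)) = mass f' (cyc b' #> z))"
    if c: "c \<in> carrier B" "b \<otimes> c = c \<otimes> b'" for c
  proof
    assume "\<exists>k\<in>base. f \<odot> wreath_action B b k = k \<odot> wreath_action B c f'"
    then obtain k where k: "k \<in> base" "f \<odot> wreath_action B b k = k \<odot> wreath_action B c f'"
      by blast
    show "\<forall>z\<in>carrier B. mass f (cyc b #> (c \<otimes> z)) = mass f' (cyc b' #> z)"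
    proof
      fix z assume z: "z \<in> carrier B"
      let ?Z = "cyc b #> (c \<otimes> z)"
      have cz: "c \<otimes> z \<in> carrier B" using c z by simp
      have "mass f ?Z \<otimes>\<^bsub>A\<^esub> mass k ?Z = mass k ?Z \<otimes>\<^bsub>A\<^esub> mass f' (cyc b' #> z)"
        using mass_mult[OF f action_closed[OF b k(1)], of ?Z] mass_mult[OF k(1) action_closed[OF c(1) f'], of ?Z]
          mass_coset_action_invariant[OF b cz k(1)] mass_coset_conj[OF b b' c z f'] k(2) by simp
      then show "mass f ?Z = mass f' (cyc b' #> z)"
        using mass_closed[OF f] mass_closed[OF f'] mass_closed[OF k(1)] by (simp add: A.m_comm)
    qed
  next
    assume m: "\<forall>z\<in>carrier B. mass f (cyc b #> (c \<otimes> z)) = mass f' (cyc b' #> z)"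
    define d where "d = wreath_action B c f'"
    have d: "d \<in> base" unfolding d_def using action_closed[OF c(1) f'] .
    define g where "g = f \<odot> inv\<^bsub>wreath_base A B\<^esub> d"
    have id: "inv\<^bsub>wreath_base A B\<^esub> d \<in> base" using d by (rule N.inv_closed)
    have g: "g \<in> base" unfolding g_def using f id by (rule N.m_closed)
    have gd: "g \<odot> d = f" unfolding g_def using f d id by (simp add: N.m_assoc del: inv_sum_group one_sum_group)
    have "mass g (cyc b #> w) = \<one>\<^bsub>A\<^esub>" if w: "w \<in> carrier B" for w
    proof -
      let ?z = "inv c \<otimes> w" and ?Z = "cyc b #> w"
      have z: "?z \<in> carrier B" "c \<otimes> ?z = w" using c w by (simp_all add: B.m_assoc[symmetric])
      have "mass g ?Z \<otimes>\<^bsub>A\<^esub> mass d ?Z = mass f ?Z" using mass_mult[OF g d] gd by simp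
      also have "\<dots> = mass d ?Z" using m[rule_format, OF z(1)] mass_coset_conj[OF b b' c z(1) f'] z(2) d_def by simp
      finally show ?thesis using mass_closed[OF g] mass_closed[OF d] by simp
    qed
    then have "g \<in> cob b" using cobI_mass[OF b g] by blast
    then obtain k where k: "k \<in> base" "g \<odot> wreath_action B b k = k" by (auto simp: cob_def)
    have "f \<odot> wreath_action B b k = (g \<odot> wreath_action B b k) \<odot> d"
      unfolding gd[symmetric] using g d action_closed[OF b k(1)] by (simp add: N.m_ac)
    then show "\<exists>k\<in>base. f \<odot> wreath_action B b k = k \<odot> wreath_action B c f'"
      using k unfolding d_def by (intro bexI[of _ k]) auto
  qed
  then show ?thesis unfolding conj_in_wreath_iff[OF f b f' b'] by blast
qed

end

section \<open>Pushing a wreath product forward to quotients of its factors\<close>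

locale wreath_push = wreath_abelian A B + A': comm_group A' + B': group B' +
    \<psi>: group_hom A A' \<psi> + \<phi>: group_hom B B' \<phi>
  for A :: "('a, 'm) monoid_scheme" and B :: "('b, 'n) monoid_scheme" (structure)
    and A' :: "('c, 'k) monoid_scheme" and B' :: "('d, 'l) monoid_scheme" and \<psi> \<phi> +
  assumes surj: "\<phi> ` carrier B = carrier B'"
begin

sublocale P: wreath_abelian A' B'
  by unfold_locales

text \<open>
  Collapsing \<open>B\<close> multiplies the values on each fibre, which makes sense because \<open>A\<close> is abelian.
\<close>

definition push :: "('b \<Rightarrow> 'a) \<Rightarrow> 'd \<Rightarrow> 'c"
  where "push f = (\<lambda>y\<in>carrier B'. \<psi> (mass f {x \<in> carrier B. \<phi> x = y}))"

lemma push_apply: "y \<in> carrier B' \<Longrightarrow> push f y = \<psi> (mass f {x \<in> carrier B. \<phi> x = y})"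
  by (simp add: push_def)

lemma supp_push: "f \<in> base \<Longrightarrow> supp A' B' (push f) \<subseteq> \<phi> ` supp A B f"
proof
  fix y assume f: "f \<in> base" and y: "y \<in> supp A' B' (push f)"
  then have "y \<in> carrier B'" "\<psi> (mass f {x \<in> carrier B. \<phi> x = y}) \<noteq> \<one>\<^bsub>A'\<^esub>"
    by (auto simp: supp_def push_apply)
  then have "{x \<in> carrier B. \<phi> x = y} \<inter> supp A B f \<noteq> {}" by (auto simp: mass_def)
  then show "y \<in> \<phi> ` supp A B f" by blast
qed

lemma push_closed:
  assumes f: "f \<in> base"
  shows "push f \<in> P.base"
proof -
  have "finite (supp A' B' (push f))"
    using finite_subset[OF supp_push[OF f]] supp_finite[OF f] by blast
  then show ?thesis
    unfolding base_carrier[OF A'.is_group] by (simp add: push_apply mass_closed[OF f]) (simp add: push_def)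
qed

lemma hom_finprod:
  assumes "finite F" "f \<in> F \<rightarrow> carrier A"
  shows "\<psi> (finprod A f F) = finprod A' (\<lambda>x. \<psi> (f x)) F"
  using assms by (induction F rule: finite_induct) (auto simp: Pi_iff)

text \<open>
  Multiplying the fibre products over \<open>Z\<close> multiplies all values over the preimage of \<open>Z\<close>.
\<close>

lemma mass_push:
  assumes f: "f \<in> base"
  shows "P.mass (push f) Z = \<psi> (mass f {x \<in> carrier B. \<phi> x \<in> Z})"
proof -
  let ?F = "{x \<in> supp A B f. \<phi> x \<in> Z}"
  let ?Fy = "\<lambda>y. {x \<in> ?F. \<phi> x = y}"
  have "?F \<subseteq> supp A B f" by blast
  from finite_subset[OF this supp_finite[OF f]] have F: "finite ?F" "?F \<subseteq> carrier B" by (auto simp: supp_def)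
  have fib: "push f y = \<psi> (finprod A f (?Fy y))" if "y \<in> \<phi> ` ?F" for y
  proof -
    have "{x \<in> carrier B. \<phi> x = y} \<inter> supp A B f = ?Fy y" using that by (auto simp: supp_def)
    moreover have "y \<in> carrier B'" using that F by auto
    ultimately show ?thesis by (simp add: push_apply mass_def)
  qed
  have cl: "finprod A f (?Fy y) \<in> carrier A" for y
    by (rule A.finprod_closed) (use F f in \<open>auto simp: base_mem\<close>)
  have fin: "finite (?Fy y)" for y by (rule finite_subset[OF _ F(1)]) blast
  have "P.mass (push f) Z = finprod A' (push f) (\<phi> ` ?F)"
    by (rule P.mass_superset) (use F supp_push[OF f] push_closed[OF f] in auto)
  also have "\<dots> = finprod A' (\<lambda>y. \<psi> (finprod A f (?Fy y))) (\<phi> ` ?F)"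
    by (rule A'.finprod_cong') (use fib cl in auto)
  also have "\<dots> = \<psi> (finprod A (\<lambda>y. finprod A f (?Fy y)) (\<phi> ` ?F))"
    by (rule hom_finprod[symmetric]) (use F cl in auto)
  also have "finprod A (\<lambda>y. finprod A f (?Fy y)) (\<phi> ` ?F) = finprod A f (\<Union>y\<in>\<phi> ` ?F. ?Fy y)"
    by (rule A.finprod_UN_disjoint[symmetric]) (use F f fin in \<open>auto simp: base_mem disjnt_def pairwise_def simp del: finite_Collect_conjI\<close>)
  also have "(\<Union>y\<in>\<phi> ` ?F. ?Fy y) = {x \<in> carrier B. \<phi> x \<in> Z} \<inter> supp A B f" by (auto simp: supp_def)
  finally show ?thesis by (simp add: mass_def)
qed

lemma push_hom: "push \<in> hom (wreath_base A B) (wreath_base A' B')"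
proof (rule homI)
  fix f g assume fg: "f \<in> base" "g \<in> base"
  show "push (f \<odot> g) = push f \<otimes>\<^bsub>wreath_base A' B'\<^esub> push g"
  proof (rule P.base_eqI)
    show "push (f \<odot> g) \<in> P.base"
      by (rule push_closed[OF N.m_closed[OF fg]])
    show "push f \<otimes>\<^bsub>wreath_base A' B'\<^esub> push g \<in> P.base"
      by (rule P.N.m_closed[OF push_closed push_closed]) (use fg in auto)
    fix y assume y: "y \<in> carrier B'"
    show "push (f \<odot> g) y = (push f \<otimes>\<^bsub>wreath_base A' B'\<^esub> push g) y"
      using y fg mass_mult[OF fg] by (simp add: push_apply mass_closed)
  qed
qed (rule push_closed)

lemma push_action:
  assumes b: "b \<in> carrier B" and f: "f \<in> base"
  shows "push (wreath_action B b f) = wreath_action B' (\<phi> b) (push f)"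
proof (rule P.base_eqI)
  show "push (wreath_action B b f) \<in> P.base" by (rule push_closed[OF action_closed[OF b f]])
  show "wreath_action B' (\<phi> b) (push f) \<in> P.base" using P.action_closed push_closed[OF f] b by simp
  fix y assume y: "y \<in> carrier B'"
  have "{x \<in> carrier B. b \<otimes> x \<in> {x \<in> carrier B. \<phi> x = y}} = {x \<in> carrier B. \<phi> x = inv\<^bsub>B'\<^esub> \<phi> b \<otimes>\<^bsub>B'\<^esub> y}"
    using b y by (auto simp: B'.inv_solve_left)
  then show "push (wreath_action B b f) y = wreath_action B' (\<phi> b) (push f) y"
    using b y f by (simp add: push_apply mass_action P.action_apply)
qed

lemma push_wreath_hom: "(\<lambda>(f, b). (push f, \<phi> b)) \<in> hom W (wreath A' B')"
  by (rule wreath_hom[OF P.wreath_pair_axioms push_hom \<phi>.homh push_action])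

text \<open>
  The preimage in \<open>B\<close> of a coset of the cyclic group generated by \<open>\<phi> b\<close>, that is, the coset of \<open>z\<close> thickened by
  the kernel of \<open>\<phi>\<close>.
\<close>

definition fat :: "'b \<Rightarrow> 'b \<Rightarrow> 'b set"
  where "fat b z = {x \<in> carrier B. \<phi> x \<otimes>\<^bsub>B'\<^esub> inv\<^bsub>B'\<^esub> \<phi> z \<in> \<phi> ` cyc b}"

lemma phi_cyc: "b \<in> carrier B \<Longrightarrow> \<phi> ` cyc b = P.cyc (\<phi> b)"
  using \<phi>.generate_img[of "{b}"] by simp

lemma fat_eq:
  assumes "b \<in> carrier B" "z \<in> carrier B"
  shows "{x \<in> carrier B. \<phi> x \<in> P.cyc (\<phi> b) #>\<^bsub>B'\<^esub> \<phi> z} = fat b z"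
  using assms by (auto simp: fat_def P.cyc_coset_iff phi_cyc)

text \<open>
  Thickening a coset does not change the product over it as long as it catches no new support point; this
  is a finite set of conditions on \<open>\<phi>\<close>, each of which separates an element from a cyclic subgroup.
\<close>

lemma mass_fat:
  assumes b: "b \<in> carrier B" and z: "z \<in> carrier B"
    and sep: "\<And>x. x \<in> supp A B f \<Longrightarrow> x \<otimes> inv z \<notin> cyc b \<Longrightarrow> \<phi> (x \<otimes> inv z) \<notin> \<phi> ` cyc b"
  shows "mass f (fat b z) = mass f (cyc b #> z)"
proof (rule mass_cong)
  have "x \<in> fat b z \<longleftrightarrow> x \<in> cyc b #> z" if x: "x \<in> supp A B f" for x
  proof -
    have xB: "x \<in> carrier B" using x by (simp add: supp_def)
    have "x \<in> fat b z \<longleftrightarrow> \<phi> (x \<otimes> inv z) \<in> \<phi> ` cyc b" using xB z by (simp add: fat_def)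
    also have "\<dots> \<longleftrightarrow> x \<otimes> inv z \<in> cyc b" using sep[OF x] by blast
    finally show ?thesis using xB z b by (simp add: cyc_coset_iff)
  qed
  then show "fat b z \<inter> supp A B f = (cyc b #> z) \<inter> supp A B f" by blast
qed

lemma fat_cong: "\<phi> z = \<phi> z' \<Longrightarrow> fat b z = fat b z'"
  by (simp add: fat_def)

lemma fat_shift:
  assumes b: "b \<in> carrier B" and z: "z \<in> carrier B" and t: "t \<in> cyc b"
  shows "fat b (inv t \<otimes> z) = fat b z"
proof -
  have tB: "t \<in> carrier B" by (rule cyc_closed[OF b t])
  have H: "subgroup (\<phi> ` cyc b) B'" using P.cyc_subgroup b phi_cyc by simp
  have "\<phi> x \<otimes>\<^bsub>B'\<^esub> inv\<^bsub>B'\<^esub> \<phi> (inv t \<otimes> z) \<in> \<phi> ` cyc b \<longleftrightarrow> \<phi> x \<otimes>\<^bsub>B'\<^esub> inv\<^bsub>B'\<^esub> \<phi> z \<in> \<phi> ` cyc b"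
    if x: "x \<in> carrier B" for x
  proof -
    let ?u = "\<phi> x \<otimes>\<^bsub>B'\<^esub> inv\<^bsub>B'\<^esub> \<phi> z"
    have e: "\<phi> x \<otimes>\<^bsub>B'\<^esub> inv\<^bsub>B'\<^esub> \<phi> (inv t \<otimes> z) = ?u \<otimes>\<^bsub>B'\<^esub> \<phi> t"
      using x z tB by (simp add: B'.inv_mult_group B'.m_assoc)
    have pt: "\<phi> t \<in> \<phi> ` cyc b" using t by blast
    have "?u = (?u \<otimes>\<^bsub>B'\<^esub> \<phi> t) \<otimes>\<^bsub>B'\<^esub> inv\<^bsub>B'\<^esub> \<phi> t" using x z tB by (simp add: B'.m_assoc)
    then have "?u \<otimes>\<^bsub>B'\<^esub> \<phi> t \<in> \<phi> ` cyc b \<longleftrightarrow> ?u \<in> \<phi> ` cyc b"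
      using subgroup.m_closed[OF H _ pt, of ?u] subgroup.m_closed[OF H _ subgroup.m_inv_closed[OF H pt], of "?u \<otimes>\<^bsub>B'\<^esub> \<phi> t"]
      by auto
    then show ?thesis unfolding e .
  qed
  then show ?thesis by (auto simp: fat_def)
qed

lemma push_conjD:
  assumes f: "f \<in> base" and b: "b \<in> carrier B" and f': "f' \<in> base" and b': "b' \<in> carrier B"
    and "conj_in (wreath A' B') (push f, \<phi> b) (push f', \<phi> b')"
  obtains c where "c \<in> carrier B" "\<phi> (b \<otimes> c) = \<phi> (c \<otimes> b')"
    "\<And>z. z \<in> carrier B \<Longrightarrow> \<psi> (mass f (fat b (c \<otimes> z))) = \<psi> (mass f' (fat b' z))"
proof -
  have "\<phi> b \<in> carrier B'" "\<phi> b' \<in> carrier B'" using b b' by auto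
  from assms(5)[unfolded P.conj_in_wreath_abelian_iff[OF push_closed[OF f] this(1) push_closed[OF f'] this(2)]]
  obtain c' where c': "c' \<in> carrier B'" "\<phi> b \<otimes>\<^bsub>B'\<^esub> c' = c' \<otimes>\<^bsub>B'\<^esub> \<phi> b'"
    "\<forall>z\<in>carrier B'. P.mass (push f) (P.cyc (\<phi> b) #>\<^bsub>B'\<^esub> (c' \<otimes>\<^bsub>B'\<^esub> z)) = P.mass (push f') (P.cyc (\<phi> b') #>\<^bsub>B'\<^esub> z)"
    by blast
  from c'(1)[folded surj] obtain c where c: "c' = \<phi> c" "c \<in> carrier B" by (rule imageE)
  show ?thesis
  proof (rule that[of c])
    show "c \<in> carrier B" by fact
    show "\<phi> (b \<otimes> c) = \<phi> (c \<otimes> b')" using c'(2) c b b' by simp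
    fix z assume z: "z \<in> carrier B"
    then have "P.mass (push f) (P.cyc (\<phi> b) #>\<^bsub>B'\<^esub> \<phi> (c \<otimes> z)) = P.mass (push f') (P.cyc (\<phi> b') #>\<^bsub>B'\<^esub> \<phi> z)"
      using c'(3) c by simp
    then show "\<psi> (mass f (fat b (c \<otimes> z))) = \<psi> (mass f' (fat b' z))"
      unfolding mass_push[OF f] mass_push[OF f'] using fat_eq[OF b' z] fat_eq[OF b, of "c \<otimes> z"] c z
      by (simp del: \<phi>.hom_mult)
  qed
qed

text \<open>
  The heart of the sufficiency proof. A conjugator \<open>c\<close> of the images must move the coset of \<open>x\<^sub>0\<close>, whose product
  stays visible by \<open>ne\<close>, onto a coset that meets the support of \<open>f'\<close> in some \<open>y\<close>. Up to powers of \<open>b'\<close>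
  and up to the kernel of \<open>\<phi>\<close>, it is therefore \<open>x\<^sub>0 y\<^sup>-\<^sup>1\<close>. By \<open>inj\<close> this element conjugates \<open>b\<close> to \<open>b'\<close> in
  \<open>B\<close> itself, and then the coset of \<open>z y\<close> shows a difference that survives in the quotient.
\<close>

lemma push_not_conj:
  assumes f: "f \<in> base" and b: "b \<in> carrier B" and f': "f' \<in> base" and b': "b' \<in> carrier B"
    and x0: "x0 \<in> carrier B"
    and ne: "\<psi> (mass f (cyc b #> x0)) \<noteq> \<one>\<^bsub>A'\<^esub>"
    and sep0: "\<And>x. x \<in> supp A B f \<Longrightarrow> x \<otimes> inv x0 \<notin> cyc b \<Longrightarrow> \<phi> (x \<otimes> inv x0) \<notin> \<phi> ` cyc b"
    and inj: "\<And>y. y \<in> supp A B f' \<Longrightarrow> b \<otimes> (x0 \<otimes> inv y) \<noteq> x0 \<otimes> inv y \<otimes> b' \<Longrightarrow>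
      \<phi> (b \<otimes> (x0 \<otimes> inv y)) \<noteq> \<phi> (x0 \<otimes> inv y \<otimes> b')"
    and z: "\<And>y. y \<in> supp A B f' \<Longrightarrow> b \<otimes> (x0 \<otimes> inv y) = x0 \<otimes> inv y \<otimes> b' \<Longrightarrow>
      z y \<in> carrier B \<and>
      \<psi> (mass f (cyc b #> (x0 \<otimes> inv y \<otimes> z y))) \<noteq> \<psi> (mass f' (cyc b' #> z y)) \<and>
      (\<forall>x\<in>supp A B f. x \<otimes> inv (x0 \<otimes> inv y \<otimes> z y) \<notin> cyc b \<longrightarrow>
        \<phi> (x \<otimes> inv (x0 \<otimes> inv y \<otimes> z y)) \<notin> \<phi> ` cyc b) \<and>
      (\<forall>x\<in>supp A B f'. x \<otimes> inv z y \<notin> cyc b' \<longrightarrow> \<phi> (x \<otimes> inv z y) \<notin> \<phi> ` cyc b')"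
  shows "\<not> conj_in (wreath A' B') (push f, \<phi> b) (push f', \<phi> b')"
proof
  assume "conj_in (wreath A' B') (push f, \<phi> b) (push f', \<phi> b')"
  then obtain c where c: "c \<in> carrier B" "\<phi> (b \<otimes> c) = \<phi> (c \<otimes> b')"
    and m: "\<And>z. z \<in> carrier B \<Longrightarrow> \<psi> (mass f (fat b (c \<otimes> z))) = \<psi> (mass f' (fat b' z))"
    by (rule push_conjD[OF f b f' b']) (rule that)
  \<comment> \<open>The coset of z0 is the one that c carries to the coset of x0.\<close>
  define z0 where "z0 = inv c \<otimes> x0"
  have z0: "z0 \<in> carrier B" "c \<otimes> z0 = x0" using c x0 by (simp_all add: z0_def B.m_assoc[symmetric])
  have "\<psi> (mass f' (fat b' z0)) \<noteq> \<one>\<^bsub>A'\<^esub>"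
    using m[OF z0(1)] z0(2) mass_fat[OF b x0 sep0] ne by simp
  then have "fat b' z0 \<inter> supp A B f' \<noteq> {}" by (auto simp: mass_def)
  then obtain y where y: "y \<in> supp A B f'" "y \<in> fat b' z0" by blast
  then have yB: "y \<in> carrier B" by (simp add: supp_def)
  obtain t where t: "t \<in> cyc b'" "\<phi> y \<otimes>\<^bsub>B'\<^esub> inv\<^bsub>B'\<^esub> \<phi> z0 = \<phi> t" using y(2) by (auto simp: fat_def)
  have tB: "t \<in> carrier B" by (rule cyc_closed[OF b' t(1)])
  define cy where "cy = x0 \<otimes> inv y"
  have cyB: "cy \<in> carrier B" using x0 yB by (simp add: cy_def)
  have tt: "t \<otimes> b' = b' \<otimes> t"
  proof -
    obtain k :: int where "t = b' [^] k" using t(1) B.generate_pow[OF b'] by auto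
    then show ?thesis using b' by (metis B.int_pow_mult B.int_pow_1 add.commute)
  qed
  \<comment> \<open>In the quotient, cy agrees with c corrected by a power of b'.\<close>
  have pcy: "\<phi> cy = \<phi> c \<otimes>\<^bsub>B'\<^esub> inv\<^bsub>B'\<^esub> \<phi> t"
  proof -
    have "\<phi> y = \<phi> t \<otimes>\<^bsub>B'\<^esub> \<phi> z0" using t(2) yB z0(1) tB by (metis B'.inv_solve_right' \<phi>.hom_closed)
    then have "\<phi> cy = \<phi> x0 \<otimes>\<^bsub>B'\<^esub> (inv\<^bsub>B'\<^esub> \<phi> z0 \<otimes>\<^bsub>B'\<^esub> inv\<^bsub>B'\<^esub> \<phi> t)"
      using x0 yB z0(1) tB by (simp add: cy_def B'.inv_mult_group)
    also have "\<phi> x0 = \<phi> c \<otimes>\<^bsub>B'\<^esub> \<phi> z0" using z0 c by (metis \<phi>.hom_mult)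
    finally show ?thesis using c z0(1) tB by (simp add: B'.m_assoc[symmetric]) (simp add: B'.m_assoc)
  qed
  have "\<phi> (b \<otimes> cy) = \<phi> (b \<otimes> c) \<otimes>\<^bsub>B'\<^esub> inv\<^bsub>B'\<^esub> \<phi> t"
    using b c(1) tB cyB by (simp add: pcy B'.m_assoc)
  also have "\<dots> = \<phi> c \<otimes>\<^bsub>B'\<^esub> \<phi> (b' \<otimes> inv t)"
    unfolding c(2) using b' c tB by (simp add: B'.m_assoc)
  also have "b' \<otimes> inv t = inv t \<otimes> b'"
    using tt b' tB by (metis B.inv_solve_left B.inv_solve_right B.m_assoc B.m_closed B.inv_closed)
  also have "\<phi> c \<otimes>\<^bsub>B'\<^esub> \<phi> (inv t \<otimes> b') = \<phi> (cy \<otimes> b')"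
    using b' c tB cyB by (simp add: pcy B'.m_assoc)
  finally have "b \<otimes> cy = cy \<otimes> b'" using inj[OF y(1)] unfolding cy_def[symmetric] by blast
  from z[OF y(1), folded cy_def, OF this] have zy: "z y \<in> carrier B"
    and d: "\<psi> (mass f (cyc b #> (cy \<otimes> z y))) \<noteq> \<psi> (mass f' (cyc b' #> z y))"
    and s: "\<forall>x\<in>supp A B f. x \<otimes> inv (cy \<otimes> z y) \<notin> cyc b \<longrightarrow> \<phi> (x \<otimes> inv (cy \<otimes> z y)) \<notin> \<phi> ` cyc b"
      "\<forall>x\<in>supp A B f'. x \<otimes> inv z y \<notin> cyc b' \<longrightarrow> \<phi> (x \<otimes> inv z y) \<notin> \<phi> ` cyc b'"
    by blast+
  have cz: "cy \<otimes> z y \<in> carrier B" using cyB zy by simp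
  have e1: "mass f (fat b (cy \<otimes> z y)) = mass f (cyc b #> (cy \<otimes> z y))"
    by (rule mass_fat[OF b cz]) (use s(1) in blast)
  have e2: "mass f' (fat b' (z y)) = mass f' (cyc b' #> z y)"
    by (rule mass_fat[OF b' zy]) (use s(2) in blast)
  have "\<phi> (c \<otimes> (inv t \<otimes> z y)) = \<phi> (cy \<otimes> z y)"
    using c tB zy cyB by (simp add: pcy B'.m_assoc)
  then have e3: "fat b (c \<otimes> (inv t \<otimes> z y)) = fat b (cy \<otimes> z y)" by (rule fat_cong)
  have "inv t \<otimes> z y \<in> carrier B" using tB zy by simp
  from m[OF this] show False
    using d e1 e2 e3 fat_shift[OF b' zy t(1)] by simp
qed

end

section \<open>Finitely many tests certify non-conjugacy in a quotient\<close>

context wreath_abelian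
begin

abbreviation separated_mod :: "'b set \<Rightarrow> 'a set \<Rightarrow> ('b \<Rightarrow> 'a) \<times> 'b \<Rightarrow> ('b \<Rightarrow> 'a) \<times> 'b \<Rightarrow> bool"
  where "separated_mod M N g h \<equiv>
    \<exists>\<Phi>\<in>hom W (wreath (A Mod N) (B Mod M)). \<not> conj_in (wreath (A Mod N) (B Mod M)) (\<Phi> g) (\<Phi> h)"

text \<open>
  A list of finitely many demands on quotients of \<open>A\<close> and \<open>B\<close> attached to two pairs. The set \<open>J\<close> holds
  elements to be kept out of cyclic subgroups, \<open>L\<close> pairs in \<open>B\<close> and \<open>P\<close> pairs in \<open>A\<close> to be kept apart. The
  elements of \<open>J\<close> and \<open>L\<close> are short words in the support points, \<open>b\<close> and \<open>b'\<close>, which bounds their length once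
  the supports lie in a ball; those of \<open>P\<close> are masses. The number \<open>n\<close> stands for a bound on the sizes of the
  supports.
\<close>

definition test_data ::
  "('b \<Rightarrow> 'a) \<Rightarrow> 'b \<Rightarrow> ('b \<Rightarrow> 'a) \<Rightarrow> 'b \<Rightarrow> nat \<Rightarrow> ('b \<times> 'b) set \<Rightarrow> ('b \<times> 'b) set \<Rightarrow> ('a \<times> 'a) set \<Rightarrow> bool"
  where "test_data f b f' b' n J L P \<longleftrightarrow>
    finite J \<and> finite L \<and> finite P \<and> card J \<le> n + 2 * n * n \<and> card P \<le> 1 + n \<and>
    (\<forall>(g, h)\<in>J. g \<in> {b, b'} \<and> h \<notin> cyc g \<and>
      (\<exists>u v w t. {u, v, w, t} \<subseteq> supp A B f \<union> supp A B f' \<and> h = u \<otimes> inv v \<otimes> w \<otimes> inv t)) \<and>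
    (\<forall>(u, v)\<in>L. u \<noteq> v \<and> (\<exists>x y g g'. {x, y} \<subseteq> supp A B f \<union> supp A B f' \<and> {g, g'} \<subseteq> {b, b'} \<and>
      u = g \<otimes> (x \<otimes> inv y) \<and> v = x \<otimes> inv y \<otimes> g')) \<and>
    (\<forall>(p, q)\<in>P. p \<noteq> q \<and> {p, q} \<subseteq> insert \<one>\<^bsub>A\<^esub> (range (mass f) \<union> range (mass f')))"

definition passes_tests ::
  "('b \<times> 'b) set \<Rightarrow> ('b \<times> 'b) set \<Rightarrow> ('a \<times> 'a) set \<Rightarrow> 'b set \<Rightarrow> 'a set \<Rightarrow> bool"
  where "passes_tests J L P M N \<longleftrightarrow>
    (\<forall>(g, h)\<in>J. proj B M h \<notin> proj B M ` cyc g) \<and>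
    (\<forall>(u, v)\<in>L. proj B M u \<noteq> proj B M v) \<and>
    (\<forall>(p, q)\<in>P. proj A N p \<noteq> proj A N q)"

lemma test_data_sym: "test_data f b f' b' n J L P \<Longrightarrow> test_data f' b' f b n J L P"
  unfolding test_data_def by (simp add: insert_commute Un_commute)

lemma wreath_push_proj:
  assumes M: "M \<lhd> B" and N: "N \<lhd> A"
  shows "wreath_push A B (A Mod N) (B Mod M) (proj A N) (proj B M)"
proof -
  have 1: "group (B Mod M)" by (rule normal.factorgroup_is_group[OF M])
  have 2: "comm_group (A Mod N)" by (rule A.abelian_FactGroup[OF normal_imp_subgroup[OF N]])
  have 3: "group (A Mod N)" by (rule normal.factorgroup_is_group[OF N])
  have 4: "group_hom A (A Mod N) (proj A N)" "group_hom B (B Mod M) (proj B M)"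
    using proj_hom[OF M] proj_hom[OF N] 1 3
    by (auto simp: group_hom_def group_hom_axioms_def A.is_group B.is_group)
  show ?thesis
    by (intro wreath_push.intro wreath_push_axioms.intro wreath_abelian_axioms 1 2 4 carrier_Mod_proj[symmetric])
qed

text \<open>
  For each support point \<open>y\<close> of \<open>f'\<close> for which the candidate \<open>x\<^sub>0 y\<^sup>-\<^sup>1\<close> conjugates \<open>b\<close> to \<open>b'\<close>, pick one
  coset on which it fails to match the products. One of the two products is nontrivial, so the coset can be
  represented by a support point of \<open>f'\<close> or by a preimage of a support point of \<open>f\<close>. Hence the elements
  to be kept out of cyclic subgroups are words in the support points, and there are at most \<open>n + 2 n\<^sup>2\<close> of them.
\<close>

lemma separating_tests_aux:
  assumes f: "f \<in> base" and b: "b \<in> carrier B" and f': "f' \<in> base" and b': "b' \<in> carrier B"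
    and nc: "\<not> conj_in W (f, b) (f', b')"
    and n: "card (supp A B f) \<le> n" "card (supp A B f') \<le> n"
    and x0: "x0 \<in> supp A B f" "mass f (cyc b #> x0) \<noteq> \<one>\<^bsub>A\<^esub>"
  shows "\<exists>J L P. test_data f b f' b' n J L P \<and>
    (\<forall>M N. M \<lhd> B \<longrightarrow> N \<lhd> A \<longrightarrow> passes_tests J L P M N \<longrightarrow>
      separated_mod M N (f, b) (f', b'))"
proof -
  have sB: "\<And>x. x \<in> supp A B f \<Longrightarrow> x \<in> carrier B" "\<And>x. x \<in> supp A B f' \<Longrightarrow> x \<in> carrier B"
    by (simp_all add: supp_def)
  have x0B: "x0 \<in> carrier B" using x0(1) by (rule sB)
  define cy where "cy y = x0 \<otimes> inv y" for y
  define Y where "Y = {y \<in> supp A B f'. b \<otimes> cy y = cy y \<otimes> b'}"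
  have YB: "y \<in> carrier B" "cy y \<in> carrier B" if "y \<in> Y" for y
    using that sB x0B by (auto simp: Y_def cy_def)
  have "\<forall>y\<in>Y. \<exists>z\<in>carrier B. mass f (cyc b #> (cy y \<otimes> z)) \<noteq> mass f' (cyc b' #> z) \<and>
      (z \<in> supp A B f' \<or> cy y \<otimes> z \<in> supp A B f)"
  proof
    fix y assume y: "y \<in> Y"
    note yB = YB[OF y]
    have "b \<otimes> cy y = cy y \<otimes> b'" using y by (simp add: Y_def)
    then obtain z where z: "z \<in> carrier B" "mass f (cyc b #> (cy y \<otimes> z)) \<noteq> mass f' (cyc b' #> z)"
      using nc yB(2) unfolding conj_in_wreath_abelian_iff[OF f b f' b'] by blast
    show "\<exists>z\<in>carrier B. mass f (cyc b #> (cy y \<otimes> z)) \<noteq> mass f' (cyc b' #> z) \<and>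
      (z \<in> supp A B f' \<or> cy y \<otimes> z \<in> supp A B f)"
    proof (cases "mass f' (cyc b' #> z) = \<one>\<^bsub>A\<^esub>")
      case False
      then have "(cyc b' #> z) \<inter> supp A B f' \<noteq> {}" by (auto simp: mass_def)
      then obtain w where w: "w \<in> cyc b' #> z" "w \<in> supp A B f'" by blast
      have wB: "w \<in> carrier B" using w(2) by (rule sB)
      have e1: "cyc b' #> w = cyc b' #> z"
        by (rule B.repr_independence[OF w(1) z(1) cyc_subgroup[OF b'], symmetric])
      have "b \<otimes> cy y = cy y \<otimes> b'" using y by (simp add: Y_def)
      note cj = cyc_conj_iff[OF b b' yB(2) this, of "w \<otimes> inv z"]
      have "cy y \<otimes> w \<in> cyc b #> (cy y \<otimes> z)"
        using cj w(1) wB z(1) yB b b' by (simp add: cyc_coset_iff B.inv_mult_group B.m_assoc)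
      then have e2: "cyc b #> (cy y \<otimes> w) = cyc b #> (cy y \<otimes> z)"
        using B.repr_independence[OF _ _ cyc_subgroup[OF b], symmetric] yB z(1) by simp
      show ?thesis using z(2) w(2) wB e1 e2 by (intro bexI[of _ w]) auto
    next
      case True
      then have "mass f (cyc b #> (cy y \<otimes> z)) \<noteq> \<one>\<^bsub>A\<^esub>" using z(2) by simp
      then have "(cyc b #> (cy y \<otimes> z)) \<inter> supp A B f \<noteq> {}" by (auto simp: mass_def)
      then obtain w where w: "w \<in> cyc b #> (cy y \<otimes> z)" "w \<in> supp A B f" by blast
      have wB: "w \<in> carrier B" using w(2) by (rule sB)
      define z' where "z' = inv cy y \<otimes> w"
      have z': "z' \<in> carrier B" "cy y \<otimes> z' = w" using wB yB by (simp_all add: z'_def B.m_assoc[symmetric])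
      have cz: "cy y \<otimes> z \<in> carrier B" using yB z(1) by simp
      have e2: "cyc b #> w = cyc b #> (cy y \<otimes> z)"
        by (rule B.repr_independence[OF w(1) cz cyc_subgroup[OF b], symmetric])
      have "b \<otimes> cy y = cy y \<otimes> b'" using y by (simp add: Y_def)
      note cj = cyc_conj_iff[OF b b' yB(2) this, of "z' \<otimes> inv z"]
      have "z' \<in> cyc b' #> z"
        using cj w(1) wB z(1) yB b b' z'(1) unfolding z'(2)[symmetric]
        by (simp add: cyc_coset_iff B.inv_mult_group B.m_assoc)
      then have e1: "cyc b' #> z' = cyc b' #> z"
        using B.repr_independence[OF _ z(1) cyc_subgroup[OF b'], symmetric] by simp
      show ?thesis using z(2) w(2) z' e1 e2 by (intro bexI[of _ z']) auto
    qed
  qed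
  from bchoice[OF this[unfolded Bex_def]] obtain \<zeta> where
    "\<forall>y\<in>Y. \<zeta> y \<in> carrier B \<and>
      mass f (cyc b #> (cy y \<otimes> \<zeta> y)) \<noteq> mass f' (cyc b' #> \<zeta> y) \<and>
      (\<zeta> y \<in> supp A B f' \<or> cy y \<otimes> \<zeta> y \<in> supp A B f)" ..
  then have \<zeta>: "\<And>y. y \<in> Y \<Longrightarrow> \<zeta> y \<in> carrier B"
    "\<And>y. y \<in> Y \<Longrightarrow> mass f (cyc b #> (cy y \<otimes> \<zeta> y)) \<noteq> mass f' (cyc b' #> \<zeta> y)"
    "\<And>y. y \<in> Y \<Longrightarrow> \<zeta> y \<in> supp A B f' \<or> cy y \<otimes> \<zeta> y \<in> supp A B f"
    by simp_all
  \<comment> \<open>J1 isolates the coset of x0; J2 and J3 isolate the chosen coset on the side of f and of f'.\<close>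
  define J1 where "J1 = (\<lambda>x. (b, x \<otimes> inv x0)) ` supp A B f"
  define J2 where "J2 = (\<lambda>(y, x). (b, x \<otimes> inv (cy y \<otimes> \<zeta> y))) ` (Y \<times> supp A B f)"
  define J3 where "J3 = (\<lambda>(y, x). (b', x \<otimes> inv \<zeta> y)) ` (Y \<times> supp A B f')"
  define J where "J = {j \<in> J1 \<union> J2 \<union> J3. snd j \<notin> cyc (fst j)}"
  define L where "L = (\<lambda>y. (b \<otimes> cy y, cy y \<otimes> b')) ` {y \<in> supp A B f'. b \<otimes> cy y \<noteq> cy y \<otimes> b'}"
  define P where "P = insert (mass f (cyc b #> x0), \<one>\<^bsub>A\<^esub>)
    ((\<lambda>y. (mass f (cyc b #> (cy y \<otimes> \<zeta> y)), mass f' (cyc b' #> \<zeta> y))) ` Y)"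
  have fs: "finite (supp A B f)" "finite (supp A B f')" using supp_finite f f' by auto
  have YS: "Y \<subseteq> supp A B f'" by (auto simp: Y_def)
  have fY: "finite Y" "card Y \<le> n"
    using finite_subset[OF YS fs(2)] card_mono[OF fs(2) YS] n by auto
  have fJ: "finite J1" "finite J2" "finite J3" using fs fY by (simp_all add: J1_def J2_def J3_def)
  have "card J1 \<le> card (supp A B f)" unfolding J1_def by (rule card_image_le[OF fs(1)])
  then have cJ1: "card J1 \<le> n" using n by simp
  have "card J2 \<le> card (Y \<times> supp A B f)" unfolding J2_def by (rule card_image_le) (simp add: fY fs)
  also have "\<dots> \<le> n * n" unfolding card_cartesian_product by (rule mult_le_mono[OF fY(2) n(1)])
  finally have cJ2: "card J2 \<le> n * n" .
  have "card J3 \<le> card (Y \<times> supp A B f')" unfolding J3_def by (rule card_image_le) (simp add: fY fs)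
  also have "\<dots> \<le> n * n" unfolding card_cartesian_product by (rule mult_le_mono[OF fY(2) n(2)])
  finally have cJ3: "card J3 \<le> n * n" .
  have "card J \<le> card (J1 \<union> J2 \<union> J3)" unfolding J_def by (rule card_mono) (use fJ in auto)
  also have "\<dots> \<le> card J1 + card J2 + card J3"
    using card_Un_le[of "J1 \<union> J2" J3] card_Un_le[of J1 J2] by linarith
  also have "\<dots> \<le> n + 2 * n * n" using cJ1 cJ2 cJ3 by (simp add: algebra_simps)
  finally have cJ: "card J \<le> n + 2 * n * n" .
  have fJ': "finite J" using fJ unfolding J_def by simp
  have fL: "finite L" using fs unfolding L_def by simp
  have fP: "finite P" using fY unfolding P_def by simp
  have "card P \<le> Suc (card ((\<lambda>y. (mass f (cyc b #> (cy y \<otimes> \<zeta> y)), mass f' (cyc b' #> \<zeta> y))) ` Y))"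
    unfolding P_def by (simp add: card_insert_if fY)
  also have "\<dots> \<le> 1 + n" by (simp add: le_trans[OF card_image_le[OF fY(1)] fY(2)])
  finally have cP: "card P \<le> 1 + n" .
  let ?T = "supp A B f \<union> supp A B f'"
  let ?word = "\<lambda>h. \<exists>u v w t. {u, v, w, t} \<subseteq> ?T \<and> h = u \<otimes> inv v \<otimes> w \<otimes> inv t"
  \<comment> \<open>Words of length two are padded to length four by a trivial pair.\<close>
  have word2: "?word (u \<otimes> inv v)" if "u \<in> ?T" "v \<in> ?T" for u v
  proof -
    have "u \<in> carrier B" "v \<in> carrier B" using that sB by auto
    then have "u \<otimes> inv v = u \<otimes> inv v \<otimes> v \<otimes> inv v" by (simp add: B.m_assoc)
    then show ?thesis using that by (intro exI[of _ u] exI[of _ v]) blast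
  qed
  have word4: "?word (u \<otimes> inv v \<otimes> w \<otimes> inv t)" if "{u, v, w, t} \<subseteq> ?T" for u v w t
    using that by blast
  have w1: "?word (x \<otimes> inv x0)" if "x \<in> supp A B f" for x
    by (rule word2) (use that x0 in auto)
  have w2: "?word (x \<otimes> inv (cy y \<otimes> \<zeta> y))" if x: "x \<in> supp A B f" and y: "y \<in> Y" for x y
    using \<zeta>(3)[OF y]
  proof
    assume z: "\<zeta> y \<in> supp A B f'"
    have "x \<otimes> inv (cy y \<otimes> \<zeta> y) = x \<otimes> inv \<zeta> y \<otimes> y \<otimes> inv x0"
      using sB(1)[OF x] \<zeta>(1)[OF y] YB[OF y] x0B by (simp add: cy_def B.inv_mult_group B.m_assoc)
    then show ?thesis using word4[of x "\<zeta> y" y x0] x z y YS x0(1) by auto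
  qed (rule word2, use x in auto)
  have w3: "?word (x \<otimes> inv \<zeta> y)" if x: "x \<in> supp A B f'" and y: "y \<in> Y" for x y
    using \<zeta>(3)[OF y]
  proof
    assume z: "cy y \<otimes> \<zeta> y \<in> supp A B f"
    have "x \<otimes> inv (cy y \<otimes> \<zeta> y) \<otimes> x0 \<otimes> inv y
        = x \<otimes> inv \<zeta> y \<otimes> (inv cy y \<otimes> cy y)"
      using sB(2)[OF x] \<zeta>(1)[OF y] YB[OF y] x0B
      by (simp add: B.inv_mult_group B.m_assoc del: B.l_inv) (simp add: cy_def)
    also have "\<dots> = x \<otimes> inv \<zeta> y" using sB(2)[OF x] \<zeta>(1)[OF y] YB[OF y] by simp
    finally show ?thesis using word4[of x "cy y \<otimes> \<zeta> y" x0 y] x z y YS x0(1) by auto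
  qed (rule word2, use x in auto)
  have "test_data f b f' b' n J L P"
    unfolding test_data_def
  proof (intro conjI fJ' fL fP cJ cP)
    have "g \<in> {b, b'} \<and> h \<notin> cyc g \<and> ?word h" if j: "(g, h) \<in> J" for g h
    proof -
      have "h \<notin> cyc g" "(g, h) \<in> J1 \<or> (g, h) \<in> J2 \<or> (g, h) \<in> J3" using j by (auto simp: J_def)
      moreover have "g \<in> {b, b'} \<and> ?word h" if "(g, h) \<in> J1"
      proof -
        from that obtain x where "x \<in> supp A B f" "g = b" "h = x \<otimes> inv x0" by (auto simp: J1_def)
        then show ?thesis using w1[of x] by (simp only: insert_iff simp_thms)
      qed
      moreover have "g \<in> {b, b'} \<and> ?word h" if "(g, h) \<in> J2"
      proof -
        from that obtain x y where "x \<in> supp A B f" "y \<in> Y" "g = b" "h = x \<otimes> inv (cy y \<otimes> \<zeta> y)"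
          by (auto simp: J2_def)
        then show ?thesis using w2[of x y] by (simp only: insert_iff simp_thms)
      qed
      moreover have "g \<in> {b, b'} \<and> ?word h" if "(g, h) \<in> J3"
      proof -
        from that obtain x y where "x \<in> supp A B f'" "y \<in> Y" "g = b'" "h = x \<otimes> inv \<zeta> y"
          by (auto simp: J3_def)
        then show ?thesis using w3[of x y] by (simp only: insert_iff simp_thms)
      qed
      ultimately show ?thesis by blast
    qed
    then show "\<forall>(g, h)\<in>J. g \<in> {b, b'} \<and> h \<notin> cyc g \<and> ?word h" by blast
    show "\<forall>(u, v)\<in>L. u \<noteq> v \<and> (\<exists>x y g g'. {x, y} \<subseteq> ?T \<and> {g, g'} \<subseteq> {b, b'} \<and>
      u = g \<otimes> (x \<otimes> inv y) \<and> v = x \<otimes> inv y \<otimes> g')"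
      using x0(1) unfolding L_def cy_def by blast
    show "\<forall>(p, q)\<in>P. p \<noteq> q \<and> {p, q} \<subseteq> insert \<one>\<^bsub>A\<^esub> (range (mass f) \<union> range (mass f'))"
      using x0(2) \<zeta>(2) unfolding P_def by blast
  qed
  moreover have "separated_mod M N (f, b) (f', b')"
    if M: "M \<lhd> B" and N: "N \<lhd> A" and t: "passes_tests J L P M N" for M N
  proof -
    interpret Q: wreath_push A B "A Mod N" "B Mod M" "proj A N" "proj B M"
      by (rule wreath_push_proj[OF M N])
    have tJ: "proj B M h \<notin> proj B M ` cyc g" if "(g, h) \<in> J1 \<union> J2 \<union> J3" "h \<notin> cyc g" for g h
      using t that unfolding passes_tests_def J_def by fastforce
    have tL: "proj B M u \<noteq> proj B M v" if "(u, v) \<in> L" for u v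
      using t that unfolding passes_tests_def by fastforce
    have tP: "proj A N p \<noteq> proj A N q" if "(p, q) \<in> P" for p q
      using t that unfolding passes_tests_def by fastforce
    have "\<not> conj_in (wreath (A Mod N) (B Mod M)) (Q.push f, proj B M b) (Q.push f', proj B M b')"
    proof (rule Q.push_not_conj[OF f b f' b' x0B, where z = \<zeta>])
      show "proj A N (mass f (cyc b #> x0)) \<noteq> \<one>\<^bsub>A Mod N\<^esub>"
        using tP[of "mass f (cyc b #> x0)" "\<one>\<^bsub>A\<^esub>"] unfolding P_def Q.\<psi>.hom_one by simp
      show "proj B M (x \<otimes> inv x0) \<notin> proj B M ` cyc b"
        if "x \<in> supp A B f" "x \<otimes> inv x0 \<notin> cyc b" for x
        by (rule tJ) (use that in \<open>auto simp: J1_def\<close>)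
      show "proj B M (b \<otimes> (x0 \<otimes> inv y)) \<noteq> proj B M (x0 \<otimes> inv y \<otimes> b')"
        if "y \<in> supp A B f'" "b \<otimes> (x0 \<otimes> inv y) \<noteq> x0 \<otimes> inv y \<otimes> b'" for y
        by (rule tL) (use that in \<open>auto simp only: L_def cy_def\<close>)
      fix y assume "y \<in> supp A B f'" "b \<otimes> (x0 \<otimes> inv y) = x0 \<otimes> inv y \<otimes> b'"
      then have y: "y \<in> Y" by (simp add: Y_def cy_def)
      show "\<zeta> y \<in> carrier B \<and>
        proj A N (mass f (cyc b #> (x0 \<otimes> inv y \<otimes> \<zeta> y))) \<noteq> proj A N (mass f' (cyc b' #> \<zeta> y)) \<and>
        (\<forall>x\<in>supp A B f. x \<otimes> inv (x0 \<otimes> inv y \<otimes> \<zeta> y) \<notin> cyc b \<longrightarrow>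
          proj B M (x \<otimes> inv (x0 \<otimes> inv y \<otimes> \<zeta> y)) \<notin> proj B M ` cyc b) \<and>
        (\<forall>x\<in>supp A B f'. x \<otimes> inv \<zeta> y \<notin> cyc b' \<longrightarrow> proj B M (x \<otimes> inv \<zeta> y) \<notin> proj B M ` cyc b')"
        unfolding cy_def[symmetric]
      proof (intro conjI ballI impI)
        show "\<zeta> y \<in> carrier B" by (rule \<zeta>(1)[OF y])
        show "proj A N (mass f (cyc b #> (cy y \<otimes> \<zeta> y))) \<noteq> proj A N (mass f' (cyc b' #> \<zeta> y))"
          by (rule tP) (use y in \<open>auto simp only: P_def\<close>)
        show "proj B M (x \<otimes> inv (cy y \<otimes> \<zeta> y)) \<notin> proj B M ` cyc b"
          if "x \<in> supp A B f" "x \<otimes> inv (cy y \<otimes> \<zeta> y) \<notin> cyc b" for x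
        proof (rule tJ)
          have "(b, x \<otimes> inv (cy y \<otimes> \<zeta> y)) \<in> J2" unfolding J2_def
            using that(1) y by (intro image_eqI[of _ _ "(y, x)"]) auto
          then show "(b, x \<otimes> inv (cy y \<otimes> \<zeta> y)) \<in> J1 \<union> J2 \<union> J3" by blast
        qed (rule that(2))
        show "proj B M (x \<otimes> inv \<zeta> y) \<notin> proj B M ` cyc b'"
          if "x \<in> supp A B f'" "x \<otimes> inv \<zeta> y \<notin> cyc b'" for x
        proof (rule tJ)
          have "(b', x \<otimes> inv \<zeta> y) \<in> J3" unfolding J3_def
            using that(1) y by (intro image_eqI[of _ _ "(y, x)"]) auto
          then show "(b', x \<otimes> inv \<zeta> y) \<in> J1 \<union> J2 \<union> J3" by blast
        qed (rule that(2))
      qed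
    qed
    then show ?thesis using Q.push_wreath_hom by (intro bexI[of _ "\<lambda>(f, b). (Q.push f, proj B M b)"]) simp_all
  qed
  ultimately show ?thesis by blast
qed

text \<open>
  The tests need a coset of \<open>f\<close> with nontrivial product. If there is none, then some coset of \<open>f'\<close> has one,
  since otherwise the two pairs would be conjugate, and the roles of the pairs are exchanged.
\<close>

lemma separating_tests:
  assumes f: "f \<in> base" and b: "b \<in> carrier B" and f': "f' \<in> base" and b': "b' \<in> carrier B"
    and nc: "\<not> conj_in W (f, b) (f', b')"
    and bb': "conj_in B b b'"
    and n: "card (supp A B f) \<le> n" "card (supp A B f') \<le> n"
  shows "\<exists>J L P. test_data f b f' b' n J L P \<and>
    (\<forall>M N. M \<lhd> B \<longrightarrow> N \<lhd> A \<longrightarrow> passes_tests J L P M N \<longrightarrow>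
      separated_mod M N (f, b) (f', b'))"
proof -
  have pick: "\<exists>x\<in>supp A B g. mass g (cyc d #> x) \<noteq> \<one>\<^bsub>A\<^esub>"
    if g: "g \<in> base" and d: "d \<in> carrier B" and z: "z \<in> carrier B" "mass g (cyc d #> z) \<noteq> \<one>\<^bsub>A\<^esub>" for g d z
  proof -
    have "(cyc d #> z) \<inter> supp A B g \<noteq> {}" using z(2) by (auto simp: mass_def)
    then obtain w where w: "w \<in> cyc d #> z" "w \<in> supp A B g" by blast
    have "cyc d #> w = cyc d #> z"
      by (rule B.repr_independence[OF w(1) z(1) cyc_subgroup[OF d], symmetric])
    then show ?thesis using w(2) z(2) by (intro bexI[of _ w]) simp_all
  qed
  obtain c where c: "c \<in> carrier B" "b \<otimes> c = c \<otimes> b'" using bb' by (auto simp: conj_in_def)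
  then obtain z where z: "z \<in> carrier B" "mass f (cyc b #> (c \<otimes> z)) \<noteq> mass f' (cyc b' #> z)"
    using nc unfolding conj_in_wreath_abelian_iff[OF f b f' b'] by blast
  show ?thesis
  proof (cases "mass f (cyc b #> (c \<otimes> z)) = \<one>\<^bsub>A\<^esub>")
    case False
    then obtain x0 where "x0 \<in> supp A B f" "mass f (cyc b #> x0) \<noteq> \<one>\<^bsub>A\<^esub>"
      using pick[OF f b B.m_closed[OF c(1) z(1)]] by blast
    then show ?thesis by (rule separating_tests_aux[OF f b f' b' nc n])
  next
    case True
    then have "mass f' (cyc b' #> z) \<noteq> \<one>\<^bsub>A\<^esub>" using z(2) by simp
    then obtain x0 where x0: "x0 \<in> supp A B f'" "mass f' (cyc b' #> x0) \<noteq> \<one>\<^bsub>A\<^esub>"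
      using pick[OF f' b' z(1)] by blast
    have mem: "(f, b) \<in> carrier W" "(f', b') \<in> carrier W"
      using f f' b b' by (simp_all add: carrier_wreath)
    have nc': "\<not> conj_in W (f', b') (f, b)"
      using nc conj_in_sym[OF wreath_group mem(2,1)] by blast
    from separating_tests_aux[OF f' b' f b nc' n(2,1) x0] obtain J L P where
      t: "test_data f' b' f b n J L P" and
      s: "\<And>M N. M \<lhd> B \<Longrightarrow> N \<lhd> A \<Longrightarrow> passes_tests J L P M N \<Longrightarrow>
      separated_mod M N (f', b') (f, b)" by blast
    have "separated_mod M N (f, b) (f', b')"
      if M: "M \<lhd> B" and N: "N \<lhd> A" and p: "passes_tests J L P M N" for M N
    proof -
      obtain \<Phi> where \<Phi>: "\<Phi> \<in> hom W (wreath (A Mod N) (B Mod M))"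
        "\<not> conj_in (wreath (A Mod N) (B Mod M)) (\<Phi> (f', b')) (\<Phi> (f, b))"
        using s[OF M N p] by blast
      interpret Q: wreath_push A B "A Mod N" "B Mod M" "proj A N" "proj B M"
        by (rule wreath_push_proj[OF M N])
      have "\<not> conj_in (wreath (A Mod N) (B Mod M)) (\<Phi> (f, b)) (\<Phi> (f', b'))"
        using \<Phi>(2) conj_in_sym[OF Q.P.wreath_group hom_in_carrier[OF \<Phi>(1) mem(1)] hom_in_carrier[OF \<Phi>(1) mem(2)]]
        by blast
      then show ?thesis using \<Phi>(1) by blast
    qed
    then show ?thesis using test_data_sym[OF t] by blast
  qed
qed

lemma separating_quotient:
  assumes C: "pseudovariety C" "extension_closed C"
    and M: "M \<in> class_normals C B" and N: "N \<in> class_normals C A"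
    and g: "g \<in> carrier W" "h \<in> carrier W"
    and \<Phi>: "separated_mod M N g h"
  shows "\<exists>K\<in>class_normals C W.
    quot_card W K \<le> quot_card A N ^ quot_card B M * quot_card B M \<and>
    proj W K h \<notin> proj W K ` conj_class W g"
proof -
  have "wreath_pair (A Mod N) (B Mod M)"
    using class_normalsD(1)[OF M] class_normalsD(1)[OF N] by (simp add: wreath_pair_def normal.factorgroup_is_group)
  then interpret Q: wreath_pair "A Mod N" "B Mod M" .
  have Q: "in_class C (wreath (A Mod N) (B Mod M))"
    by (rule Q.in_class_wreath[OF C class_normalsD(2)[OF N] class_normalsD(2)[OF M]])
  have "finite (carrier (B Mod M))" by (rule in_class_finite[OF C(1) class_normalsD(2)[OF M]])
  from Q.order_wreath[OF this] have o: "order (wreath (A Mod N) (B Mod M)) =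
      quot_card A N ^ quot_card B M * quot_card B M"
    by (simp add: order_def carrier_Mod)
  obtain \<Phi> where \<Phi>: "\<Phi>\<in>hom W (wreath (A Mod N) (B Mod M))"
    "\<not> conj_in (wreath (A Mod N) (B Mod M)) (\<Phi> g) (\<Phi> h)" using \<Phi> by blast
  show ?thesis using conj_separated_by_hom[OF C(1) wreath_group Q \<Phi>(1) g \<Phi>(2)] unfolding o .
qed

end

section \<open>Residual properties\<close>

text \<open>
  The version without indices, for groups that need not be finitely generated.
\<close>

lemma class_normals_INT':
  assumes C: "pseudovariety C" and G: "group G" and J: "finite J"
    and ex: "\<And>j. j \<in> J \<Longrightarrow> \<exists>N \<in> class_normals C G. P j N"
    and mono: "\<And>j N N'. j \<in> J \<Longrightarrow> P j N \<Longrightarrow> N' \<subseteq> N \<Longrightarrow> N \<in> class_normals C G \<Longrightarrow> N' \<in> class_normals C G \<Longrightarrow> P j N'"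
  shows "\<exists>N \<in> class_normals C G. \<forall>j\<in>J. P j N"
proof -
  have "\<forall>j\<in>J. \<exists>N. N \<in> class_normals C G \<and> P j N" using ex unfolding Bex_def by simp
  from bchoice[OF this] obtain N where N: "\<forall>j\<in>J. N j \<in> class_normals C G \<and> P j (N j)" ..
  define k where "k = (\<Sum>j\<in>J. quot_card G (N j))"
  have exk: "\<exists>N\<in>class_normals C G. quot_card G N \<le> k \<and> P j N" if j: "j \<in> J" for j
  proof (rule bexI[of _ "N j"])
    have "quot_card G (N j) \<le> k" unfolding k_def using member_le_sum[OF j _ J, of "\<lambda>j. quot_card G (N j)"] by simp
    then show "quot_card G (N j) \<le> k \<and> P j (N j)" using N j by simp
    show "N j \<in> class_normals C G" using N j by simp
  qed
  have "\<exists>N\<in>class_normals C G. quot_card G N \<le> k ^ card J \<and> (\<forall>j\<in>J. P j N)"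
    by (rule class_normals_INT[OF C G J, where P = P]) (erule exk, rule mono)
  then show ?thesis by (elim bexE conjE) (rule bexI)
qed

lemma separableD:
  assumes "separable C G X" "g \<in> carrier G" "g \<notin> X"
  shows "\<exists>N\<in>class_normals C G. proj G N g \<notin> proj G N ` X"
  using assms by (simp add: separable_def)

lemma separableI_conj:
  assumes "group G" "g \<in> carrier G"
    and "\<And>h. h \<in> carrier G \<Longrightarrow> \<not> conj_in G g h \<Longrightarrow> \<exists>N\<in>class_normals C G. proj G N h \<notin> proj G N ` conj_class G g"
  shows "separable C G (conj_class G g)"
  unfolding separable_def
proof (intro conjI ballI conj_class_subset[OF assms(1,2)])
  fix h assume "h \<in> carrier G - conj_class G g"
  then show "\<exists>N\<in>class_normals C G. proj G N h \<notin> proj G N ` conj_class G g"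
    using conj_class_iff[OF assms(1,2), of h] by (intro assms(3)) auto
qed

lemma conjugacy_separableD:
  assumes "group G" "conjugacy_separable C G" "g \<in> carrier G" "h \<in> carrier G" "\<not> conj_in G g h"
  shows "\<exists>N\<in>class_normals C G. proj G N h \<notin> proj G N ` conj_class G g"
  by (rule separableD) (use assms conj_class_iff[OF assms(1,3,4)] in \<open>auto simp: conjugacy_separable_def\<close>)

text \<open>
  The class of the identity is a singleton, so separating conjugacy classes separates elements.
\<close>

lemma residually_separable:
  assumes G: "group G" and cs: "conjugacy_separable C G" and gh: "g \<in> carrier G" "h \<in> carrier G" "g \<noteq> h"
  shows "\<exists>N\<in>class_normals C G. proj G N g \<noteq> proj G N h"
proof -
  interpret group G by fact
  let ?d = "g \<otimes>\<^bsub>G\<^esub> inv\<^bsub>G\<^esub> h"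
  have d: "?d \<in> carrier G" "?d \<noteq> \<one>\<^bsub>G\<^esub>"
    using gh by (auto simp: inv_solve_right')
  have "\<not> conj_in G \<one>\<^bsub>G\<^esub> ?d" using d by (auto simp: conj_in_def)
  from conjugacy_separableD[OF G cs one_closed d(1) this]
  obtain N where N: "N \<in> class_normals C G" "proj G N ?d \<notin> proj G N ` conj_class G \<one>\<^bsub>G\<^esub>" by blast
  have "\<one>\<^bsub>G\<^esub> \<in> conj_class G \<one>\<^bsub>G\<^esub>" unfolding conj_class_def by force
  then have "proj G N ?d \<noteq> proj G N \<one>\<^bsub>G\<^esub>" using N(2) by force
  then have "?d \<notin> N" using proj_eq_iff[OF G class_normalsD(3)[OF N(1)] d(1) one_closed] d(1) by simp
  then show ?thesis using proj_eq_iff[OF G class_normalsD(3)[OF N(1)] gh(1,2)] by (intro bexI[OF _ N(1)]) simp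
qed

lemma residually_injective:
  assumes C: "pseudovariety C" and G: "group G" and cs: "conjugacy_separable C G"
    and F: "finite F" "F \<subseteq> carrier G"
  shows "\<exists>N\<in>class_normals C G. inj_on (proj G N) F"
proof -
  let ?J = "{(g, h) \<in> F \<times> F. g \<noteq> h}"
  have sJ: "fst j \<in> carrier G" "snd j \<in> carrier G" if "j \<in> ?J" for j using that F(2) by auto
  have "\<exists>N\<in>class_normals C G. \<forall>j\<in>?J. proj G N (fst j) \<noteq> proj G N (snd j)"
  proof (rule class_normals_INT'[OF C G])
    show "finite ?J" by (rule finite_subset[of _ "F \<times> F"]) (use F in auto)
    fix j assume "j \<in> ?J"
    then have j: "fst j \<in> carrier G" "snd j \<in> carrier G" "fst j \<noteq> snd j" using F(2) by auto
    obtain N where "N \<in> class_normals C G" "proj G N (fst j) \<noteq> proj G N (snd j)"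
      using residually_separable[OF G cs j] by blast
    then show "\<exists>N\<in>class_normals C G. proj G N (fst j) \<noteq> proj G N (snd j)"
      by (rule bexI[rotated])
  next
    fix j N N' assume j: "j \<in> ?J" and P: "proj G N (fst j) \<noteq> proj G N (snd j)"
      and N: "N' \<subseteq> N" "N \<in> class_normals C G" "N' \<in> class_normals C G"
    show "proj G N' (fst j) \<noteq> proj G N' (snd j)"
      using proj_mono_eq[OF G class_normalsD(3)[OF N(2)] class_normalsD(3)[OF N(3)] N(1) sJ[OF j]] P by blast
  qed
  then obtain N where N: "N \<in> class_normals C G" "\<forall>j\<in>?J. proj G N (fst j) \<noteq> proj G N (snd j)" by blast
  have "inj_on (proj G N) F"
  proof (rule inj_onI, rule ccontr)
    fix x y assume xy: "x \<in> F" "y \<in> F" "proj G N x = proj G N y" "x \<noteq> y"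
    then show False using N(2)[rule_format, of "(x, y)"] by auto
  qed
  then show ?thesis using N(1) by (intro bexI[of _ N])
qed

lemma finite_conjugacy_separable_in_class:
  assumes C: "pseudovariety C" and G: "group G" and cs: "conjugacy_separable C G" and f: "finite (carrier G)"
  shows "in_class C G"
proof -
  obtain N where N: "N \<in> class_normals C G" "inj_on (proj G N) (carrier G)"
    using residually_injective[OF C G cs f subset_refl] by blast
  show ?thesis
    by (rule in_class_embed[OF C class_normalsD(2)[OF N(1)] G proj_hom[OF class_normalsD(1)[OF N(1)]] N(2)])
qed

lemma in_class_one_normal:
  assumes C: "pseudovariety C" and G: "in_class C G"
  shows "\<exists>N\<in>class_normals C G. quot_card G N \<le> order G \<and> inj_on (proj G N) (carrier G)"
proof (intro bexI conjI)
  have gr: "group G" by (rule in_class_group[OF G])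
  have id: "id \<in> hom G G" by (simp add: hom_def)
  let ?K = "kernel G G id"
  show "?K \<in> class_normals C G" "quot_card G ?K \<le> order G"
    by (rule kernel_class_normal[OF C gr G id])+
  show "inj_on (proj G ?K) (carrier G)"
    using proj_kernel_eq_iff[OF gr gr id] by (simp add: inj_on_def)
qed

section \<open>Balls in the word metric\<close>

abbreviation "gens G S \<equiv> S \<union> m_inv G ` S"
abbreviation "word_value G w \<equiv> foldr (\<otimes>\<^bsub>G\<^esub>) w \<one>\<^bsub>G\<^esub>"

lemma gens_closed: "group G \<Longrightarrow> fin_gen_set G S \<Longrightarrow> gens G S \<subseteq> carrier G"
  by (auto simp: fin_gen_set_def subset_iff)

lemma word_value_closed: "group G \<Longrightarrow> set w \<subseteq> carrier G \<Longrightarrow> word_value G w \<in> carrier G"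
  by (induction w) (auto simp: group.is_monoid monoid.m_closed monoid.one_closed)

lemma word_value_append:
  assumes "group G" shows "set v \<subseteq> carrier G \<Longrightarrow> set w \<subseteq> carrier G \<Longrightarrow> word_value G (v @ w) = word_value G v \<otimes>\<^bsub>G\<^esub> word_value G w"
proof (induction v)
  case Nil
  then show ?case using word_value_closed[OF assms, of w] assms by (simp add: group.is_monoid)
next
  case (Cons a v)
  then show ?case using word_value_closed[OF assms, of w] word_value_closed[OF assms, of v] assms
    by (simp add: group.is_monoid monoid.m_assoc)
qed

lemma word_value_inv:
  assumes G: "group G" shows "set w \<subseteq> carrier G \<Longrightarrow> word_value G (rev (map (m_inv G) w)) = inv\<^bsub>G\<^esub> (word_value G w)"
proof (induction w)
  case Nil
  then show ?case using G by (simp add: group.is_monoid monoid.inv_one)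
next
  case (Cons a w)
  interpret group G by fact
  have s: "set (rev (map (m_inv G) w)) \<subseteq> carrier G" "set [inv\<^bsub>G\<^esub> a] \<subseteq> carrier G" using Cons.prems by auto
  have "word_value G (rev (map (m_inv G) (a # w))) = inv\<^bsub>G\<^esub> (word_value G w) \<otimes>\<^bsub>G\<^esub> inv\<^bsub>G\<^esub> a"
    using word_value_append[OF G s] Cons by simp
  then show ?case using Cons.prems word_value_closed[OF G, of w] by (simp add: inv_mult_group)
qed

lemma exists_word:
  assumes G: "group G" and S: "fin_gen_set G S" and g: "g \<in> carrier G"
  shows "\<exists>w. set w \<subseteq> gens G S \<and> word_value G w = g"
proof -
  interpret group G by fact
  have "g \<in> generate G S" using S g by (simp add: fin_gen_set_def)
  then show ?thesis
  proof (induction rule: generate.induct)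
    case one
    show ?case by (rule exI[of _ "[]"]) simp
  next
    case (incl h)
    then have "h \<in> carrier G" using S by (auto simp: fin_gen_set_def)
    then show ?case using incl by (intro exI[of _ "[h]"]) simp
  next
    case (inv h)
    then have "h \<in> carrier G" using S by (auto simp: fin_gen_set_def)
    then show ?case using inv by (intro exI[of _ "[inv\<^bsub>G\<^esub> h]"]) simp
  next
    case (eng h1 h2)
    then obtain v w where vw: "set v \<subseteq> gens G S" "word_value G v = h1" "set w \<subseteq> gens G S" "word_value G w = h2" by blast
    have "word_value G (v @ w) = h1 \<otimes>\<^bsub>G\<^esub> h2"
      using word_value_append[OF G order_trans[OF vw(1) gens_closed[OF G S]] order_trans[OF vw(3) gens_closed[OF G S]]] vw(2,4) by simp
    then show ?case using vw by (intro exI[of _ "v @ w"]) simp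
  qed
qed

lemma word_ball_iff:
  assumes G: "group G" and S: "fin_gen_set G S"
  shows "g \<in> word_ball G S n \<longleftrightarrow> (\<exists>w. length w \<le> n \<and> set w \<subseteq> gens G S \<and> word_value G w = g)"
proof
  assume g: "g \<in> word_ball G S n"
  let ?Q = "\<lambda>k. \<exists>w. length w = k \<and> set w \<subseteq> gens G S \<and> word_value G w = g"
  have gc: "g \<in> carrier G" "word_length G S g \<le> n" using g by (simp_all add: word_ball_def)
  obtain w where "set w \<subseteq> gens G S" "word_value G w = g" using exists_word[OF G S gc(1)] by blast
  then have "?Q (length w)" by (intro exI[of _ w]) simp
  then have "?Q (word_length G S g)" unfolding word_length_def by (rule LeastI)
  then show "\<exists>w. length w \<le> n \<and> set w \<subseteq> gens G S \<and> word_value G w = g" using gc(2) by (elim exE conjE) (intro exI conjI, auto)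
next
  assume "\<exists>w. length w \<le> n \<and> set w \<subseteq> gens G S \<and> word_value G w = g"
  then obtain w where w: "length w \<le> n" "set w \<subseteq> gens G S" "word_value G w = g" by blast
  have "g \<in> carrier G" using word_value_closed[OF G order_trans[OF w(2) gens_closed[OF G S]]] w(3) by simp
  moreover have "word_length G S g \<le> length w"
    unfolding word_length_def by (rule Least_le) (use w in blast)
  ultimately show "g \<in> word_ball G S n" using w(1) by (simp add: word_ball_def)
qed

lemma word_ball_closed: "g \<in> word_ball G S n \<Longrightarrow> g \<in> carrier G"
  by (simp add: word_ball_def)

lemma word_ball_mono: "m \<le> n \<Longrightarrow> word_ball G S m \<subseteq> word_ball G S n"
  by (auto simp: word_ball_def)

lemma word_ball_mono': "g \<in> word_ball G S m \<Longrightarrow> m \<le> n \<Longrightarrow> g \<in> word_ball G S n"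
  by (auto simp: word_ball_def)

lemma word_ball_finite:
  assumes G: "group G" and S: "fin_gen_set G S"
  shows "finite (word_ball G S n)"
proof -
  have "finite (gens G S)" using S by (simp add: fin_gen_set_def)
  then have "finite {w. set w \<subseteq> gens G S \<and> length w \<le> n}" by (rule finite_lists_length_le)
  then show ?thesis
    by (rule finite_surj[where f = "word_value G"]) (auto simp: word_ball_iff[OF G S])
qed

lemma word_ball_mult:
  assumes G: "group G" and S: "fin_gen_set G S" and "g \<in> word_ball G S m" "h \<in> word_ball G S n"
  shows "g \<otimes>\<^bsub>G\<^esub> h \<in> word_ball G S (m + n)"
proof -
  obtain v where v: "length v \<le> m" "set v \<subseteq> gens G S" "word_value G v = g"
    using assms(3) unfolding word_ball_iff[OF G S] by blast
  obtain w where w: "length w \<le> n" "set w \<subseteq> gens G S" "word_value G w = h"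
    using assms(4) unfolding word_ball_iff[OF G S] by blast
  have "word_value G (v @ w) = g \<otimes>\<^bsub>G\<^esub> h"
    using word_value_append[OF G order_trans[OF v(2) gens_closed[OF G S]] order_trans[OF w(2) gens_closed[OF G S]]] v w by simp
  then show ?thesis unfolding word_ball_iff[OF G S] using v w by (intro exI[of _ "v @ w"]) simp
qed

lemma word_ball_inv:
  assumes G: "group G" and S: "fin_gen_set G S" and "g \<in> word_ball G S n"
  shows "inv\<^bsub>G\<^esub> g \<in> word_ball G S n"
proof -
  obtain w where w: "length w \<le> n" "set w \<subseteq> gens G S" "word_value G w = g"
    using assms(3) unfolding word_ball_iff[OF G S] by blast
  have "S \<subseteq> carrier G" using S by (simp add: fin_gen_set_def)
  then have "m_inv G ` gens G S \<subseteq> gens G S"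
    using group.is_monoid[OF G] by (auto simp: group.inv_inv[OF G] image_iff subset_iff)
  then have "set (rev (map (m_inv G) w)) \<subseteq> gens G S" using image_mono[OF w(2)] by (simp only: set_rev set_map) (rule order_trans)
  moreover have "word_value G (rev (map (m_inv G) w)) = inv\<^bsub>G\<^esub> g"
    using word_value_inv[OF G order_trans[OF w(2) gens_closed[OF G S]]] w(3) by simp
  ultimately show ?thesis unfolding word_ball_iff[OF G S] using w(1) by (intro exI[of _ "rev (map (m_inv G) w)"]) simp
qed

lemma word_ball_one:
  assumes G: "group G" and S: "fin_gen_set G S"
  shows "\<one>\<^bsub>G\<^esub> \<in> word_ball G S n"
  unfolding word_ball_iff[OF G S] by (rule exI[of _ "[]"]) simp

lemma word_ball_0:
  assumes G: "group G" and S: "fin_gen_set G S"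
  shows "word_ball G S 0 = {\<one>\<^bsub>G\<^esub>}"
  using word_ball_one[OF G S, of 0] word_ball_iff[OF G S, of _ 0] by auto

lemma word_ball_gens:
  assumes G: "group G" and S: "fin_gen_set G S" and "s \<in> gens G S"
  shows "s \<in> word_ball G S 1"
proof -
  have "s \<in> carrier G" using gens_closed[OF G S] assms(3) by (rule subsetD)
  then show ?thesis unfolding word_ball_iff[OF G S] using assms(3) G
    by (intro exI[of _ "[s]"]) (simp add: group.is_monoid)
qed

lemma word_ball_induct:
  assumes G: "group G" and S: "fin_gen_set G S" and g: "g \<in> word_ball G S n"
    and one: "P 0 \<one>\<^bsub>G\<^esub>"
    and step: "\<And>n s h. s \<in> gens G S \<Longrightarrow> h \<in> word_ball G S n \<Longrightarrow> P n h \<Longrightarrow> P (Suc n) (s \<otimes>\<^bsub>G\<^esub> h)"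
    and mono: "\<And>m n h. P m h \<Longrightarrow> m \<le> n \<Longrightarrow> P n h"
  shows "P n g"
proof -
  obtain w where w: "length w \<le> n" "set w \<subseteq> gens G S" "word_value G w = g"
    using g unfolding word_ball_iff[OF G S] by blast
  have "P (length w) (word_value G w)" using w(2)
  proof (induction w)
    case Nil
    then show ?case using one by simp
  next
    case (Cons s w)
    then have "word_value G w \<in> word_ball G S (length w)"
      unfolding word_ball_iff[OF G S] by (intro exI[of _ w]) simp
    then show ?case using step[of s "word_value G w" "length w"] Cons by simp
  qed
  then show ?thesis using mono[OF _ w(1)] w(3) by simp
qed

lemma finite_subset_word_ball:
  assumes "finite F" "F \<subseteq> carrier G"
  shows "\<exists>c. F \<subseteq> word_ball G S c"
proof
  show "F \<subseteq> word_ball G S (\<Sum>g\<in>F. word_length G S g)"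
    using assms by (auto simp: word_ball_def intro: member_le_sum)
qed

section \<open>The quantifying functions\<close>

lemma depth_witness:
  assumes "\<exists>N\<in>class_normals C G. proj G N g \<notin> proj G N ` X"
  shows "\<exists>N\<in>class_normals C G. quot_card G N = depth C G X g \<and> proj G N g \<notin> proj G N ` X"
proof -
  have "{quot_card G N | N. N \<in> class_normals C G \<and> proj G N g \<notin> proj G N ` X} \<noteq> {}"
    using assms by blast
  from Inf_nat_def1[OF this] show ?thesis unfolding depth_def by (elim CollectE exE conjE) (rule bexI, auto)
qed

lemma depth_le:
  assumes "N \<in> class_normals C G" "proj G N g \<notin> proj G N ` X"
  shows "depth C G X g \<le> quot_card G N"
  unfolding depth_def by (rule cInf_lower) (use assms in auto)

lemma Max_insert_le_iff:
  assumes "finite F" "finite E" "D = {d x y | x y. x \<in> F \<and> y \<in> E \<and> P x y}"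
  shows "finite (insert (1::nat) D)" "x \<in> F \<Longrightarrow> y \<in> E \<Longrightarrow> P x y \<Longrightarrow> d x y \<le> Max (insert 1 D)"
    "1 \<le> Max (insert 1 D)"
    "1 \<le> k \<Longrightarrow> (\<And>x y. x \<in> F \<Longrightarrow> y \<in> E \<Longrightarrow> P x y \<Longrightarrow> d x y \<le> k) \<Longrightarrow> Max (insert 1 D) \<le> k"
proof -
  have "D \<subseteq> (\<lambda>(x, y). d x y) ` (F \<times> E)" using assms(3) by auto
  then show f: "finite (insert (1::nat) D)" using assms(1,2) finite_subset by blast
  show "x \<in> F \<Longrightarrow> y \<in> E \<Longrightarrow> P x y \<Longrightarrow> d x y \<le> Max (insert 1 D)"
    by (rule Max_ge[OF f]) (use assms(3) in blast)
  show "1 \<le> Max (insert 1 D)" by (rule Max_ge[OF f]) simp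
  show "1 \<le> k \<Longrightarrow> (\<And>x y. x \<in> F \<Longrightarrow> y \<in> E \<Longrightarrow> P x y \<Longrightarrow> d x y \<le> k) \<Longrightarrow> Max (insert 1 D) \<le> k"
    by (rule Max.boundedI[OF f]) (use assms(3) in auto)
qed

context
  fixes G :: "('a, 'm) monoid_scheme" and S and C :: "nat monoid set"
  assumes G: "group G" and S: "fin_gen_set G S"
begin

private lemma Conj_set: "{depth C G (conj_class G g) h | g h.
      g \<in> word_ball G S n \<and> h \<in> word_ball G S n \<and> h \<notin> conj_class G g} =
  {depth C G (conj_class G g) h | g h. g \<in> word_ball G S n \<and> h \<in> word_ball G S n \<and> \<not> conj_in G g h}"
proof -
  have "g \<in> word_ball G S n \<and> h \<in> word_ball G S n \<and> h \<notin> conj_class G g \<longleftrightarrow>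
      g \<in> word_ball G S n \<and> h \<in> word_ball G S n \<and> \<not> conj_in G g h" for g h
    using conj_class_iff[OF G, of g h] word_ball_closed[of g G S n] word_ball_closed[of h G S n] by argo
  then show ?thesis by simp
qed

private lemma Conj_Max: "Conj_fun C G S n = Max (insert 1 {depth C G (conj_class G g) h | g h.
    g \<in> word_ball G S n \<and> h \<in> word_ball G S n \<and> \<not> conj_in G g h})"
  unfolding Conj_fun_def Conj_set ..

private lemmas fin = word_ball_finite[OF G S]

lemma Conj_fun_ge_1: "1 \<le> Conj_fun C G S n"
  unfolding Conj_Max by (rule Max_insert_le_iff(3)[OF fin fin refl])

lemma Conj_fun_witness:
  assumes "conjugacy_separable C G" "g \<in> word_ball G S n" "h \<in> word_ball G S n" "\<not> conj_in G g h"
  shows "conj_separated_within C G (Conj_fun C G S n) g h"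
proof -
  obtain N where N: "N \<in> class_normals C G" "quot_card G N = depth C G (conj_class G g) h"
    "proj G N h \<notin> proj G N ` conj_class G g"
    using depth_witness[OF conjugacy_separableD[OF G assms(1) word_ball_closed[OF assms(2)] word_ball_closed[OF assms(3)] assms(4)]]
    by blast
  have "depth C G (conj_class G g) h \<le> Conj_fun C G S n"
    unfolding Conj_Max by (rule Max_insert_le_iff(2)[OF fin fin refl]) (use assms in auto)
  then show ?thesis using N by (intro bexI[of _ N]) auto
qed

lemma Conj_fun_le:
  assumes "1 \<le> k" and "\<And>g h. g \<in> word_ball G S n \<Longrightarrow> h \<in> word_ball G S n \<Longrightarrow> \<not> conj_in G g h \<Longrightarrow>
    conj_separated_within C G k g h"
  shows "Conj_fun C G S n \<le> k"
  unfolding Conj_Max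
proof (rule Max_insert_le_iff(4)[OF fin fin refl assms(1)])
  fix g h assume "g \<in> word_ball G S n" "h \<in> word_ball G S n" "\<not> conj_in G g h"
  from assms(2)[OF this] obtain N where N: "N \<in> class_normals C G" "quot_card G N \<le> k" "proj G N h \<notin> proj G N ` conj_class G g"
    by blast
  show "depth C G (conj_class G g) h \<le> k" using depth_le[OF N(1,3)] N(2) by (rule order_trans)
qed

lemma Conj_fun_mono:
  assumes "m \<le> n" "conjugacy_separable C G"
  shows "Conj_fun C G S m \<le> Conj_fun C G S n"
  by (rule Conj_fun_le[OF Conj_fun_ge_1])
    (rule Conj_fun_witness[OF assms(2)], auto intro: word_ball_mono'[OF _ assms(1)])

lemma Conj_fun_0: "Conj_fun C G S 0 \<le> 1"
proof (rule Conj_fun_le)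
  fix g h assume "g \<in> word_ball G S 0" "h \<in> word_ball G S 0" "\<not> conj_in G g h"
  moreover have "conj_in G \<one>\<^bsub>G\<^esub> \<one>\<^bsub>G\<^esub>" unfolding conj_in_def
    using G by (intro bexI[of _ "\<one>\<^bsub>G\<^esub>"]) (simp_all add: group.is_monoid)
  ultimately show "conj_separated_within C G 1 g h"
    unfolding word_ball_0[OF G S] by simp
qed simp

lemma Cyclic_fun_ge_1: "1 \<le> Cyclic_fun C G S n"
  unfolding Cyclic_fun_def by (rule Max_insert_le_iff(3)[OF fin fin refl])

lemma Cyclic_fun_depth:
  assumes "g \<in> word_ball G S n" "h \<in> word_ball G S n" "h \<notin> generate G {g}"
  shows "depth C G (generate G {g}) h \<le> Cyclic_fun C G S n"
  unfolding Cyclic_fun_def by (rule Max_insert_le_iff(2)[OF fin fin refl]) (use assms in auto)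

lemma Cyclic_fun_witness:
  assumes "cyclic_subgroup_separable C G" "g \<in> word_ball G S n" "h \<in> word_ball G S n" "h \<notin> generate G {g}"
  shows "\<exists>N\<in>class_normals C G. quot_card G N \<le> Cyclic_fun C G S n \<and> proj G N h \<notin> proj G N ` generate G {g}"
proof -
  have "separable C G (generate G {g})"
    using assms(1) word_ball_closed[OF assms(2)] by (simp add: cyclic_subgroup_separable_def)
  from depth_witness[OF separableD[OF this word_ball_closed[OF assms(3)] assms(4)]]
  obtain N where "N \<in> class_normals C G" "quot_card G N = depth C G (generate G {g}) h"
    "proj G N h \<notin> proj G N ` generate G {g}" by blast
  then show ?thesis using Cyclic_fun_depth[OF assms(2-4)] by (intro bexI[of _ N]) auto
qed

lemma Cyclic_fun_mono:
  assumes "m \<le> n"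
  shows "Cyclic_fun C G S m \<le> Cyclic_fun C G S n"
proof -
  have "Max (insert 1 {depth C G (generate G {g}) h | g h.
      g \<in> word_ball G S m \<and> h \<in> word_ball G S m \<and> h \<notin> generate G {g}}) \<le> Cyclic_fun C G S n"
    by (rule Max_insert_le_iff(4)[OF fin fin refl Cyclic_fun_ge_1])
      (rule Cyclic_fun_depth, auto intro: word_ball_mono'[OF _ assms])
  then show ?thesis by (simp only: Cyclic_fun_def)
qed

lemma RG_fun_witness:
  assumes "pseudovariety C" "conjugacy_separable C G"
  shows "\<exists>N\<in>class_normals C G. quot_card G N = RG_fun C G S n \<and> inj_on (proj G N) (word_ball G S n)"
proof -
  have "word_ball G S n \<subseteq> carrier G" by (auto simp: word_ball_def)
  from residually_injective[OF assms(1) G assms(2) fin this]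
  have "{quot_card G N | N. N \<in> class_normals C G \<and> inj_on (proj G N) (word_ball G S n)} \<noteq> {}"
    by blast
  from Inf_nat_def1[OF this] show ?thesis unfolding RG_fun_def by (elim CollectE exE conjE) (rule bexI, auto)
qed

lemma RG_fun_le:
  assumes "N \<in> class_normals C G" "inj_on (proj G N) (word_ball G S n)"
  shows "RG_fun C G S n \<le> quot_card G N"
  unfolding RG_fun_def by (rule cInf_lower) (use assms in auto)

lemma RG_fun_ge_1:
  assumes "pseudovariety C" "conjugacy_separable C G"
  shows "1 \<le> RG_fun C G S n"
proof -
  obtain N where "N \<in> class_normals C G" "quot_card G N = RG_fun C G S n"
    using RG_fun_witness[OF assms] by blast
  then show ?thesis using class_normals_index(2)[OF assms(1) G] by metis
qed

end

section \<open>Necessity\<close>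

context wreath_pair
begin

definition site :: "'b \<Rightarrow> 'a \<Rightarrow> ('b \<Rightarrow> 'a) \<times> 'b"
  where "site x a = (delta x a, \<one>)"

definition top :: "'b \<Rightarrow> ('b \<Rightarrow> 'a) \<times> 'b"
  where "top b = (const_one, b)"

lemma site_closed: "a \<in> carrier A \<Longrightarrow> site x a \<in> carrier W"
  by (simp add: site_def carrier_wreath delta_mem)

lemma top_closed: "b \<in> carrier B \<Longrightarrow> top b \<in> carrier W"
  by (simp add: top_def carrier_wreath const_one_mem)

lemma site_mult:
  assumes "a \<in> carrier A" "a' \<in> carrier A"
  shows "site x a \<otimes>\<^bsub>W\<^esub> site y a' = (delta x a \<odot> delta y a', \<one>)"
  using assms by (simp add: site_def mult_wreath action_one delta_mem del: mult_sum_group)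

lemma site_mult_same:
  assumes "a \<in> carrier A" "a' \<in> carrier A"
  shows "site x a \<otimes>\<^bsub>W\<^esub> site x a' = site x (a \<otimes>\<^bsub>A\<^esub> a')"
  unfolding site_mult[OF assms] using assms by (auto simp: site_def delta_def fun_eq_iff)

lemma site_commute:
  assumes "a \<in> carrier A" "a' \<in> carrier A" "x \<noteq> y"
  shows "site x a \<otimes>\<^bsub>W\<^esub> site y a' = site y a' \<otimes>\<^bsub>W\<^esub> site x a"
  unfolding site_mult[OF assms(1,2)] site_mult[OF assms(2,1)] using assms by (auto simp: delta_def fun_eq_iff)

lemma top_site:
  assumes "a \<in> carrier A" "b \<in> carrier B" "x \<in> carrier B"
  shows "top b \<otimes>\<^bsub>W\<^esub> site x a = site (b \<otimes> x) a \<otimes>\<^bsub>W\<^esub> top b"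
  using assms by (simp add: top_def site_def mult_wreath action_delta action_const_one base_mult_const_one delta_mem del: mult_sum_group)

text \<open>
  Conjugating by the top element \<open>s\<close> translates sites by \<open>s\<close>. So top elements with equal images translate
  every site to points with equal images.
\<close>

lemma hom_site_cong:
  assumes p: "p \<in> hom W Q" and Q: "group Q"
    and st: "s \<in> carrier B" "t \<in> carrier B" "p (top s) = p (top t)" and x: "x \<in> carrier B" and a: "a \<in> carrier A"
  shows "p (site (s \<otimes> x) a) = p (site (t \<otimes> x) a)"
proof -
  interpret Q: group Q by fact
  interpret p: group_hom "W" Q p using p Q wreath_group by (simp add: group_hom_def group_hom_axioms_def)
  have "p (site (s \<otimes> x) a) \<otimes>\<^bsub>Q\<^esub> p (top s) = p (top s) \<otimes>\<^bsub>Q\<^esub> p (site x a)"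
    using top_site[OF a st(1) x] p.hom_mult[OF top_closed[OF st(1)] site_closed[OF a, of x]]
      p.hom_mult[OF site_closed[OF a, of "s \<otimes> x"] top_closed[OF st(1)]] by simp
  also have "\<dots> = p (site (t \<otimes> x) a) \<otimes>\<^bsub>Q\<^esub> p (top s)"
    unfolding st(3)
    using top_site[OF a st(2) x] p.hom_mult[OF top_closed[OF st(2)] site_closed[OF a, of x]]
      p.hom_mult[OF site_closed[OF a, of "t \<otimes> x"] top_closed[OF st(2)]] by simp
  finally show ?thesis using a st site_closed top_closed p.hom_closed by (simp add: st)
qed

lemma top_hom: "p \<in> hom W Q \<Longrightarrow> (\<lambda>b. p (top b)) \<in> hom B Q"
  using hom_compose[OF top_embed_hom, of p Q] by (simp add: o_def top_def)

text \<open>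
  In an infinite \<open>B\<close> a quotient from the class merges two points, hence also the copies of \<open>A\<close> over them.
  Copies over distinct points commute, so the images of \<open>a a'\<close> and \<open>a' a\<close> at one site agree, and the
  wreath product is not even residually in the class unless \<open>A\<close> is abelian.
\<close>

lemma nonabelian_necessary:
  assumes C: "pseudovariety C" and cW: "conjugacy_separable C W" and cB: "conjugacy_separable C B"
    and nA: "\<not> comm_group A"
  shows "in_class C B"
proof (rule ccontr)
  assume nB: "\<not> in_class C B"
  have inf: "infinite (carrier B)"
    using finite_conjugacy_separable_in_class[OF C B.is_group cB] nB by blast
  have "\<exists>a\<in>carrier A. \<exists>a'\<in>carrier A. a \<otimes>\<^bsub>A\<^esub> a' \<noteq> a' \<otimes>\<^bsub>A\<^esub> a"
    using A.group_comm_groupI nA by blast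
  then obtain a a' where a: "a \<in> carrier A" "a' \<in> carrier A" "a \<otimes>\<^bsub>A\<^esub> a' \<noteq> a' \<otimes>\<^bsub>A\<^esub> a" by blast
  let ?W = "W"
  let ?g = "site \<one> (a \<otimes>\<^bsub>A\<^esub> a')" and ?h = "site \<one> (a' \<otimes>\<^bsub>A\<^esub> a)"
  have ne: "?g \<noteq> ?h"
  proof
    assume "?g = ?h"
    then have "delta \<one> (a \<otimes>\<^bsub>A\<^esub> a') \<one> = delta \<one> (a' \<otimes>\<^bsub>A\<^esub> a) \<one>" by (simp add: site_def)
    then show False using a by (simp add: delta_apply)
  qed
  have mem: "?g \<in> carrier ?W" "?h \<in> carrier ?W" using a by (simp_all add: site_closed)
  from residually_separable[OF wreath_group cW mem ne]
  obtain N where N: "N \<in> class_normals C ?W" "proj ?W N ?g \<noteq> proj ?W N ?h" by blast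
  let ?Q = "?W Mod N" and ?p = "proj ?W N"
  have Q: "group ?Q" by (rule in_class_group[OF class_normalsD(2)[OF N(1)]])
  have fQ: "finite (carrier ?Q)" by (rule in_class_finite[OF C class_normalsD(2)[OF N(1)]])
  have p: "?p \<in> hom ?W ?Q" by (rule proj_hom[OF class_normalsD(1)[OF N(1)]])
  interpret \<chi>: group_hom B ?Q "\<lambda>b. ?p (top b)"
    using top_hom[OF p] Q by (simp add: group_hom_def group_hom_axioms_def B.is_group)
  have "\<not> inj_on (\<lambda>b. ?p (top b)) (carrier B)"
  proof
    assume "inj_on (\<lambda>b. ?p (top b)) (carrier B)"
    moreover have "finite ((\<lambda>b. ?p (top b)) ` carrier B)"
      by (rule finite_subset[OF hom_carrier[OF top_hom[OF p]] fQ])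
    ultimately show False using inf finite_imageD by blast
  qed
  then obtain s t where st: "s \<in> carrier B" "t \<in> carrier B" "?p (top s) = ?p (top t)" "s \<noteq> t"
    unfolding inj_on_def by blast
  define x where "x = inv t"
  have x: "x \<in> carrier B" "t \<otimes> x = \<one>" "s \<otimes> x \<noteq> \<one>"
    using st by (simp_all add: x_def B.inv_solve_right')
  have tr: "?p (site (s \<otimes> x) d) = ?p (site \<one> d)" if "d \<in> carrier A" for d
    using hom_site_cong[OF p Q st(1,2,3) x(1) that] x(2) by simp
  note pm = hom_mult[OF p site_closed site_closed]
  have "?p ?g = ?p (site \<one> a \<otimes>\<^bsub>?W\<^esub> site (s \<otimes> x) a')"
    unfolding pm[OF a(1,2)] tr[OF a(2)] by (simp only: pm[OF a(1,2), symmetric] site_mult_same[OF a(1,2)])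
  also have "\<dots> = ?p (site (s \<otimes> x) a' \<otimes>\<^bsub>?W\<^esub> site \<one> a)"
    using site_commute[OF a(1,2), of "\<one>" "s \<otimes> x"] x(3) by simp
  also have "\<dots> = ?p ?h"
    unfolding pm[OF a(2,1)] tr[OF a(2)] by (simp only: pm[OF a(2,1), symmetric] site_mult_same[OF a(2,1)])
  finally show False using N(2) by simp
qed

end

text \<open>
  For \<open>t\<close> in \<open>B\<close> let \<open>F t\<close> carry \<open>a\<close> at \<open>1\<close> and the inverse of \<open>a\<close> at \<open>t\<close>. If \<open>t\<close> lies in \<open>\<langle>b\<rangle>\<close>, then \<open>(F t, b)\<close> is
  conjugate to \<open>(1, b)\<close>, while for \<open>h\<close> outside \<open>\<langle>b\<rangle>\<close> it is not. A quotient that tells \<open>(F h, b)\<close>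
  from \<open>(1, b)\<close> must therefore keep \<open>h\<close> away from \<open>\<langle>b\<rangle>\<close>.
\<close>

lemma (in wreath_abelian) abelian_necessary:
  assumes C: "pseudovariety C" and cW: "conjugacy_separable C W"
    and a: "a \<in> carrier A" "a \<noteq> \<one>\<^bsub>A\<^esub>"
  shows "cyclic_subgroup_separable C B"
  unfolding cyclic_subgroup_separable_def separable_def
proof (intro ballI conjI)
  fix b assume b: "b \<in> carrier B"
  show "cyc b \<subseteq> carrier B" using cyc_closed[OF b] by blast
  fix h assume "h \<in> carrier B - cyc b"
  then have h: "h \<in> carrier B" "h \<notin> cyc b" by auto
  let ?W = "W"
  have ia: "inv\<^bsub>A\<^esub> a \<in> carrier A" using a by simp
  define F where "F t = delta \<one> a \<odot> delta t (inv\<^bsub>A\<^esub> a)" for t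
  have F: "F t \<in> base" for t unfolding F_def by (rule base_mult_closed[OF delta_mem[OF a(1)] delta_mem[OF ia]])
  have mem: "(F t, b) \<in> carrier ?W" "(const_one, b) \<in> carrier ?W" for t
    using F b const_one_mem by (simp_all add: carrier_wreath)
  have "\<not> conj_in ?W (F h, b) (const_one, b)"
  proof
    assume "conj_in ?W (F h, b) (const_one, b)"
    then obtain c where c: "c \<in> carrier B" "\<forall>z\<in>carrier B. mass (F h) (cyc b #> (c \<otimes> z)) = mass const_one (cyc b #> z)"
      unfolding conj_in_wreath_abelian_iff[OF F b const_one_mem b] by blast
    from c(2)[rule_format, of "inv c"] have "mass (F h) (cyc b #> \<one>) = \<one>\<^bsub>A\<^esub>"
      using c(1) by (simp add: mass_const_one)
    moreover have "\<one> \<in> cyc b #> \<one>" "h \<notin> cyc b #> \<one>"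
      using b h by (simp_all add: cyc_coset_iff generate.one)
    ultimately show False
      unfolding F_def mass_mult[OF delta_mem[OF a(1)] delta_mem[OF ia]]
      using a h(1) by (simp add: mass_delta[OF a(1)] mass_delta[OF ia])
  qed
  from conjugacy_separableD[OF wreath_group cW mem this]
  obtain N where N: "N \<in> class_normals C ?W" "proj ?W N (const_one, b) \<notin> proj ?W N ` conj_class ?W (F h, b)" by blast
  let ?Q = "?W Mod N" and ?p = "proj ?W N"
  have Q: "group ?Q" by (rule in_class_group[OF class_normalsD(2)[OF N(1)]])
  have p: "?p \<in> hom ?W ?Q" by (rule proj_hom[OF class_normalsD(1)[OF N(1)]])
  let ?M = "kernel B ?Q (\<lambda>b. ?p (top b))"
  have M: "?M \<in> class_normals C B"
    by (rule kernel_class_normal(1)[OF C B.is_group class_normalsD(2)[OF N(1)] top_hom[OF p]])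
  have "proj B ?M h \<notin> proj B ?M ` cyc b"
  proof
    assume "proj B ?M h \<in> proj B ?M ` cyc b"
    then obtain t where t: "t \<in> cyc b" "proj B ?M h = proj B ?M t" by blast
    have tB: "t \<in> carrier B" by (rule cyc_closed[OF b t(1)])
    have e: "?p (top h) = ?p (top t)"
      using t(2) proj_kernel_eq_iff[OF B.is_group Q top_hom[OF p] h(1) tB] by simp
    have s: "?p (site h (inv\<^bsub>A\<^esub> a)) = ?p (site t (inv\<^bsub>A\<^esub> a))"
      using hom_site_cong[OF p Q h(1) tB e B.one_closed ia] h(1) tB by simp
    have dec: "(F u, b) = site \<one> a \<otimes>\<^bsub>?W\<^esub> site u (inv\<^bsub>A\<^esub> a) \<otimes>\<^bsub>?W\<^esub> top b" for u
      unfolding site_mult[OF a(1) ia] F_def[symmetric] top_def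
      using F b by (simp add: mult_wreath action_const_one base_mult_const_one del: mult_sum_group)
    interpret W: group ?W by (rule wreath_group)
    have "?p (F u, b) = ?p (site \<one> a) \<otimes>\<^bsub>?Q\<^esub> ?p (site u (inv\<^bsub>A\<^esub> a)) \<otimes>\<^bsub>?Q\<^esub> ?p (top b)" for u
      unfolding dec using hom_mult[OF p] site_closed[OF a(1)] site_closed[OF ia] top_closed[OF b] by simp
    then have pe: "?p (F h, b) = ?p (F t, b)" using s by simp
    have cob: "F t \<in> cob b" unfolding F_def using cob_transfer[OF b t(1) B.one_closed a(1)] tB by simp
    have "conj_in ?W (F t, b) (const_one, b)"
      unfolding conj_in_wreath_abelian_iff[OF F b const_one_mem b]
      by (rule bexI[of _ "\<one>"]) (use b mass_cob[OF b cob] mass_const_one in auto)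
    from conj_in_hom[OF p mem(1) mem(2) this] have "conj_in ?Q (?p (F h, b)) (?p (const_one, b))"
      unfolding pe .
    then show False
      using N(2) proj_conj_class_iff[OF wreath_group class_normalsD(1)[OF N(1)] mem(1) mem(2)] by simp
  qed
  then show "\<exists>M\<in>class_normals C B. proj B M h \<notin> proj B M ` cyc b" using M by (rule bexI)
qed

section \<open>Wreath products with a top group in the class\<close>

context wreath_pair
begin

text \<open>
  The product of the values of \<open>f\<close> at \<open>x\<close>, \<open>d x\<close>, \<open>d\<^sup>2 x\<close> and so on, in this order. For \<open>d = b\<^sup>-\<^sup>1\<close> it is the value at
  \<open>x\<close> of the base part of the \<open>n\<close>-th power of \<open>(f, b)\<close>.
\<close>

primrec twist :: "('b \<Rightarrow> 'a) \<Rightarrow> 'b \<Rightarrow> nat \<Rightarrow> 'b \<Rightarrow> 'a"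
  where "twist f d 0 x = \<one>\<^bsub>A\<^esub>"
  | "twist f d (Suc n) x = f x \<otimes>\<^bsub>A\<^esub> twist f d n (d \<otimes> x)"

lemma twist_closed: "f \<in> base \<Longrightarrow> d \<in> carrier B \<Longrightarrow> x \<in> carrier B \<Longrightarrow> twist f d n x \<in> carrier A"
  by (induction n arbitrary: x) (simp_all add: base_mem)

lemma twist_Suc_right:
  assumes "f \<in> base" "d \<in> carrier B" "x \<in> carrier B"
  shows "twist f d (Suc n) x = twist f d n x \<otimes>\<^bsub>A\<^esub> f (d [^] n \<otimes> x)"
  using assms(3)
proof (induction n arbitrary: x)
  case 0
  then show ?case using assms by (simp add: base_mem)
next
  case (Suc n)
  have "twist f d (Suc (Suc n)) x = f x \<otimes>\<^bsub>A\<^esub> (twist f d n (d \<otimes> x) \<otimes>\<^bsub>A\<^esub> f (d [^] n \<otimes> (d \<otimes> x)))"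
    using Suc.IH[of "d \<otimes> x"] Suc.prems assms(2) by simp
  also have "d [^] n \<otimes> (d \<otimes> x) = d [^] (Suc n) \<otimes> x"
    using Suc.prems assms(2) by (simp add: B.m_assoc)
  finally show ?case using Suc.prems assms by (simp add: A.m_assoc base_mem twist_closed)
qed

lemma base_eq_iff:
  assumes "f \<in> base" "k \<in> base" "f' \<in> base" "b \<in> carrier B" "c \<in> carrier B"
  shows "f \<odot> wreath_action B b k = k \<odot> wreath_action B c f' \<longleftrightarrow>
    (\<forall>x\<in>carrier B. f x \<otimes>\<^bsub>A\<^esub> k (inv b \<otimes> x) = k x \<otimes>\<^bsub>A\<^esub> f' (inv c \<otimes> x))"
  by (auto simp: fun_eq_iff action_apply)

text \<open>
  Pointwise, a conjugator \<open>k\<close> intertwines \<open>f\<close> and \<open>f'\<close> with a shift of its argument by \<open>d\<close>. Along an orbit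
  the shifts telescope.
\<close>

lemma twist_intertwine:
  assumes f: "f \<in> base" and k: "k \<in> base" and f': "f' \<in> base" and d: "d \<in> carrier B" and d': "d' \<in> carrier B" and e: "e \<in> carrier B"
    and ed: "e \<otimes> d = d' \<otimes> e"
    and eq: "\<And>x. x \<in> carrier B \<Longrightarrow> f x \<otimes>\<^bsub>A\<^esub> k (d \<otimes> x) = k x \<otimes>\<^bsub>A\<^esub> f' (e \<otimes> x)"
    and x: "x \<in> carrier B"
  shows "twist f d n x \<otimes>\<^bsub>A\<^esub> k (d [^] n \<otimes> x) = k x \<otimes>\<^bsub>A\<^esub> twist f' d' n (e \<otimes> x)"
  using x
proof (induction n arbitrary: x)
  case 0
  then show ?case by (simp add: base_mem[OF k])
next
  case (Suc n)
  note x = Suc.prems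
  have dx: "d \<otimes> x \<in> carrier B" "e \<otimes> x \<in> carrier B" using d e x by auto
  have 1: "d [^] (Suc n) \<otimes> x = d [^] n \<otimes> (d \<otimes> x)" using d x by (simp add: B.m_assoc)
  have 2: "e \<otimes> (d \<otimes> x) = d' \<otimes> (e \<otimes> x)" using d d' e x ed by (simp add: B.m_assoc[symmetric])
  have "twist f d (Suc n) x \<otimes>\<^bsub>A\<^esub> k (d [^] (Suc n) \<otimes> x)
    = f x \<otimes>\<^bsub>A\<^esub> (twist f d n (d \<otimes> x) \<otimes>\<^bsub>A\<^esub> k (d [^] n \<otimes> (d \<otimes> x)))"
    unfolding 1 using base_mem[OF f x] twist_closed[OF f d dx(1)] base_mem[OF k] d dx by (simp add: A.m_assoc)
  also have "\<dots> = (f x \<otimes>\<^bsub>A\<^esub> k (d \<otimes> x)) \<otimes>\<^bsub>A\<^esub> twist f' d' n (d' \<otimes> (e \<otimes> x))"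
    unfolding Suc.IH[OF dx(1)] 2 using base_mem[OF f x] base_mem[OF k dx(1)] twist_closed[OF f' d'] d' dx by (simp add: A.m_assoc)
  also have "\<dots> = k x \<otimes>\<^bsub>A\<^esub> twist f' d' (Suc n) (e \<otimes> x)"
    unfolding eq[OF x] using base_mem[OF k x] base_mem[OF f' dx(2)] twist_closed[OF f' d'] d' dx by (simp add: A.m_assoc)
  finally show ?case .
qed

lemma conj_inv_commute:
  assumes "b \<in> carrier B" "b' \<in> carrier B" "c \<in> carrier B" "b \<otimes> c = c \<otimes> b'"
  shows "inv c \<otimes> inv b = inv b' \<otimes> inv c"
  using assms by (metis B.inv_mult_group)

lemma conj_twistD:
  assumes f: "f \<in> base" and b: "b \<in> carrier B" and f': "f' \<in> base" and b': "b' \<in> carrier B"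
    and r: "(inv b) [^] (r::nat) = \<one>"
    and cj: "conj_in W (f, b) (f', b')"
  shows "\<exists>c\<in>carrier B. b \<otimes> c = c \<otimes> b' \<and>
    (\<forall>x\<in>carrier B. conj_in A (twist f (inv b) r x) (twist f' (inv b') r (inv c \<otimes> x)))"
proof -
  obtain c k where c: "c \<in> carrier B" "b \<otimes> c = c \<otimes> b'" and k: "k \<in> base"
    "f \<odot> wreath_action B b k = k \<odot> wreath_action B c f'"
    using cj unfolding conj_in_wreath_iff[OF f b f' b'] by blast
  note eq = k(2)[unfolded base_eq_iff[OF f k(1) f' b c(1)], rule_format]
  have "conj_in A (twist f (inv b) r x) (twist f' (inv b') r (inv c \<otimes> x))" if x: "x \<in> carrier B" for x
    unfolding conj_in_def
  proof (rule bexI[of _ "k x"])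
    show "twist f (inv b) r x \<otimes>\<^bsub>A\<^esub> k x = k x \<otimes>\<^bsub>A\<^esub> twist f' (inv b') r (inv c \<otimes> x)"
      using twist_intertwine[OF f k(1) f' B.inv_closed[OF b] B.inv_closed[OF b'] B.inv_closed[OF c(1)] conj_inv_commute[OF b b' c] eq x, of r]
        r x by simp
  qed (rule base_mem[OF k(1) x])
  then show ?thesis using c by (intro bexI[of _ c]) auto
qed

text \<open>
  On each orbit of \<open>d\<close> choose a base point \<open>rep\<close> and a conjugator \<open>\<kappa>\<close> of the two orbit products there. The
  intertwining equation then dictates the conjugator \<open>kk\<close> at the \<open>i\<close>-th point of the orbit, and the choice of
  \<open>\<kappa>\<close> makes it consistent when the orbit closes up. The number of steps must be the exact order of \<open>d\<close>: for
  a proper multiple the orbit products become powers, which may be conjugate when the products are not.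
\<close>

lemma conj_twistI:
  assumes fin: "finite (carrier B)"
    and f: "f \<in> base" and b: "b \<in> carrier B" and f': "f' \<in> base" and b': "b' \<in> carrier B"
    and c: "c \<in> carrier B" "b \<otimes> c = c \<otimes> b'"
    and cj: "\<And>x. x \<in> carrier B \<Longrightarrow> conj_in A (twist f (inv b) (group.ord B (inv b)) x)
       (twist f' (inv b') (group.ord B (inv b)) (inv c \<otimes> x))"
  shows "conj_in W (f, b) (f', b')"
proof -
  define d where "d = inv b"
  define d' where "d' = inv b'"
  define e where "e = inv c"
  define r where "r = group.ord B d"
  have dB: "d \<in> carrier B" "d' \<in> carrier B" "e \<in> carrier B" using b b' c by (auto simp: d_def d'_def e_def)
  have ed: "e \<otimes> d = d' \<otimes> e" unfolding e_def d_def d'_def by (rule conj_inv_commute[OF b b' c])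
  have epow: "e \<otimes> (d [^] n \<otimes> x) = d' [^] n \<otimes> (e \<otimes> x)" if "x \<in> carrier B" for n :: nat and x
    using that
  proof (induction n arbitrary: x)
    case (Suc n)
    have dx: "d \<otimes> x \<in> carrier B" using dB Suc.prems by simp
    have "e \<otimes> (d [^] Suc n \<otimes> x) = e \<otimes> (d [^] n \<otimes> (d \<otimes> x))"
      using dB Suc.prems by (simp add: B.m_assoc)
    also have "\<dots> = d' [^] n \<otimes> (e \<otimes> d \<otimes> x)" using Suc.IH[OF dx] dB Suc.prems by (simp add: B.m_assoc)
    finally show ?case using dB Suc.prems by (simp add: ed B.m_assoc)
  qed (use dB in simp)
  have r: "d [^] r = \<one>" unfolding r_def by (rule B.pow_ord_eq_1[OF dB(1)])
  have "1 \<le> r" unfolding r_def by (rule B.ord_ge_1[OF fin dB(1)])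
  then have r0: "0 < r" by simp
  have rinj: "inj_on (\<lambda>i. d [^] i) {0..r - 1}" unfolding r_def by (rule B.ord_inj[OF dB(1)])
  have fn: "\<exists>i<r. d [^] n = d [^] i" for n :: nat
  proof -
    have "d [^] (r * (n div r) + n mod r) = (d [^] r) [^] (n div r) \<otimes> d [^] (n mod r)"
      using dB(1) by (simp only: B.nat_pow_mult[symmetric] B.nat_pow_pow[symmetric])
    then have "d [^] n = d [^] (n mod r)" using r dB(1) by simp
    then show ?thesis using mod_less_divisor[OF r0, of n] by (intro exI[of _ "n mod r"] conjI)
  qed
  define H where "H = generate B {d}"
  have H: "subgroup H B" unfolding H_def by (rule B.generate_is_subgroup) (use dB in simp)
  have Hpow: "\<exists>i<r. t = d [^] i" if t: "t \<in> H" for t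
  proof -
    obtain k :: nat where "t = d [^] k"
      using t unfolding H_def B.generate_pow_on_finite_carrier[OF fin dB(1)] by auto
    then show ?thesis using fn[of k] by simp
  qed
  define rep where "rep x = (SOME y. y \<in> H #> x)" for x
  have rep: "rep x \<in> H #> x" "rep x \<in> carrier B" if x: "x \<in> carrier B" for x
  proof -
    have "x \<in> H #> x" by (rule B.rcos_self[OF x H])
    then show 1: "rep x \<in> H #> x" unfolding rep_def by (rule someI[of "\<lambda>y. y \<in> H #> x"])
    show "rep x \<in> carrier B" using subsetD[OF B.r_coset_subset_G[OF subgroup.subset[OF H] x] 1] .
  qed
  have repd: "rep (d \<otimes> x) = rep x" if x: "x \<in> carrier B" for x
  proof -
    have "d \<in> H" unfolding H_def by (simp add: generate.incl)
    then have "d \<otimes> x \<in> H #> x" by (rule B.rcosI[OF _ subgroup.subset[OF H] x])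
    then have "H #> (d \<otimes> x) = H #> x" by (rule B.repr_independence[OF _ x H, symmetric])
    then show ?thesis by (simp add: rep_def)
  qed
  define idx where "idx x = (SOME i. i < r \<and> x = d [^] i \<otimes> rep x)" for x
  have idx: "idx x < r" "x = d [^] idx x \<otimes> rep x" if x: "x \<in> carrier B" for x
  proof -
    have "H #> x = H #> rep x" by (rule B.repr_independence[OF rep(1)[OF x] x H])
    then have "x \<in> H #> rep x" using B.rcos_self[OF x H] by simp
    then have "x \<otimes> inv rep x \<in> H" using subgroup.rcos_module[OF H B.is_group rep(2)[OF x] x] by simp
    from Hpow[OF this] obtain i where i: "i < r" "x \<otimes> inv rep x = d [^] i" by blast
    have "x = d [^] i \<otimes> rep x" unfolding i(2)[symmetric] using x rep(2)[OF x] by (simp add: B.m_assoc)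
    then have "i < r \<and> x = d [^] i \<otimes> rep x" using i(1) by blast
    from someI[of "\<lambda>i. i < r \<and> x = d [^] i \<otimes> rep x", OF this, folded idx_def]
    show "idx x < r" "x = d [^] idx x \<otimes> rep x" by blast+
  qed
  have idx_unique: "idx x = i" if x: "x \<in> carrier B" and i: "i < r" "x = d [^] i \<otimes> rep x" for x i
  proof -
    have "d [^] i \<otimes> rep x = d [^] idx x \<otimes> rep x" using idx(2)[OF x] i(2) by simp
    then have "d [^] i = d [^] idx x" using rep(2)[OF x] dB(1) by simp
    moreover have "i \<in> {0..r - 1}" "idx x \<in> {0..r - 1}" using i(1) idx(1)[OF x] by auto
    ultimately have "i = idx x" by (rule inj_onD[OF rinj])
    then show ?thesis ..
  qed
  have "\<forall>x\<in>carrier B. \<exists>\<kappa>. \<kappa> \<in> carrier A \<and> twist f d r x \<otimes>\<^bsub>A\<^esub> \<kappa> = \<kappa> \<otimes>\<^bsub>A\<^esub> twist f' d' r (e \<otimes> x)"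
    using cj unfolding conj_in_def Bex_def d_def d'_def e_def r_def by blast
  from bchoice[OF this] obtain \<kappa> where \<kappa>: "\<And>x. x \<in> carrier B \<Longrightarrow> \<kappa> x \<in> carrier A"
    "\<And>x. x \<in> carrier B \<Longrightarrow> twist f d r x \<otimes>\<^bsub>A\<^esub> \<kappa> x = \<kappa> x \<otimes>\<^bsub>A\<^esub> twist f' d' r (e \<otimes> x)" by blast
  define kk where "kk x i = inv\<^bsub>A\<^esub> (twist f d i x) \<otimes>\<^bsub>A\<^esub> \<kappa> x \<otimes>\<^bsub>A\<^esub> twist f' d' i (e \<otimes> x)" for x i
  have T: "twist f d i x \<in> carrier A" "twist f' d' i (e \<otimes> x) \<in> carrier A" if "x \<in> carrier B" for i x
    using twist_closed[OF f dB(1) that] twist_closed[OF f' dB(2)] dB(3) that by auto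
  have kk: "kk x i \<in> carrier A" if "x \<in> carrier B" for x i
    unfolding kk_def using T[OF that] \<kappa>(1)[OF that] by simp
  \<comment> \<open>Closing up: after a full turn around the orbit the dictated value returns.\<close>
  have kkr: "kk x r = kk x 0" if x: "x \<in> carrier B" for x
  proof -
    have "kk x r = inv\<^bsub>A\<^esub> (twist f d r x) \<otimes>\<^bsub>A\<^esub> (twist f d r x \<otimes>\<^bsub>A\<^esub> \<kappa> x)"
      unfolding kk_def \<kappa>(2)[OF x] using T[OF x] \<kappa>(1)[OF x] by (simp add: A.m_assoc)
    also have "\<dots> = \<kappa> x" using T[OF x] \<kappa>(1)[OF x] by (simp add: A.m_assoc[symmetric])
    finally show ?thesis using \<kappa>(1)[OF x] by (simp add: kk_def)
  qed
  have kkS: "f (d [^] i \<otimes> x) \<otimes>\<^bsub>A\<^esub> kk x (Suc i) = kk x i \<otimes>\<^bsub>A\<^esub> f' (e \<otimes> (d [^] i \<otimes> x))"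
    if x: "x \<in> carrier B" for x i
  proof -
    let ?y = "d [^] i \<otimes> x"
    have y: "?y \<in> carrier B" "e \<otimes> ?y \<in> carrier B" "e \<otimes> x \<in> carrier B" using dB x by simp_all
    have fy: "f ?y \<in> carrier A" "f' (e \<otimes> ?y) \<in> carrier A" using base_mem[OF f y(1)] base_mem[OF f' y(2)] .
    have t': "twist f' d' (Suc i) (e \<otimes> x) = twist f' d' i (e \<otimes> x) \<otimes>\<^bsub>A\<^esub> f' (e \<otimes> ?y)"
      unfolding twist_Suc_right[OF f' dB(2) y(3)] epow[OF x] ..
    have "f ?y \<otimes>\<^bsub>A\<^esub> kk x (Suc i) = f ?y \<otimes>\<^bsub>A\<^esub> (inv\<^bsub>A\<^esub> (f ?y) \<otimes>\<^bsub>A\<^esub> (kk x i \<otimes>\<^bsub>A\<^esub> f' (e \<otimes> ?y)))"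
      unfolding kk_def t' twist_Suc_right[OF f dB(1) x] using T[OF x, of i] \<kappa>(1)[OF x] fy
      by (simp add: A.inv_mult_group A.m_assoc)
    also have "\<dots> = kk x i \<otimes>\<^bsub>A\<^esub> f' (e \<otimes> ?y)" using fy kk[OF x] by (simp add: A.m_assoc[symmetric])
    finally show ?thesis .
  qed
  define k where "k = (\<lambda>x\<in>carrier B. kk (rep x) (idx x))"
  have k: "k \<in> base"
    unfolding base_carrier[OF A.is_group] using kk rep(2) fin by (simp add: k_def supp_def)
  have eq: "f x \<otimes>\<^bsub>A\<^esub> k (d \<otimes> x) = k x \<otimes>\<^bsub>A\<^esub> f' (e \<otimes> x)" if x: "x \<in> carrier B" for x
  proof -
    have dx: "d \<otimes> x \<in> carrier B" using dB x by simp
    note R = rep(2)[OF x]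
    have "d [^] Suc (idx x) \<otimes> rep x = d \<otimes> (d [^] idx x \<otimes> rep x)"
      unfolding B.nat_pow_Suc2[OF dB(1)] using dB(1) R by (simp add: B.m_assoc)
    then have step: "d \<otimes> x = d [^] Suc (idx x) \<otimes> rep (d \<otimes> x)"
      unfolding repd[OF x] using idx(2)[OF x] by simp
    have "kk (rep x) (idx (d \<otimes> x)) = kk (rep x) (Suc (idx x))"
    proof (cases "Suc (idx x) < r")
      case True
      then show ?thesis using idx_unique[OF dx True step] by simp
    next
      case False
      then have s: "Suc (idx x) = r" using idx(1)[OF x] by simp
      have "d \<otimes> x = d [^] (0::nat) \<otimes> rep (d \<otimes> x)"
        using step unfolding s r by simp
      then have "idx (d \<otimes> x) = 0" by (rule idx_unique[OF dx r0])
      then show ?thesis using kkr[OF R] s by simp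
    qed
    then have "f x \<otimes>\<^bsub>A\<^esub> k (d \<otimes> x) = f (d [^] idx x \<otimes> rep x) \<otimes>\<^bsub>A\<^esub> kk (rep x) (Suc (idx x))"
      using dx repd[OF x] idx(2)[OF x] by (simp add: k_def)
    also have "\<dots> = kk (rep x) (idx x) \<otimes>\<^bsub>A\<^esub> f' (e \<otimes> x)"
      unfolding kkS[OF R] using idx(2)[OF x] by simp
    finally show ?thesis using x by (simp add: k_def)
  qed
  show ?thesis
    unfolding conj_in_wreath_iff[OF f b f' b']
    by (intro bexI[OF _ c(1)] conjI c(2) bexI[OF _ k]) (unfold base_eq_iff[OF f k f' b c(1)], use eq in \<open>simp add: d_def e_def\<close>)
qed

definition pointwise :: "('a \<Rightarrow> 'c) \<Rightarrow> ('b \<Rightarrow> 'a) \<Rightarrow> 'b \<Rightarrow> 'c"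
  where "pointwise \<psi> f = (\<lambda>x\<in>carrier B. \<psi> (f x))"

end

lemma (in wreath_pair) pointwise_wreath_hom:
  assumes \<psi>: "group_hom A A' \<psi>"
  shows "(\<lambda>(f, b). (pointwise \<psi> f, b)) \<in> hom W (wreath A' B)"
    and "f \<in> base \<Longrightarrow> pointwise \<psi> f \<in> carrier (wreath_base A' B)"
proof -
  interpret \<psi>: group_hom A A' \<psi> by fact
  interpret P: wreath_pair A' B by (simp add: wreath_pair_def \<psi>.H.is_group B.is_group)
  show cl: "pointwise \<psi> f \<in> P.base" if f: "f \<in> base" for f
  proof -
    have "supp A' B (pointwise \<psi> f) \<subseteq> supp A B f" by (auto simp: supp_def pointwise_def)
    then have "finite (supp A' B (pointwise \<psi> f))" using supp_finite[OF f] by (rule finite_subset)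
    then show ?thesis unfolding base_carrier[OF \<psi>.H.is_group] using base_mem[OF f] by (simp add: pointwise_def)
  qed
  have h: "pointwise \<psi> \<in> hom (wreath_base A B) (wreath_base A' B)"
  proof (rule homI)
    fix f g assume fg: "f \<in> base" "g \<in> base"
    show "pointwise \<psi> (f \<odot> g) = pointwise \<psi> f \<otimes>\<^bsub>wreath_base A' B\<^esub> pointwise \<psi> g"
      using base_mem[OF fg(1)] base_mem[OF fg(2)] by (auto simp: pointwise_def fun_eq_iff)
  qed (rule cl)
  have "(\<lambda>(f, b). (pointwise \<psi> f, id b)) \<in> hom W (wreath A' B)"
    by (rule wreath_hom[OF P.wreath_pair_axioms h]) (auto simp: hom_def wreath_action_def pointwise_def fun_eq_iff)
  then show "(\<lambda>(f, b). (pointwise \<psi> f, b)) \<in> hom W (wreath A' B)" by (simp only: id_apply)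
qed

lemma (in wreath_pair) twist_pointwise:
  assumes \<psi>: "group_hom A A' \<psi>" and f: "f \<in> base" and d: "d \<in> carrier B" and x: "x \<in> carrier B"
  shows "wreath_pair.twist A' B (pointwise \<psi> f) d n x = \<psi> (twist f d n x)"
proof -
  interpret \<psi>: group_hom A A' \<psi> by fact
  interpret P: wreath_pair A' B by (simp add: wreath_pair_def \<psi>.H.is_group B.is_group)
  show ?thesis using x
    by (induction n arbitrary: x) (simp_all add: pointwise_def d base_mem[OF f] twist_closed[OF f d])
qed

context wreath_pair
begin

definition twist_test :: "('b \<Rightarrow> 'a) \<Rightarrow> 'b \<Rightarrow> ('b \<Rightarrow> 'a) \<Rightarrow> 'b \<Rightarrow> 'b \<Rightarrow> 'b \<Rightarrow> 'a set \<Rightarrow> bool"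
  where "twist_test f b f' b' c x N \<longleftrightarrow>
    proj A N (twist f' (inv b') (group.ord B (inv b)) (inv c \<otimes> x)) \<notin>
    proj A N ` conj_class A (twist f (inv b) (group.ord B (inv b)) x)"

text \<open>
  Each of the at most \<open>|B|\<close> elements \<open>c\<close> that conjugate \<open>b\<close> to \<open>b'\<close> fails at some point \<open>x c\<close>, by
  \<open>conj_twistI\<close>, and one quotient of \<open>A\<close> of order at most \<open>k\<close> records this failure. The wreath
  product of the common quotient with \<open>B\<close> separates the pairs.
\<close>

lemma finite_top_separation:
  assumes C: "pseudovariety C" "extension_closed C" and B: "in_class C B"
    and f: "f \<in> base" and b: "b \<in> carrier B" and f': "f' \<in> base" and b': "b' \<in> carrier B"
    and nc: "\<not> conj_in W (f, b) (f', b')"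
    and test: "\<And>x y. x \<in> carrier B \<Longrightarrow> y \<in> carrier B \<Longrightarrow>
      \<not> conj_in A (twist f (inv b) (group.ord B (inv b)) x) (twist f' (inv b') (group.ord B (inv b)) y) \<Longrightarrow>
      \<exists>N\<in>class_normals C A. quot_card A N \<le> k \<and>
        proj A N (twist f' (inv b') (group.ord B (inv b)) y) \<notin>
        proj A N ` conj_class A (twist f (inv b) (group.ord B (inv b)) x)"
    and k: "1 \<le> k"
  shows "conj_separated_within C W (k ^ (order B * order B) * order B) (f, b) (f', b')"
proof -
  let ?r = "group.ord B (inv b)" and ?d = "inv b" and ?d' = "inv b'"
  have fin: "finite (carrier B)" by (rule in_class_finite[OF C(1) B])
  have dB: "?d \<in> carrier B" "?d' \<in> carrier B" using b b' by auto
  define J where "J = {c \<in> carrier B. b \<otimes> c = c \<otimes> b'}"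
  have fJ: "finite J" "card J \<le> order B" unfolding J_def order_def using fin by (auto intro: card_mono)
  have "\<forall>c\<in>J. \<exists>x. x \<in> carrier B \<and> \<not> conj_in A (twist f ?d ?r x) (twist f' ?d' ?r (inv c \<otimes> x))"
    using conj_twistI[OF fin f b f' b'] nc unfolding J_def by blast
  from bchoice[OF this] obtain x where x: "\<And>c. c \<in> J \<Longrightarrow> x c \<in> carrier B"
    "\<And>c. c \<in> J \<Longrightarrow> \<not> conj_in A (twist f ?d ?r (x c)) (twist f' ?d' ?r (inv c \<otimes> x c))" by blast
  have y: "inv c \<otimes> x c \<in> carrier B" if "c \<in> J" for c using x(1)[OF that] that by (simp add: J_def)
  note T = twist_closed[OF f dB(1) x(1)] twist_closed[OF f' dB(2) y]
  have "\<exists>N\<in>class_normals C A. quot_card A N \<le> k ^ card J \<and> (\<forall>c\<in>J. twist_test f b f' b' c (x c) N)"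
  proof (rule class_normals_INT[OF C(1) A.is_group fJ(1)])
    fix c assume c: "c \<in> J"
    show "\<exists>N\<in>class_normals C A. quot_card A N \<le> k \<and> twist_test f b f' b' c (x c) N"
      unfolding twist_test_def by (rule test[OF x(1)[OF c] y[OF c] x(2)[OF c]])
  next
    fix c N N' assume c: "c \<in> J" and t: "twist_test f b f' b' c (x c) N"
      and N: "N' \<subseteq> N" "N \<in> class_normals C A" "N' \<in> class_normals C A"
    show "twist_test f b f' b' c (x c) N'"
      unfolding twist_test_def
      by (rule proj_not_in_image_mono[OF A.is_group N(2,3,1) T(2)[OF c] conj_class_subset[OF A.is_group T(1)[OF c]] t[unfolded twist_test_def]])
  qed
  then obtain N where N: "N \<in> class_normals C A" "quot_card A N \<le> k ^ card J" "\<And>c. c \<in> J \<Longrightarrow> twist_test f b f' b' c (x c) N"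
    by blast
  note nN = class_normalsD(1)[OF N(1)]
  have \<psi>: "group_hom A (A Mod N) (proj A N)"
    using proj_hom[OF nN] normal.factorgroup_is_group[OF nN] by (simp add: group_hom_def group_hom_axioms_def A.is_group)
  interpret P: wreath_pair "A Mod N" B
    using normal.factorgroup_is_group[OF nN] by (simp add: wreath_pair_def B.is_group)
  have Q: "in_class C (wreath (A Mod N) B)" by (rule P.in_class_wreath[OF C class_normalsD(2)[OF N(1)] B])
  let ?\<Phi> = "\<lambda>(f, b). (pointwise (proj A N) f, b)"
  note \<Phi> = pointwise_wreath_hom(1)[OF \<psi>] and cl = pointwise_wreath_hom(2)[OF \<psi>]
  have "\<not> conj_in (wreath (A Mod N) B) (?\<Phi> (f, b)) (?\<Phi> (f', b'))"
  proof
    assume "conj_in (wreath (A Mod N) B) (?\<Phi> (f, b)) (?\<Phi> (f', b'))"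
    then have cj: "conj_in (wreath (A Mod N) B) (pointwise (proj A N) f, b) (pointwise (proj A N) f', b')" by simp
    from P.conj_twistD[OF cl[OF f] b cl[OF f'] b' B.pow_ord_eq_1[OF dB(1)] cj]
    obtain c where c: "c \<in> J" and
      tc: "\<forall>x\<in>carrier B. conj_in (A Mod N) (P.twist (pointwise (proj A N) f) ?d ?r x)
        (P.twist (pointwise (proj A N) f') ?d' ?r (inv c \<otimes> x))" unfolding J_def by blast
    have "conj_in (A Mod N) (proj A N (twist f ?d ?r (x c))) (proj A N (twist f' ?d' ?r (inv c \<otimes> x c)))"
      using tc[rule_format, OF x(1)[OF c]]
      unfolding twist_pointwise[OF \<psi> f dB(1) x(1)[OF c]] twist_pointwise[OF \<psi> f' dB(2) y[OF c]] .
    then show False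
      using N(3)[OF c] unfolding twist_test_def proj_conj_class_iff[OF A.is_group nN T(1)[OF c] T(2)[OF c]] by simp
  qed
  moreover have "(f, b) \<in> carrier W" "(f', b') \<in> carrier W" using f b f' b' by (simp_all add: carrier_wreath)
  ultimately obtain K where K: "K \<in> class_normals C W" "quot_card W K \<le> order (wreath (A Mod N) B)"
    "proj W K (f', b') \<notin> proj W K ` conj_class W (f, b)"
    using conj_separated_by_hom[OF C(1) wreath_group Q \<Phi>] by blast
  have "order (wreath (A Mod N) B) = quot_card A N ^ order B * order B"
    unfolding P.order_wreath[OF fin] by (simp add: order_def carrier_Mod)
  also have "quot_card A N \<le> k ^ order B"
    using N(2) power_increasing[OF fJ(2) k] by (rule order_trans)
  then have "quot_card A N ^ order B * order B \<le> (k ^ order B) ^ order B * order B"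
    by (intro mult_le_mono1 power_mono) simp_all
  finally show ?thesis using K by (intro bexI[of _ K]) (auto simp: power_mult)
qed

end

section \<open>Word length in wreath products\<close>

context wreath_pair
begin

lemma wreath_gens_finite:
  assumes "fin_gen_set W S"
  shows "finite (gens W S)" "gens W S \<subseteq> carrier W"
    "\<And>g. g \<in> gens W S \<Longrightarrow> fst g \<in> base"
    "\<And>g. g \<in> gens W S \<Longrightarrow> snd g \<in> carrier B"
proof -
  show "finite (gens W S)" using assms by (simp add: fin_gen_set_def)
  show s: "gens W S \<subseteq> carrier W" by (rule gens_closed[OF wreath_group assms])
  show "fst g \<in> base" "snd g \<in> carrier B" if "g \<in> gens W S" for g
    using subsetD[OF s that] by (simp_all add: carrier_wreath mem_Times_iff)
qed

text \<open>
  Multiplying by one generator moves the top part by a bounded amount and adds boundedly many support points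
  at bounded distance from the identity, so all three quantities grow linearly.
\<close>

lemma wreath_ball_top:
  assumes S: "fin_gen_set W S" and T: "fin_gen_set B T"
  shows "\<exists>c. \<forall>n f b. (f, b) \<in> word_ball W S n \<longrightarrow>
    b \<in> word_ball B T (c * n) \<and> supp A B f \<subseteq> word_ball B T (c * n) \<and> card (supp A B f) \<le> c * n"
proof -
  let ?G = "gens W S"
  note G = wreath_gens_finite[OF S]
  define F where "F = (\<Union>g\<in>?G. insert (snd g) (supp A B (fst g)))"
  have "finite F" unfolding F_def by (intro finite_UN_I G(1)) (simp add: supp_finite[OF G(3)])
  moreover have "F \<subseteq> carrier B" unfolding F_def using G(4) by (intro UN_least) (simp add: supp_def)
  ultimately obtain c1 where c1: "F \<subseteq> word_ball B T c1" using finite_subset_word_ball by blast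
  define c where "c = c1 + (\<Sum>g\<in>?G. card (supp A B (fst g)))"
  have gen: "b \<in> word_ball B T c \<and> supp A B f \<subseteq> word_ball B T c \<and> card (supp A B f) \<le> c" if "(f, b) \<in> ?G" for f b
  proof -
    have "insert b (supp A B f) \<subseteq> F"
      unfolding F_def using UN_upper[OF that, of "\<lambda>g. insert (snd g) (supp A B (fst g))"] by simp
    moreover have "word_ball B T c1 \<subseteq> word_ball B T c" by (rule word_ball_mono) (simp add: c_def)
    moreover have "card (supp A B f) \<le> (\<Sum>g\<in>?G. card (supp A B (fst g)))"
      using member_le_sum[OF that, of "\<lambda>g. card (supp A B (fst g))"] G(1) by simp
    ultimately show ?thesis using c1 unfolding c_def by auto
  qed
  have "snd g \<in> word_ball B T (c * n) \<and> supp A B (fst g) \<subseteq> word_ball B T (c * n) \<and> card (supp A B (fst g)) \<le> c * n"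
    if "g \<in> word_ball W S n" for g n
    using wreath_group S that
  proof (rule word_ball_induct)
    have "supp A B (fst \<one>\<^bsub>W\<^esub>) = {}" by (auto simp: one_wreath supp_def)
    then show "snd \<one>\<^bsub>W\<^esub> \<in> word_ball B T (c * 0) \<and> supp A B (fst \<one>\<^bsub>W\<^esub>) \<subseteq> word_ball B T (c * 0) \<and>
      card (supp A B (fst \<one>\<^bsub>W\<^esub>)) \<le> c * 0"
      using word_ball_one[OF B.is_group T] by (simp add: one_wreath)
  next
    fix n s h assume s: "s \<in> ?G" and h: "h \<in> word_ball W S n" and
      IH: "snd h \<in> word_ball B T (c * n) \<and> supp A B (fst h) \<subseteq> word_ball B T (c * n) \<and> card (supp A B (fst h)) \<le> c * n"
    obtain f0 b0 where s': "s = (f0, b0)" by (cases s)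
    obtain f b where h': "h = (f, b)" by (cases h)
    have b0: "b0 \<in> carrier B" using G(4)[OF s] s' by simp
    have f: "f \<in> base" using word_ball_closed[OF h] h' by (simp add: carrier_wreath)
    have g0: "b0 \<in> word_ball B T c" "supp A B f0 \<subseteq> word_ball B T c" "card (supp A B f0) \<le> c" using gen[of f0 b0] s unfolding s' by simp_all
    have sh: "s \<otimes>\<^bsub>W\<^esub> h = (f0 \<odot> wreath_action B b0 f, b0 \<otimes> b)"
      unfolding s' h' by (rule mult_wreath)
    have f0: "f0 \<in> base" using G(3)[OF s] s' by simp
    have sub: "supp A B (f0 \<odot> wreath_action B b0 f) \<subseteq> supp A B f0 \<union> (\<lambda>x. b0 \<otimes> x) ` supp A B f"
      using supp_mult supp_action[OF b0, of f] by fastforce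
    have im: "(\<lambda>x. b0 \<otimes> x) ` supp A B f \<subseteq> word_ball B T (c + c * n)"
      using word_ball_mult[OF B.is_group T g0(1)] IH h' by auto
    have c0: "word_ball B T c \<subseteq> word_ball B T (c + c * n)" by (rule word_ball_mono) simp
    have "card (supp A B (f0 \<odot> wreath_action B b0 f)) \<le> card (supp A B f0 \<union> (\<lambda>x. b0 \<otimes> x) ` supp A B f)"
      by (rule card_mono[OF _ sub]) (simp add: supp_finite[OF f] supp_finite[OF f0])
    also have "\<dots> \<le> card (supp A B f0) + card ((\<lambda>x. b0 \<otimes> x) ` supp A B f)" by (rule card_Un_le)
    also have "\<dots> \<le> c + c * n" using g0(3) card_image_le[OF supp_finite[OF f], of "\<lambda>x. b0 \<otimes> x"] IH h' by simp
    finally have "card (supp A B (f0 \<odot> wreath_action B b0 f)) \<le> c * Suc n" by simp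
    moreover have "b0 \<otimes> b \<in> word_ball B T (c * Suc n)"
      using word_ball_mult[OF B.is_group T g0(1)] IH h' by simp
    moreover have "supp A B (f0 \<odot> wreath_action B b0 f) \<subseteq> word_ball B T (c * Suc n)"
      using sub im g0(2) c0 by (simp del: mult_sum_group) blast
    ultimately show "snd (s \<otimes>\<^bsub>W\<^esub> h) \<in> word_ball B T (c * Suc n) \<and>
      supp A B (fst (s \<otimes>\<^bsub>W\<^esub> h)) \<subseteq> word_ball B T (c * Suc n) \<and> card (supp A B (fst (s \<otimes>\<^bsub>W\<^esub> h))) \<le> c * Suc n"
      unfolding sh fst_conv snd_conv by blast
  next
    fix m n :: nat and h assume IH: "snd h \<in> word_ball B T (c * m) \<and> supp A B (fst h) \<subseteq> word_ball B T (c * m) \<and> card (supp A B (fst h)) \<le> c * m"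
      and mn: "m \<le> n"
    have cmn: "c * m \<le> c * n" using mn by simp
    note sub = word_ball_mono[OF cmn, of B T]
    show "snd h \<in> word_ball B T (c * n) \<and> supp A B (fst h) \<subseteq> word_ball B T (c * n) \<and> card (supp A B (fst h)) \<le> c * n"
      using IH sub cmn by (intro conjI) (blast, blast, linarith)
  qed
  then show ?thesis by (intro exI[of _ c]) force
qed

lemma wreath_ball_value:
  assumes S: "fin_gen_set W S" and T: "fin_gen_set A T"
  shows "\<exists>c. \<forall>n f b. (f, b) \<in> word_ball W S n \<longrightarrow> (\<forall>x\<in>carrier B. f x \<in> word_ball A T (c * n))"
proof -
  let ?G = "gens W S"
  note G = wreath_gens_finite[OF S]
  define F where "F = insert \<one>\<^bsub>A\<^esub> (\<Union>g\<in>?G. fst g ` supp A B (fst g))"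
  have "finite F" unfolding F_def by (intro finite.insertI finite_UN_I G(1) finite_imageI supp_finite G(3))
  moreover have "F \<subseteq> carrier A" unfolding F_def
    by (intro insert_subsetI UN_least A.one_closed image_subsetI) (rule base_mem[OF G(3)], simp_all add: supp_def)
  ultimately obtain c where c: "F \<subseteq> word_ball A T c" using finite_subset_word_ball by blast
  have "\<forall>x\<in>carrier B. fst g x \<in> word_ball A T (c * n)" if "g \<in> word_ball W S n" for g n
    using wreath_group S that
  proof (rule word_ball_induct)
    show "\<forall>x\<in>carrier B. fst \<one>\<^bsub>W\<^esub> x \<in> word_ball A T (c * 0)"
      using word_ball_one[OF A.is_group T] by (simp add: one_wreath)
  next
    fix n s h assume s: "s \<in> ?G" and h: "h \<in> word_ball W S n" and IH: "\<forall>x\<in>carrier B. fst h x \<in> word_ball A T (c * n)"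
    obtain f0 b0 where s': "s = (f0, b0)" by (cases s)
    obtain f b where h': "h = (f, b)" by (cases h)
    have b0: "b0 \<in> carrier B" using G(4)[OF s] s' by simp
    have "f0 x \<in> word_ball A T c" if x: "x \<in> carrier B" for x
    proof -
      have "f0 x \<in> F"
      proof (cases "f0 x = \<one>\<^bsub>A\<^esub>")
        case False
        then have "f0 x \<in> fst s ` supp A B (fst s)" using x by (simp add: s' supp_def)
        then show ?thesis unfolding F_def using UN_I[OF s] by (intro insertI2)
      qed (simp add: F_def)
      then show ?thesis using c by blast
    qed
    then have "f0 x \<otimes>\<^bsub>A\<^esub> f (inv b0 \<otimes> x) \<in> word_ball A T (c + c * n)" if x: "x \<in> carrier B" for x
      using word_ball_mult[OF A.is_group T, of "f0 x" c "f (inv b0 \<otimes> x)" "c * n"] IH h' x b0 by simp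
    then show "\<forall>x\<in>carrier B. fst (s \<otimes>\<^bsub>W\<^esub> h) x \<in> word_ball A T (c * Suc n)"
      unfolding s' h' mult_wreath by (simp add: action_apply)
  next
    fix m n :: nat and h :: "('b \<Rightarrow> 'a) \<times> 'b" assume IH: "\<forall>x\<in>carrier B. fst h x \<in> word_ball A T (c * m)" and mn: "m \<le> n"
    have "c * m \<le> c * n" using mn by simp
    then show "\<forall>x\<in>carrier B. fst h x \<in> word_ball A T (c * n)"
      using IH word_ball_mono[of "c * m" "c * n" A T] by blast
  qed
  then show ?thesis by (intro exI[of _ c]) force
qed

lemma twist_ball:
  assumes f: "\<forall>x\<in>carrier B. f x \<in> word_ball A T m" and T: "fin_gen_set A T" and d: "d \<in> carrier B" and x: "x \<in> carrier B"
  shows "twist f d r x \<in> word_ball A T (r * m)"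
  using x
proof (induction r arbitrary: x)
  case 0
  then show ?case using word_ball_one[OF A.is_group T] by simp
next
  case (Suc r)
  then show ?case using word_ball_mult[OF A.is_group T, of "f x" m "twist f d r (d \<otimes> x)" "r * m"] f d by simp
qed

end

text \<open>
  A generator has only finitely many masses, although \<open>Z\<close> ranges over all subsets of \<open>B\<close>, so one constant
  serves all \<open>Z\<close>.
\<close>

lemma (in wreath_abelian) wreath_ball_mass:
  assumes S: "fin_gen_set W S" and T: "fin_gen_set A T"
  shows "\<exists>c. \<forall>n f b Z. (f, b) \<in> word_ball W S n \<longrightarrow> mass f Z \<in> word_ball A T (c * n)"
proof -
  let ?G = "gens W S"
  note G = wreath_gens_finite[OF S]
  note Gb = G(3)
  define F where "F = (\<Union>g\<in>?G. finprod A (fst g) ` Pow (supp A B (fst g)))"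
  have mF: "mass (fst g) Z \<in> F" if "g \<in> ?G" for g Z
    using that unfolding F_def mass_def by blast
  have "finite F" unfolding F_def using G(1) Gb supp_finite by (intro finite_UN_I finite_imageI) simp_all
  moreover have "F \<subseteq> carrier A"
  proof
    fix a assume "a \<in> F"
    then obtain g X where g: "g \<in> ?G" "X \<subseteq> supp A B (fst g)" "a = finprod A (fst g) X" unfolding F_def by blast
    have "X \<subseteq> carrier B" using g(2) by (auto simp: supp_def)
    then show "a \<in> carrier A" unfolding g(3) by (intro A.finprod_closed base_funcset[OF Gb[OF g(1)]])
  qed
  ultimately obtain c where c: "F \<subseteq> word_ball A T c" using finite_subset_word_ball by blast
  have "fst g \<in> base \<and> (\<forall>Z. mass (fst g) Z \<in> word_ball A T (c * n))" if "g \<in> word_ball W S n" for g n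
    using wreath_group S that
  proof (rule word_ball_induct)
    have "fst \<one>\<^bsub>W\<^esub> = const_one" by (simp add: one_wreath const_one_def)
    then show "fst \<one>\<^bsub>W\<^esub> \<in> base \<and> (\<forall>Z. mass (fst \<one>\<^bsub>W\<^esub>) Z \<in> word_ball A T (c * 0))"
      using word_ball_one[OF A.is_group T] const_one_mem mass_const_one by (simp del: one_sum_group)
  next
    fix n s h assume s: "s \<in> ?G" and h: "h \<in> word_ball W S n" and
      IH: "fst h \<in> base \<and> (\<forall>Z. mass (fst h) Z \<in> word_ball A T (c * n))"
    obtain f0 b0 where s': "s = (f0, b0)" by (cases s)
    obtain f b where h': "h = (f, b)" by (cases h)
    have b0: "b0 \<in> carrier B" using G(4)[OF s] s' by simp
    have f0: "f0 \<in> base" using Gb[OF s] s' by simp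
    have f: "f \<in> base" using IH h' by simp
    have m0: "mass f0 Z \<in> word_ball A T c" for Z using mF[OF s] s' c by auto
    have "mass (f0 \<odot> wreath_action B b0 f) Z \<in> word_ball A T (c + c * n)" for Z
      unfolding mass_mult[OF f0 action_closed[OF b0 f]] mass_action[OF b0 f]
      by (rule word_ball_mult[OF A.is_group T m0]) (use IH h' in simp)
    then show "fst (s \<otimes>\<^bsub>W\<^esub> h) \<in> base \<and> (\<forall>Z. mass (fst (s \<otimes>\<^bsub>W\<^esub> h)) Z \<in> word_ball A T (c * Suc n))"
      unfolding s' h' mult_wreath using base_mult_closed[OF f0 action_closed[OF b0 f]] by (simp del: mult_sum_group)
  next
    fix m n :: nat and h :: "('b \<Rightarrow> 'a) \<times> 'b" assume IH: "fst h \<in> base \<and> (\<forall>Z. mass (fst h) Z \<in> word_ball A T (c * m))" and mn: "m \<le> n"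
    have "c * m \<le> c * n" using mn by simp
    then show "fst h \<in> base \<and> (\<forall>Z. mass (fst h) Z \<in> word_ball A T (c * n))"
      using IH word_ball_mono[of "c * m" "c * n" A T] by blast
  qed
  then show ?thesis by (intro exI[of _ c]) force
qed

section \<open>Sufficiency\<close>

lemma (in wreath_pair) finite_top_sufficient:
  assumes C: "pseudovariety C" "extension_closed C" and cA: "conjugacy_separable C A" and B: "in_class C B"
  shows "conjugacy_separable C W"
  unfolding conjugacy_separable_def
proof (intro ballI separableI_conj[OF wreath_group])
  fix g h assume g: "g \<in> carrier W" and h: "h \<in> carrier W" and nc: "\<not> conj_in W g h"
  obtain f b where g': "g = (f, b)" "f \<in> base" "b \<in> carrier B" using g by (cases g) (auto simp: carrier_wreath)
  obtain f' b' where h': "h = (f', b')" "f' \<in> base" "b' \<in> carrier B" using h by (cases h) (auto simp: carrier_wreath)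
  let ?r = "group.ord B (inv b)"
  let ?t = "twist f (inv b) ?r" and ?t' = "twist f' (inv b') ?r"
  have t: "?t x \<in> carrier A" "?t' x \<in> carrier A" if "x \<in> carrier B" for x
    using twist_closed[OF g'(2)] twist_closed[OF h'(2)] g'(3) h'(3) that by auto
  let ?J = "{j \<in> carrier B \<times> carrier B. \<not> conj_in A (?t (fst j)) (?t' (snd j))}"
  let ?P = "\<lambda>j N. proj A N (?t' (snd j)) \<notin> proj A N ` conj_class A (?t (fst j))"
  have fin: "finite (carrier B)" by (rule in_class_finite[OF C(1) B])
  have "\<forall>j\<in>?J. \<exists>N. N \<in> class_normals C A \<and> ?P j N"
  proof
    fix j assume "j \<in> ?J"
    then have j: "fst j \<in> carrier B" "snd j \<in> carrier B" "\<not> conj_in A (?t (fst j)) (?t' (snd j))" by auto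
    show "\<exists>N. N \<in> class_normals C A \<and> ?P j N"
      using conjugacy_separableD[OF A.is_group cA t(1)[OF j(1)] t(2)[OF j(2)] j(3)] unfolding Bex_def .
  qed
  from bchoice[OF this] obtain N where "\<forall>j\<in>?J. N j \<in> class_normals C A \<and> ?P j (N j)" ..
  then have N: "\<And>j. j \<in> ?J \<Longrightarrow> N j \<in> class_normals C A \<and> ?P j (N j)" by (rule bspec)
  define k where "k = Suc (\<Sum>j\<in>?J. quot_card A (N j))"
  have fJ: "finite ?J" by (rule finite_subset[of _ "carrier B \<times> carrier B"]) (use fin in auto)
  have "conj_separated_within C A k (?t x) (?t' y)"
    if "x \<in> carrier B" "y \<in> carrier B" "\<not> conj_in A (?t x) (?t' y)" for x y
  proof -
    have j: "(x, y) \<in> ?J" using that by simp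
    have "quot_card A (N (x, y)) \<le> k"
      unfolding k_def using member_le_sum[OF j _ fJ, of "\<lambda>j. quot_card A (N j)"] by simp
    then show ?thesis using N[OF j] by (intro bexI[of _ "N (x, y)"]) auto
  qed
  from finite_top_separation[OF C B g'(2,3) h'(2,3) nc[unfolded g'(1) h'(1)] this]
  show "\<exists>N\<in>class_normals C W. proj W N h \<notin> proj W N ` conj_class W g"
    unfolding g'(1) h'(1) by (auto simp: k_def)
qed

context wreath_abelian
begin

lemma top_separation:
  assumes C: "pseudovariety C"
    and g: "g \<in> carrier W" "h \<in> carrier W"
    and M: "M \<in> class_normals C B" "quot_card B M \<le> k" "proj B M (snd h) \<notin> proj B M ` conj_class B (snd g)"
  shows "conj_separated_within C W k g h"
proof -
  have s: "snd g \<in> carrier B" "snd h \<in> carrier B" using hom_in_carrier[OF snd_hom] g by auto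
  have \<phi>: "proj B M \<circ> snd \<in> hom W (B Mod M)"
    by (rule hom_compose[OF snd_hom proj_hom[OF class_normalsD(1)[OF M(1)]]])
  have "\<not> conj_in (B Mod M) ((proj B M \<circ> snd) g) ((proj B M \<circ> snd) h)"
    using M(3) proj_conj_class_iff[OF B.is_group class_normalsD(1)[OF M(1)] s] by simp
  from conj_separated_by_hom[OF C wreath_group class_normalsD(2)[OF M(1)] \<phi> g this]
  obtain K where K: "K \<in> class_normals C W" "quot_card W K \<le> order (B Mod M)"
    "proj W K h \<notin> proj W K ` conj_class W g" by blast
  have "order (B Mod M) \<le> k" using M(2) by (simp add: order_def carrier_Mod)
  with K show ?thesis by (intro bexI[of _ K]) auto
qed

lemma passes_tests_exists:
  assumes C: "pseudovariety C" and cA: "conjugacy_separable C A" and cB: "conjugacy_separable C B"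
    and yB: "cyclic_subgroup_separable C B"
    and f: "f \<in> base" and b: "b \<in> carrier B" and f': "f' \<in> base" and b': "b' \<in> carrier B"
    and t: "test_data f b f' b' n J L P"
  shows "\<exists>M\<in>class_normals C B. \<exists>N\<in>class_normals C A. passes_tests J L P M N"
proof -
  have sB: "x \<in> carrier B" if "x \<in> supp A B f \<union> supp A B f'" for x using that by (auto simp: supp_def)
  have fin: "finite J" "finite L" "finite P" using t by (simp_all add: test_data_def)
  have J: "fst j \<in> carrier B \<and> snd j \<in> carrier B \<and> snd j \<notin> cyc (fst j)" if j: "j \<in> J" for j
  proof -
    obtain u v w y where "{u, v, w, y} \<subseteq> supp A B f \<union> supp A B f'" "snd j = u \<otimes> inv v \<otimes> w \<otimes> inv y"
      "fst j \<in> {b, b'}" "snd j \<notin> cyc (fst j)"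
      using t j unfolding test_data_def by (cases j) fastforce
    then show ?thesis using sB[of u] sB[of v] sB[of w] sB[of y] b b' by auto
  qed
  have L: "fst j \<in> carrier B \<and> snd j \<in> carrier B \<and> fst j \<noteq> snd j" if j: "j \<in> L" for j
  proof -
    obtain x y g g' where "{x, y} \<subseteq> supp A B f \<union> supp A B f'" "{g, g'} \<subseteq> {b, b'}"
      "fst j = g \<otimes> (x \<otimes> inv y)" "snd j = x \<otimes> inv y \<otimes> g'" "fst j \<noteq> snd j"
      using t j unfolding test_data_def by (cases j) fastforce
    then show ?thesis using sB[of x] sB[of y] b b' by auto
  qed
  have P: "fst j \<in> carrier A \<and> snd j \<in> carrier A \<and> fst j \<noteq> snd j" if j: "j \<in> P" for j
  proof -
    have "{fst j, snd j} \<subseteq> insert \<one>\<^bsub>A\<^esub> (range (mass f) \<union> range (mass f'))" "fst j \<noteq> snd j"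
      using t j unfolding test_data_def by (cases j; fastforce)+
    then show ?thesis using mass_closed[OF f] mass_closed[OF f'] by auto
  qed
  have "\<exists>M\<in>class_normals C B. \<forall>j\<in>J. proj B M (snd j) \<notin> proj B M ` cyc (fst j)"
  proof (rule class_normals_INT'[OF C B.is_group fin(1)])
    fix j assume "j \<in> J"
    then show "\<exists>M\<in>class_normals C B. proj B M (snd j) \<notin> proj B M ` cyc (fst j)"
      using J separableD[of C B "cyc (fst j)" "snd j"] yB by (simp add: cyclic_subgroup_separable_def)
  next
    fix j M M' assume j: "j \<in> J" and m: "proj B M (snd j) \<notin> proj B M ` cyc (fst j)" and MM: "M' \<subseteq> M" "M \<in> class_normals C B" "M' \<in> class_normals C B"
    have "cyc (fst j) \<subseteq> carrier B" using cyc_closed J[OF j] by blast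
    then show "proj B M' (snd j) \<notin> proj B M' ` cyc (fst j)"
      using proj_not_in_image_mono[OF B.is_group MM(2,3,1) _ _ m] J[OF j] by simp
  qed
  then obtain M1 where M1: "M1 \<in> class_normals C B" "\<forall>j\<in>J. proj B M1 (snd j) \<notin> proj B M1 ` cyc (fst j)" by blast
  have "finite (fst ` L \<union> snd ` L)" "fst ` L \<union> snd ` L \<subseteq> carrier B" using fin(2) L by auto
  from residually_injective[OF C B.is_group cB this]
  obtain M2 where M2: "M2 \<in> class_normals C B" "inj_on (proj B M2) (fst ` L \<union> snd ` L)" by blast
  have "finite (fst ` P \<union> snd ` P)" "fst ` P \<union> snd ` P \<subseteq> carrier A" using fin(3) P by auto
  from residually_injective[OF C A.is_group cA this]
  obtain N where N: "N \<in> class_normals C A" "inj_on (proj A N) (fst ` P \<union> snd ` P)" by blast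
  let ?M = "M1 \<inter> M2"
  have M: "?M \<in> class_normals C B" by (rule class_normals_Int(1)[OF C B.is_group M1(1) M2(1)])
  have "proj B ?M h \<notin> proj B ?M ` cyc g" if j: "(g, h) \<in> J" for g h
  proof -
    have "cyc g \<subseteq> carrier B" using cyc_closed J[OF j] by auto
    then show ?thesis
      using proj_not_in_image_mono[OF B.is_group M1(1) M _ _ _ M1(2)[rule_format, OF j]] J[OF j] by simp
  qed
  moreover have "proj B ?M u \<noteq> proj B ?M v" if j: "(u, v) \<in> L" for u v
  proof
    assume "proj B ?M u = proj B ?M v"
    then have "proj B M2 u = proj B M2 v"
      using proj_mono_eq[OF B.is_group class_normalsD(3)[OF M2(1)] class_normalsD(3)[OF M]] L[OF j] by simp
    then show False using inj_onD[OF M2(2), of u v] L[OF j] j by force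
  qed
  moreover have "proj A N p \<noteq> proj A N q" if j: "(p, q) \<in> P" for p q
    using inj_onD[OF N(2), of p q] P[OF j] j by force
  ultimately have "passes_tests J L P ?M N" unfolding passes_tests_def by blast
  then show ?thesis using M N(1) by blast
qed

lemma abelian_sufficient:
  assumes C: "pseudovariety C" "extension_closed C" and cA: "conjugacy_separable C A" and cB: "conjugacy_separable C B"
    and yB: "cyclic_subgroup_separable C B"
  shows "conjugacy_separable C W"
  unfolding conjugacy_separable_def
proof (intro ballI separableI_conj[OF wreath_group])
  fix g h assume g: "g \<in> carrier W" and h: "h \<in> carrier W" and nc: "\<not> conj_in W g h"
  obtain f b where g': "g = (f, b)" "f \<in> base" "b \<in> carrier B" using g by (cases g) (auto simp: carrier_wreath)
  obtain f' b' where h': "h = (f', b')" "f' \<in> base" "b' \<in> carrier B" using h by (cases h) (auto simp: carrier_wreath)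
  show "\<exists>N\<in>class_normals C W. proj W N h \<notin> proj W N ` conj_class W g"
  proof (cases "conj_in B b b'")
    case False
    from conjugacy_separableD[OF B.is_group cB g'(3) h'(3) this]
    obtain M where "M \<in> class_normals C B" "proj B M b' \<notin> proj B M ` conj_class B b" by blast
    then show ?thesis using top_separation[OF C(1) g h, of M "quot_card B M"] g'(1) h'(1) by auto
  next
    case True
    define n where "n = max (card (supp A B f)) (card (supp A B f'))"
    from separating_tests[OF g'(2,3) h'(2,3) nc[unfolded g'(1) h'(1)] True, of n]
    obtain J L P where t: "test_data f b f' b' n J L P" and
      s: "\<And>M N. M \<lhd> B \<Longrightarrow> N \<lhd> A \<Longrightarrow> passes_tests J L P M N \<Longrightarrow>
      separated_mod M N (f, b) (f', b')" unfolding n_def by auto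
    from passes_tests_exists[OF C(1) cA cB yB g'(2,3) h'(2,3) t]
    obtain M N where MN: "M \<in> class_normals C B" "N \<in> class_normals C A" "passes_tests J L P M N" by blast
    have "separated_mod M N g h"
      unfolding g'(1) h'(1) by (rule s[OF class_normalsD(1)[OF MN(1)] class_normalsD(1)[OF MN(2)] MN(3)])
    from separating_quotient[OF C MN(1,2) g h this] show ?thesis by blast
  qed
qed

end

section \<open>Bounds when the top group lies in the class\<close>

lemma in_class_Conj_fun_bounded:
  assumes C: "pseudovariety C" and G: "in_class C G" and S: "fin_gen_set G S"
  shows "Conj_fun C G S n \<le> order G"
proof (rule Conj_fun_le[OF in_class_group[OF G] S])
  have gr: "group G" by (rule in_class_group[OF G])
  show "1 \<le> order G" using monoid.order_gt_0_iff_finite[OF group.is_monoid[OF gr]] in_class_finite[OF C G] by simp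
  fix g h assume "g \<in> word_ball G S n" "h \<in> word_ball G S n" "\<not> conj_in G g h"
  then show "conj_separated_within C G (order G) g h"
    using conj_separated_by_hom[OF C gr G, of id g h] by (simp add: hom_def word_ball_closed)
qed

lemma (in wreath_pair) finite_top_bound:
  assumes C: "pseudovariety C" "extension_closed C" and cA: "conjugacy_separable C A" and B: "in_class C B"
    and T: "fin_gen_set A T" and S: "fin_gen_set W S"
  shows "Conj_fun C W S \<preceq> (\<lambda>n. Conj_fun C A T n ^ (order B ^ 3))"
proof -
  have fin: "finite (carrier B)" by (rule in_class_finite[OF C(1) B])
  have o1: "1 \<le> order B" using B.order_gt_0_iff_finite fin by simp
  obtain c where c: "\<And>n f b. (f, b) \<in> word_ball W S n \<Longrightarrow> \<forall>x\<in>carrier B. f x \<in> word_ball A T (c * n)"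
    using wreath_ball_value[OF S T] by blast
  define K where "K = order B + order B * c"
  have "Conj_fun C W S n \<le> K * Conj_fun C A T (K * n) ^ (order B ^ 3)" for n
  proof (rule Conj_fun_le[OF wreath_group S])
    let ?k = "Conj_fun C A T (K * n)"
    have k1: "1 \<le> ?k" by (rule Conj_fun_ge_1[OF A.is_group T])
    have K1: "order B \<le> K" "1 \<le> K" using o1 by (simp_all add: K_def)
    have "1 * 1 \<le> K * ?k ^ (order B ^ 3)" by (rule mult_le_mono[OF K1(2) one_le_power[OF k1]])
    then show "1 \<le> K * ?k ^ (order B ^ 3)" by simp
    fix g h assume g: "g \<in> word_ball W S n" and h: "h \<in> word_ball W S n" and nc: "\<not> conj_in W g h"
    obtain f b where g': "g = (f, b)" "f \<in> base" "b \<in> carrier B" using word_ball_closed[OF g] by (cases g) (auto simp: carrier_wreath)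
    obtain f' b' where h': "h = (f', b')" "f' \<in> base" "b' \<in> carrier B" using word_ball_closed[OF h] by (cases h) (auto simp: carrier_wreath)
    let ?r = "group.ord B (inv b)"
    have "?r \<le> order B" by (rule B.ord_le_group_order[OF fin]) (simp add: g')
    then have rc: "?r * (c * n) \<le> K * n" unfolding K_def by (simp add: algebra_simps trans_le_add2)
    have t: "twist f (inv b) ?r x \<in> word_ball A T (K * n)" "twist f' (inv b') ?r x \<in> word_ball A T (K * n)" if "x \<in> carrier B" for x
      by (rule word_ball_mono'[OF twist_ball[OF c[OF g[unfolded g'(1)]] T B.inv_closed[OF g'(3)] that] rc],
        rule word_ball_mono'[OF twist_ball[OF c[OF h[unfolded h'(1)]] T B.inv_closed[OF h'(3)] that] rc])
    have "conj_separated_within C A ?k (twist f (inv b) ?r x) (twist f' (inv b') ?r y)"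
      if "x \<in> carrier B" "y \<in> carrier B" "\<not> conj_in A (twist f (inv b) ?r x) (twist f' (inv b') ?r y)" for x y
      by (rule Conj_fun_witness[OF A.is_group T cA t(1)[OF that(1)] t(2)[OF that(2)] that(3)])
    from finite_top_separation[OF C B g'(2,3) h'(2,3) nc[unfolded g'(1) h'(1)] this k1]
    obtain N where N: "N \<in> class_normals C W" "quot_card W N \<le> ?k ^ (order B * order B) * order B"
      "proj W N h \<notin> proj W N ` conj_class W g" unfolding g'(1) h'(1) by blast
    have "order B * order B \<le> order B ^ 3" using o1 by (simp add: power3_eq_cube)
    then have "?k ^ (order B * order B) * order B \<le> ?k ^ (order B ^ 3) * K"
      by (intro mult_le_mono power_increasing k1 K1(1))
    then have "quot_card W N \<le> K * ?k ^ (order B ^ 3)" using N(2) by (simp add: mult.commute)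
    then show "conj_separated_within C W (K * ?k ^ (order B ^ 3)) g h" using N by (intro bexI[of _ N]) auto
  qed
  then show ?thesis unfolding preceq_def by blast
qed

section \<open>Bounds for an abelian base\<close>

lemma RG_fun_mono:
  assumes "group G" "fin_gen_set G S" "pseudovariety C" "conjugacy_separable C G" "m \<le> n"
  shows "RG_fun C G S m \<le> RG_fun C G S n"
proof -
  obtain N where N: "N \<in> class_normals C G" "quot_card G N = RG_fun C G S n" "inj_on (proj G N) (word_ball G S n)"
    using RG_fun_witness[OF assms(1,2,3,4), of n] by blast
  have "inj_on (proj G N) (word_ball G S m)" by (rule inj_on_subset[OF N(3) word_ball_mono[OF assms(5)]])
  from RG_fun_le[OF assms(1,2) N(1) this] show ?thesis using N(2) by simp
qed

text \<open>
  A nontrivial generator lies outside the trivial cyclic subgroup. With base at least 2, powers of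
  \<open>Cyclic_fun\<close> can absorb constant factors.
\<close>

lemma Cyclic_fun_ge_2:
  assumes G: "group G" "fin_gen_set G S" and C: "pseudovariety C" and y: "cyclic_subgroup_separable C G"
    and nt: "carrier G \<noteq> {\<one>\<^bsub>G\<^esub>}" and n: "1 \<le> n"
  shows "2 \<le> Cyclic_fun C G S n"
proof -
  interpret group G by fact
  have one: "generate G {\<one>\<^bsub>G\<^esub>} \<subseteq> {\<one>\<^bsub>G\<^esub>}"
    by (rule generate_subgroup_incl[OF subset_refl triv_subgroup])
  have "\<not> S \<subseteq> {\<one>\<^bsub>G\<^esub>}"
  proof
    assume "S \<subseteq> {\<one>\<^bsub>G\<^esub>}"
    then have "carrier G \<subseteq> {\<one>\<^bsub>G\<^esub>}" using generate_subgroup_incl[OF \<open>S \<subseteq> {\<one>\<^bsub>G\<^esub>}\<close> triv_subgroup] G(2)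
      unfolding fin_gen_set_def by simp
    then show False using nt one_closed by blast
  qed
  then obtain s where s: "s \<in> S" "s \<noteq> \<one>\<^bsub>G\<^esub>" by blast
  have "s \<in> word_ball G S 1" by (rule word_ball_gens[OF G]) (use s in simp)
  then have sb: "s \<in> word_ball G S n" using n by (rule word_ball_mono')
  have sn: "s \<notin> generate G {\<one>\<^bsub>G\<^esub>}" using s one by blast
  obtain N where N: "N \<in> class_normals C G" "quot_card G N \<le> Cyclic_fun C G S n" "proj G N s \<notin> proj G N ` generate G {\<one>\<^bsub>G\<^esub>}"
    using Cyclic_fun_witness[OF G y word_ball_one[OF G] sb sn] by blast
  have "proj G N s \<noteq> proj G N \<one>\<^bsub>G\<^esub>" using N(3) generate.one[of G "{\<one>\<^bsub>G\<^esub>}"] by blast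
  moreover have "{proj G N s, proj G N \<one>\<^bsub>G\<^esub>} \<subseteq> rcosets\<^bsub>G\<^esub> N"
    using carrier_Mod_proj[of G N] word_ball_closed[OF sb] by (simp add: carrier_Mod)
  ultimately have "2 \<le> quot_card G N"
    using card_mono[OF class_normals_index(1)[OF C G(1) N(1)], of "{proj G N s, proj G N \<one>\<^bsub>G\<^esub>}"] by simp
  then show ?thesis using N(2) by simp
qed

lemma Psi_fun_ge_1:
  assumes "group B" "fin_gen_set B T" "pseudovariety C" "conjugacy_separable C B"
  shows "1 \<le> Psi_fun C B T n"
  using RG_fun_ge_1[OF assms] Cyclic_fun_ge_1[OF assms(1,2)] unfolding Psi_fun_def
  by (simp add: Suc_le_eq)

text \<open>
  The separation at radius \<open>c n\<close> takes place in balls of radius \<open>3 c n\<close> and \<open>4 c n\<close> and uses quadratically many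
  cyclic subgroups. As \<open>Phi_fun B T m\<close> is at least \<open>m\<close>, passing from \<open>n\<close> to \<open>K n\<close> leaves room in the
  exponent of \<open>Psi_fun\<close> for all of this and for a further factor \<open>2 ^ l\<close>.
\<close>

lemma Psi_fun_absorbs:
  assumes B: "group B" "fin_gen_set B T" and C: "pseudovariety C" and cB: "conjugacy_separable C B"
    and y: "cyclic_subgroup_separable C B" and nt: "carrier B \<noteq> {\<one>\<^bsub>B\<^esub>}"
    and n: "1 \<le> n" and K: "4 * c + l + 1 \<le> K"
  shows "RG_fun C B T (3 * (c * n)) * Cyclic_fun C B T (4 * (c * n)) ^ (c * n + 2 * (c * n) * (c * n)) * 2 ^ l \<le> Psi_fun C B T (K * n)"
    and "1 + c * n \<le> Psi_fun C B T (K * n)"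
proof -
  define F where "F = Phi_fun B T (K * n)"
  let ?m = "c * n"
  let ?R = "RG_fun C B T F" and ?Y = "Cyclic_fun C B T F"
  have "(4 * c + l + 1) * n \<le> K * n" using K by (rule mult_le_mono1)
  moreover have "(4 * c + l + 1) * n = 4 * ?m + l * n + n" by (simp add: algebra_simps)
  moreover have "l * 1 \<le> l * n" using n by (rule mult_le_mono2)
  moreover have "K * n \<le> F" unfolding F_def Phi_fun_def by simp
  ultimately have F: "4 * ?m + l + n \<le> F" by linarith
  have Y2: "2 \<le> ?Y" by (rule Cyclic_fun_ge_2[OF B C y nt]) (use F n in linarith)
  have R: "RG_fun C B T (3 * ?m) \<le> ?R" by (rule RG_fun_mono[OF B C cB]) (use F in linarith)
  have Y: "Cyclic_fun C B T (4 * ?m) \<le> ?Y" by (rule Cyclic_fun_mono[OF B]) (use F in linarith)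
  have Psi: "Psi_fun C B T (K * n) = ?R * ?Y ^ (F\<^sup>2)" unfolding Psi_fun_def F_def ..
  have sq: "?m \<le> ?m * ?m" "l \<le> l * l" by (simp_all add: le_square)
  have "(4 * ?m + l)\<^sup>2 \<le> F\<^sup>2" by (rule power_mono) (use F in linarith, simp)
  then have "16 * (?m * ?m) + l * l \<le> F\<^sup>2" by (simp add: power2_eq_square algebra_simps)
  moreover have "2 * ?m * ?m = 2 * (?m * ?m)" by (rule mult.assoc)
  ultimately have e: "?m + 2 * ?m * ?m + l \<le> F\<^sup>2" using sq by linarith
  have "RG_fun C B T (3 * ?m) * Cyclic_fun C B T (4 * ?m) ^ (?m + 2 * ?m * ?m) * 2 ^ l
      \<le> ?R * ?Y ^ (?m + 2 * ?m * ?m) * ?Y ^ l"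
    by (intro mult_le_mono R power_mono Y Y2) simp_all
  also have "\<dots> = ?R * ?Y ^ (?m + 2 * ?m * ?m + l)" by (simp add: power_add)
  also have "\<dots> \<le> ?R * ?Y ^ (F\<^sup>2)" by (intro mult_le_mono2 power_increasing e) (use Y2 in linarith)
  finally show "RG_fun C B T (3 * ?m) * Cyclic_fun C B T (4 * ?m) ^ (?m + 2 * ?m * ?m) * 2 ^ l \<le> Psi_fun C B T (K * n)"
    unfolding Psi .
  have "1 + ?m \<le> F" using F n by linarith
  also have "F \<le> F\<^sup>2" by (simp add: power2_eq_square le_square)
  also have "F\<^sup>2 \<le> 2 ^ (F\<^sup>2)" by (rule less_imp_le[OF less_exp])
  also have "(2::nat) ^ (F\<^sup>2) \<le> ?Y ^ (F\<^sup>2)" by (rule power_mono[OF Y2]) simp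
  also have "\<dots> \<le> ?R * ?Y ^ (F\<^sup>2)" using RG_fun_ge_1[OF B C cB, of F] by simp
  finally show "1 + ?m \<le> Psi_fun C B T (K * n)" unfolding Psi .
qed

context wreath_abelian
begin

text \<open>
  Every test element is a word of length at most four in elements of the ball of radius \<open>m\<close>, hence the radii
  \<open>3 m\<close> and \<open>4 m\<close>.
\<close>

lemma top_quotient_bound:
  assumes C: "pseudovariety C" and cB: "conjugacy_separable C B" and yB: "cyclic_subgroup_separable C B"
    and T: "fin_gen_set B T"
    and b: "b \<in> word_ball B T m" and b': "b' \<in> word_ball B T m"
    and s: "supp A B f \<subseteq> word_ball B T m" "supp A B f' \<subseteq> word_ball B T m"
    and t: "test_data f b f' b' m J L P"
  shows "\<exists>M\<in>class_normals C B. quot_card B M \<le> RG_fun C B T (3 * m) * Cyclic_fun C B T (4 * m) ^ (m + 2 * m * m) \<and>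
    (\<forall>(g, h)\<in>J. proj B M h \<notin> proj B M ` cyc g) \<and> (\<forall>(u, v)\<in>L. proj B M u \<noteq> proj B M v)"
proof -
  let ?Y = "Cyclic_fun C B T (4 * m)"
  have sb: "x \<in> word_ball B T m" if "x \<in> supp A B f \<union> supp A B f'" for x using that s by blast
  note bm = word_ball_mult[OF B.is_group T] and bi = word_ball_inv[OF B.is_group T]
  have J: "fst j \<in> word_ball B T (4 * m) \<and> snd j \<in> word_ball B T (4 * m) \<and> snd j \<notin> cyc (fst j)" if j: "j \<in> J" for j
  proof -
    obtain u v w y where u: "{u, v, w, y} \<subseteq> supp A B f \<union> supp A B f'" "snd j = u \<otimes> inv v \<otimes> w \<otimes> inv y"
      and g: "fst j \<in> {b, b'}" "snd j \<notin> cyc (fst j)"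
      using t j unfolding test_data_def by (cases j) fastforce
    have "u \<otimes> inv v \<otimes> w \<otimes> inv y \<in> word_ball B T (m + m + m + m)"
      by (intro bm bi sb) (use u(1) in auto)
    also have "m + m + m + m = 4 * m" by simp
    finally have "snd j \<in> word_ball B T (4 * m)" using u(2) by simp
    moreover have "fst j \<in> word_ball B T (4 * m)" using g(1) b b' word_ball_mono'[of _ B T m "4 * m"] by auto
    ultimately show ?thesis using g(2) by blast
  qed
  have L: "fst j \<in> word_ball B T (3 * m) \<and> snd j \<in> word_ball B T (3 * m) \<and> fst j \<noteq> snd j" if j: "j \<in> L" for j
  proof -
    obtain x y g g' where x: "{x, y} \<subseteq> supp A B f \<union> supp A B f'" and g: "{g, g'} \<subseteq> {b, b'}" and
      e: "fst j = g \<otimes> (x \<otimes> inv y)" "snd j = x \<otimes> inv y \<otimes> g'" "fst j \<noteq> snd j"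
      using t j unfolding test_data_def by (cases j) fastforce
    have gg: "g \<in> word_ball B T m" "g' \<in> word_ball B T m" using g b b' by auto
    have "g \<otimes> (x \<otimes> inv y) \<in> word_ball B T (m + (m + m))"
      by (intro bm bi sb gg) (use x in auto)
    moreover have "x \<otimes> inv y \<otimes> g' \<in> word_ball B T (m + m + m)"
      by (intro bm bi sb gg) (use x in auto)
    moreover have "m + (m + m) = 3 * m" "m + m + m = 3 * m" by simp_all
    ultimately show ?thesis using e by simp
  qed
  have fJ: "finite J" "card J \<le> m + 2 * m * m" using t by (simp_all add: test_data_def)
  have Jc: "cyc (fst j) \<subseteq> carrier B" if "j \<in> J" for j
    using cyc_closed[OF word_ball_closed[OF conjunct1[OF J[OF that]]]] by (intro subsetI)
  have "\<exists>M\<in>class_normals C B. quot_card B M \<le> ?Y ^ card J \<and> (\<forall>j\<in>J. proj B M (snd j) \<notin> proj B M ` cyc (fst j))"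
  proof (rule class_normals_INT[OF C B.is_group fJ(1)])
    fix j assume j: "j \<in> J"
    show "\<exists>M\<in>class_normals C B. quot_card B M \<le> ?Y \<and> proj B M (snd j) \<notin> proj B M ` cyc (fst j)"
      by (rule Cyclic_fun_witness[OF B.is_group T yB]) (use J[OF j] in auto)
  next
    fix j M M' assume j: "j \<in> J" and mm: "proj B M (snd j) \<notin> proj B M ` cyc (fst j)" and MM: "M' \<subseteq> M" "M \<in> class_normals C B" "M' \<in> class_normals C B"
    show "proj B M' (snd j) \<notin> proj B M' ` cyc (fst j)"
      by (rule proj_not_in_image_mono[OF B.is_group MM(2,3,1) word_ball_closed Jc[OF j] mm]) (use J[OF j] in blast)
  qed
  then obtain M1 where M1: "M1 \<in> class_normals C B" "quot_card B M1 \<le> ?Y ^ card J" "\<forall>j\<in>J. proj B M1 (snd j) \<notin> proj B M1 ` cyc (fst j)" by blast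
  obtain M2 where M2: "M2 \<in> class_normals C B" "quot_card B M2 = RG_fun C B T (3 * m)" "inj_on (proj B M2) (word_ball B T (3 * m))"
    using RG_fun_witness[OF B.is_group T C cB, of "3 * m"] by blast
  let ?M = "M2 \<inter> M1"
  note M = class_normals_Int[OF C B.is_group M2(1) M1(1)]
  have "?Y ^ card J \<le> ?Y ^ (m + 2 * m * m)" by (rule power_increasing[OF fJ(2) Cyclic_fun_ge_1[OF B.is_group T]])
  then have "quot_card B ?M \<le> RG_fun C B T (3 * m) * ?Y ^ (m + 2 * m * m)"
    using order_trans[OF M(2) mult_le_mono2[OF order_trans[OF M1(2)]]] M2(2) by simp
  moreover have "proj B ?M h \<notin> proj B ?M ` cyc g" if j: "(g, h) \<in> J" for g h
    by (rule proj_not_in_image_mono[OF B.is_group M1(1) M(1) Int_lower2 word_ball_closed _ M1(3)[rule_format, OF j, unfolded fst_conv snd_conv]])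
      (use J[OF j] Jc[OF j] in auto)
  moreover have "proj B ?M u \<noteq> proj B ?M v" if j: "(u, v) \<in> L" for u v
  proof
    assume e: "proj B ?M u = proj B ?M v"
    have uv: "u \<in> word_ball B T (3 * m)" "v \<in> word_ball B T (3 * m)" "u \<noteq> v" using L[OF j] by auto
    have "proj B M2 u = proj B M2 v"
      by (rule proj_mono_eq[OF B.is_group class_normalsD(3)[OF M2(1)] class_normalsD(3)[OF M(1)] Int_lower1 word_ball_closed[OF uv(1)] word_ball_closed[OF uv(2)] e])
    then show False using inj_onD[OF M2(3) _ uv(1,2)] uv(3) by blast
  qed
  ultimately show ?thesis using M(1) by (intro bexI[of _ ?M]) auto
qed

lemma base_quotient_bound:
  assumes C: "pseudovariety C" and cA: "conjugacy_separable C A" and T: "fin_gen_set A T"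
    and s: "\<And>Z. mass f Z \<in> word_ball A T m" "\<And>Z. mass f' Z \<in> word_ball A T m"
    and t: "test_data f b f' b' q J L P"
  shows "\<exists>N\<in>class_normals C A. quot_card A N \<le> Conj_fun C A T m ^ (1 + q) \<and> (\<forall>(p, q)\<in>P. proj A N p \<noteq> proj A N q)"
proof -
  let ?k = "Conj_fun C A T m"
  have P: "fst j \<in> word_ball A T m \<and> snd j \<in> word_ball A T m \<and> fst j \<noteq> snd j" if j: "j \<in> P" for j
  proof -
    have "{fst j, snd j} \<subseteq> insert \<one>\<^bsub>A\<^esub> (range (mass f) \<union> range (mass f'))" "fst j \<noteq> snd j"
      using t j unfolding test_data_def by (cases j; fastforce)+
    then show ?thesis using s word_ball_one[OF A.is_group T] by auto
  qed
  have fP: "finite P" "card P \<le> 1 + q" using t by (simp_all add: test_data_def)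
  have "\<exists>N\<in>class_normals C A. quot_card A N \<le> ?k ^ card P \<and> (\<forall>j\<in>P. proj A N (fst j) \<noteq> proj A N (snd j))"
  proof (rule class_normals_INT[OF C A.is_group fP(1)])
    fix j assume j: "j \<in> P"
    have c: "fst j \<in> carrier A" "snd j \<in> carrier A" using P[OF j] by (auto simp: word_ball_def)
    have "\<not> conj_in A (fst j) (snd j)"
    proof
      assume "conj_in A (fst j) (snd j)"
      then obtain x where "x \<in> carrier A" "fst j \<otimes>\<^bsub>A\<^esub> x = x \<otimes>\<^bsub>A\<^esub> snd j" by (auto simp: conj_in_def)
      then show False using P[OF j] c by (simp add: A.m_comm)
    qed
    from Conj_fun_witness[OF A.is_group T cA _ _ this, of m]
    obtain N where N: "N \<in> class_normals C A" "quot_card A N \<le> ?k" "proj A N (snd j) \<notin> proj A N ` conj_class A (fst j)"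
      using P[OF j] by blast
    have "fst j \<in> conj_class A (fst j)" unfolding conj_class_iff[OF A.is_group c(1) c(1)] conj_in_def by (intro bexI[OF _ c(1)]) (rule refl)
    from imageI[OF this, of "proj A N"] have "proj A N (fst j) \<noteq> proj A N (snd j)" using N(3) by (intro notI) simp
    then show "\<exists>N\<in>class_normals C A. quot_card A N \<le> ?k \<and> proj A N (fst j) \<noteq> proj A N (snd j)"
      using N by (intro bexI[of _ N]) auto
  next
    fix j N N' assume j: "j \<in> P" and mm: "proj A N (fst j) \<noteq> proj A N (snd j)" and NN: "N' \<subseteq> N" "N \<in> class_normals C A" "N' \<in> class_normals C A"
    have c: "fst j \<in> carrier A" "snd j \<in> carrier A" using P[OF j] by (auto simp: word_ball_def)
    show "proj A N' (fst j) \<noteq> proj A N' (snd j)"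
      using proj_mono_eq[OF A.is_group class_normalsD(3)[OF NN(2)] class_normalsD(3)[OF NN(3)] NN(1) c] mm by blast
  qed
  then obtain N where N: "N \<in> class_normals C A" "quot_card A N \<le> ?k ^ card P" "\<forall>j\<in>P. proj A N (fst j) \<noteq> proj A N (snd j)" by blast
  have "?k ^ card P \<le> ?k ^ (1 + q)" by (rule power_increasing[OF fP(2) Conj_fun_ge_1[OF A.is_group T]])
  then show ?thesis using N by (intro bexI[of _ N]) auto
qed

text \<open>
  The common part of both bounds for abelian \<open>A\<close>: if the tests in \<open>A\<close> are passed by a quotient of order at
  most \<open>a\<close> and those in \<open>B\<close> by one of order at most \<open>Q\<close>, the wreath product of the quotients has order
  at most \<open>a ^ Q * Q\<close>. The other term of the maximum handles pairs with non-conjugate top parts, which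
  already \<open>B\<close> separates.
\<close>

lemma abelian_bound_step:
  assumes C: "pseudovariety C" "extension_closed C" and cB: "conjugacy_separable C B" and yB: "cyclic_subgroup_separable C B"
    and T: "fin_gen_set B T" and S: "fin_gen_set W S"
    and c: "\<And>n f b. (f, b) \<in> word_ball W S n \<Longrightarrow>
      b \<in> word_ball B T (c * n) \<and> supp A B f \<subseteq> word_ball B T (c * n) \<and> card (supp A B f) \<le> c * n"
    and bq: "\<And>f b f' b' J L P. (f, b) \<in> word_ball W S n \<Longrightarrow> (f', b') \<in> word_ball W S n \<Longrightarrow>
      test_data f b f' b' (c * n) J L P \<Longrightarrow>
      \<exists>N\<in>class_normals C A. quot_card A N \<le> a \<and> (\<forall>(p, q)\<in>P. proj A N p \<noteq> proj A N q)"
    and Q: "RG_fun C B T (3 * (c * n)) * Cyclic_fun C B T (4 * (c * n)) ^ (c * n + 2 * (c * n) * (c * n)) \<le> Q"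
    and a: "1 \<le> a"
  shows "Conj_fun C W S n \<le> max (Conj_fun C B T (c * n)) (a ^ Q * Q)"
proof (rule Conj_fun_le[OF wreath_group S])
  show "1 \<le> max (Conj_fun C B T (c * n)) (a ^ Q * Q)" using Conj_fun_ge_1[OF B.is_group T, of C "c * n"] by simp
  fix g h assume g: "g \<in> word_ball W S n" and h: "h \<in> word_ball W S n" and nc: "\<not> conj_in W g h"
  note gc = word_ball_closed[OF g] and hc = word_ball_closed[OF h]
  obtain f b where g': "g = (f, b)" "f \<in> base" "b \<in> carrier B" using gc by (cases g) (auto simp: carrier_wreath)
  obtain f' b' where h': "h = (f', b')" "f' \<in> base" "b' \<in> carrier B" using hc by (cases h) (auto simp: carrier_wreath)
  note cg = c[OF g[unfolded g'(1)]] and ch = c[OF h[unfolded h'(1)]]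
  show "conj_separated_within C W (max (Conj_fun C B T (c * n)) (a ^ Q * Q)) g h"
  proof (cases "conj_in B b b'")
    case False
    from Conj_fun_witness[OF B.is_group T cB _ _ this, of "c * n"] obtain M where
      "M \<in> class_normals C B" "quot_card B M \<le> Conj_fun C B T (c * n)" "proj B M b' \<notin> proj B M ` conj_class B b" using cg ch by blast
    then show ?thesis using g'(1) h'(1) by (intro top_separation[OF C(1) gc hc]) auto
  next
    case True
    from separating_tests[OF g'(2,3) h'(2,3) nc[unfolded g'(1) h'(1)] True, of "c * n"]
    obtain J L P where t: "test_data f b f' b' (c * n) J L P" and
      s: "\<And>M N. M \<lhd> B \<Longrightarrow> N \<lhd> A \<Longrightarrow> passes_tests J L P M N \<Longrightarrow>
      separated_mod M N (f, b) (f', b')" using cg ch by blast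
    obtain M where M: "M \<in> class_normals C B" "quot_card B M \<le> Q"
      "\<forall>(g, h)\<in>J. proj B M h \<notin> proj B M ` cyc g" "\<forall>(u, v)\<in>L. proj B M u \<noteq> proj B M v"
      using top_quotient_bound[OF C(1) cB yB T _ _ _ _ t] cg ch order_trans[OF _ Q] by blast
    obtain N where N: "N \<in> class_normals C A" "quot_card A N \<le> a" "\<forall>(p, q)\<in>P. proj A N p \<noteq> proj A N q"
      using bq[OF g[unfolded g'(1)] h[unfolded h'(1)] t] by blast
    have p: "passes_tests J L P M N" unfolding passes_tests_def using M(3,4) N(3) by blast
    have "separated_mod M N g h"
      unfolding g'(1) h'(1) by (rule s[OF class_normalsD(1)[OF M(1)] class_normalsD(1)[OF N(1)] p])
    from separating_quotient[OF C M(1) N(1) gc hc this] obtain K where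
      K: "K\<in>class_normals C W" "quot_card W K \<le> quot_card A N ^ quot_card B M * quot_card B M"
      "proj W K h \<notin> proj W K ` conj_class W g" by blast
    have "quot_card A N ^ quot_card B M \<le> a ^ quot_card B M" by (rule power_mono[OF N(2)]) simp
    also have "\<dots> \<le> a ^ Q" by (rule power_increasing[OF M(2) a])
    finally have "quot_card A N ^ quot_card B M * quot_card B M \<le> a ^ Q * Q"
      using M(2) by (rule mult_le_mono)
    then show ?thesis using K by (intro bexI[of _ K]) auto
  qed
qed

text \<open>
  A finite conjugacy separable \<open>A\<close> lies in the class, so that \<open>A\<close> itself serves as the quotient.
\<close>

lemma finite_base_bound:
  assumes C: "pseudovariety C" "extension_closed C" and cA: "conjugacy_separable C A" and cB: "conjugacy_separable C B"
    and yB: "cyclic_subgroup_separable C B" and fA: "finite (carrier A)"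
    and T: "fin_gen_set B T" and S: "fin_gen_set W S"
  shows "Conj_fun C W S \<preceq> (\<lambda>n. max (Conj_fun C B T n) (Psi_fun C B T n * 2 ^ Psi_fun C B T n))"
\<comment> \<open>For trivial B the function Cyclic_fun is constantly 1 and absorbs nothing, so this case is treated apart.\<close>
proof (cases "carrier B = {\<one>}")
  case True
  have A: "in_class C A" by (rule finite_conjugacy_separable_in_class[OF C(1) A.is_group cA fA])
  have B: "in_class C B" by (rule in_class_trivial[OF C(1) B.is_group True])
  note W = in_class_Conj_fun_bounded[OF C(1) in_class_wreath[OF C A B] S]
  have "Conj_fun C W S n \<le> order W *
      max (Conj_fun C B T (order W * n)) (Psi_fun C B T (order W * n) * 2 ^ Psi_fun C B T (order W * n))" for n
  proof -
    have "1 \<le> max (Conj_fun C B T (order W * n)) (Psi_fun C B T (order W * n) * 2 ^ Psi_fun C B T (order W * n))"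
      using Conj_fun_ge_1[OF B.is_group T] by (simp add: le_max_iff_disj)
    from W[of n] mult_le_mono2[OF this, of "order W"] show ?thesis
      unfolding mult_1_right by (rule order_trans)
  qed
  then show ?thesis unfolding preceq_def by blast
next
  case False
  obtain c where c: "\<And>n f b. (f, b) \<in> word_ball W S n \<Longrightarrow>
      b \<in> word_ball B T (c * n) \<and> supp A B f \<subseteq> word_ball B T (c * n) \<and> card (supp A B f) \<le> c * n"
    using wreath_ball_top[OF S T] by blast
  define a where "a = order A"
  have a1: "1 \<le> a" using A.order_gt_0_iff_finite fA by (simp add: a_def)
  define K where "K = 4 * c + a + 1"
  have A: "in_class C A" by (rule finite_conjugacy_separable_in_class[OF C(1) A.is_group cA fA])
  from in_class_one_normal[OF C(1) A]
  obtain N where N: "N \<in> class_normals C A" "quot_card A N \<le> a" "inj_on (proj A N) (carrier A)" unfolding a_def by blast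
  have "Conj_fun C W S n \<le> K * max (Conj_fun C B T (K * n)) (Psi_fun C B T (K * n) * 2 ^ Psi_fun C B T (K * n))" for n
  proof (cases "n = 0")
    \<comment> \<open>Scaling the argument by K gives no room at 0, but there the ball is trivial.\<close>
    case True
    have "1 * 1 \<le> K * max (Conj_fun C B T (K * n)) (Psi_fun C B T (K * n) * 2 ^ Psi_fun C B T (K * n))"
      by (rule mult_le_mono) (use Conj_fun_ge_1[OF B.is_group T, of C "K * n"] in \<open>auto simp: K_def\<close>)
    moreover have "Conj_fun C W S n \<le> 1 * 1" using Conj_fun_0[OF wreath_group S, of C] True by simp
    ultimately show ?thesis by (rule order_trans[rotated])
  next
    case False
    then have n: "1 \<le> n" by simp
    let ?Q = "RG_fun C B T (3 * (c * n)) * Cyclic_fun C B T (4 * (c * n)) ^ (c * n + 2 * (c * n) * (c * n))"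
    let ?p = "Psi_fun C B T (K * n)"
    have step: "Conj_fun C W S n \<le> max (Conj_fun C B T (c * n)) (a ^ ?Q * ?Q)"
    proof (rule abelian_bound_step[OF C cB yB T S c _ order_refl a1])
      fix f b f' b' J L P assume w: "(f, b) \<in> word_ball W S n" "(f', b') \<in> word_ball W S n"
        and t: "test_data f b f' b' (c * n) J L P"
      have f: "f \<in> base" "f' \<in> base" using word_ball_closed[OF w(1)] word_ball_closed[OF w(2)] by (simp_all add: carrier_wreath)
      have "proj A N p \<noteq> proj A N q" if "(p, q) \<in> P" for p q
      proof -
        have pq: "{p, q} \<subseteq> insert \<one>\<^bsub>A\<^esub> (range (mass f) \<union> range (mass f'))" "p \<noteq> q"
          using t that unfolding test_data_def by fastforce+
        then have "p \<in> carrier A" "q \<in> carrier A" using mass_closed[OF f(1)] mass_closed[OF f(2)] by auto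
        then show ?thesis using inj_onD[OF N(3)] pq(2) by blast
      qed
      then show "\<exists>N\<in>class_normals C A. quot_card A N \<le> a \<and> (\<forall>(p, q)\<in>P. proj A N p \<noteq> proj A N q)"
        using N(1,2) by blast
    qed
    have Q: "?Q * 2 ^ a \<le> ?p"
      by (rule Psi_fun_absorbs(1)[OF B.is_group T C(1) cB yB \<open>carrier B \<noteq> {\<one>}\<close> n]) (simp add: K_def)
    have "a * ?Q = ?Q * a" by (rule mult.commute)
    also have "\<dots> \<le> ?Q * 2 ^ a" by (intro mult_le_mono2 less_imp_le less_exp)
    finally have Qa: "a * ?Q \<le> ?p" using Q by (rule order_trans)
    have "?Q * 1 \<le> ?Q * 2 ^ a" by (intro mult_le_mono2) simp
    then have Q1: "?Q \<le> ?p" using Q unfolding mult_1_right by (rule order_trans)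
    have "a ^ ?Q \<le> (2 ^ a) ^ ?Q" by (rule power_mono[OF less_imp_le[OF less_exp]]) simp
    also have "\<dots> = 2 ^ (a * ?Q)" by (simp only: power_mult)
    also have "\<dots> \<le> 2 ^ ?p" by (rule power_increasing[OF Qa]) simp
    finally have "a ^ ?Q * ?Q \<le> 2 ^ ?p * ?p" using Q1 by (rule mult_le_mono)
    moreover have "Conj_fun C B T (c * n) \<le> Conj_fun C B T (K * n)"
      by (rule Conj_fun_mono[OF B.is_group T _ cB]) (simp add: K_def algebra_simps)
    ultimately have "Conj_fun C W S n \<le> max (Conj_fun C B T (K * n)) (?p * 2 ^ ?p)"
      using order_trans[OF step max.mono] by (simp only: mult.commute[of "?p"])
    also have "\<dots> \<le> K * max (Conj_fun C B T (K * n)) (?p * 2 ^ ?p)" by (simp add: K_def)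
    finally show ?thesis .
  qed
  then show ?thesis unfolding preceq_def by blast
qed

text \<open>
  The tests in \<open>A\<close> number at most \<open>1 + c\<^sub>1 n\<close>, so the quotient of \<open>A\<close> has order at most a power of \<open>Conj_fun\<close>
  with that exponent; the cube in the exponent of the bound leaves ample room.
\<close>

lemma abelian_base_bound:
  assumes C: "pseudovariety C" "extension_closed C" and cA: "conjugacy_separable C A" and cB: "conjugacy_separable C B"
    and yB: "cyclic_subgroup_separable C B"
    and U: "fin_gen_set A U" and T: "fin_gen_set B T" and S: "fin_gen_set W S"
  shows "Conj_fun C W S \<preceq> (\<lambda>n. max (Conj_fun C B T n)
    ((Psi_fun C B T n * Conj_fun C A U (Psi_fun C B T n * n)) ^ (Psi_fun C B T n ^ 3)))"
\<comment> \<open>For trivial B the function Cyclic_fun is constantly 1 and absorbs nothing; the wreath product is then a copy of A.\<close>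
proof (cases "carrier B = {\<one>}")
  case True
  have B: "in_class C B" by (rule in_class_trivial[OF C(1) B.is_group True])
  have "order B = 1" using True by (simp add: order_def)
  then obtain K where K: "\<And>n. Conj_fun C W S n \<le> K * Conj_fun C A U (K * n)"
    using finite_top_bound[OF C cA B U S] unfolding preceq_def by auto
  have "Conj_fun C W S n \<le> K * max (Conj_fun C B T (K * n))
    ((Psi_fun C B T (K * n) * Conj_fun C A U (Psi_fun C B T (K * n) * (K * n))) ^ (Psi_fun C B T (K * n) ^ 3))" for n
  proof -
    let ?p = "Psi_fun C B T (K * n)"
    have p1: "1 \<le> ?p" by (rule Psi_fun_ge_1[OF B.is_group T C(1) cB])
    let ?a = "Conj_fun C A U (?p * (K * n))"
    have a1: "1 \<le> ?a" by (rule Conj_fun_ge_1[OF A.is_group U])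
    have "Conj_fun C A U (K * n) \<le> ?a" by (rule Conj_fun_mono[OF A.is_group U _ cA]) (use p1 in simp)
    also have "?a \<le> ?p * ?a" using p1 by simp
    also have "\<dots> \<le> (?p * ?a) ^ (?p ^ 3)" by (rule self_le_power) (use p1 a1 in \<open>simp_all add: Suc_le_eq\<close>)
    finally have "K * Conj_fun C A U (K * n) \<le> K * max (Conj_fun C B T (K * n)) ((?p * ?a) ^ (?p ^ 3))"
      by (intro mult_le_mono2) (simp add: le_max_iff_disj)
    then show ?thesis using K[of n] by (rule order_trans[rotated])
  qed
  then show ?thesis unfolding preceq_def by blast
next
  case False
  obtain c1 where c1: "\<And>n f b. (f, b) \<in> word_ball W S n \<Longrightarrow>
      b \<in> word_ball B T (c1 * n) \<and> supp A B f \<subseteq> word_ball B T (c1 * n) \<and> card (supp A B f) \<le> c1 * n"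
    using wreath_ball_top[OF S T] by blast
  obtain c2 where c2: "\<And>n f b Z. (f, b) \<in> word_ball W S n \<Longrightarrow> mass f Z \<in> word_ball A U (c2 * n)"
    using wreath_ball_mass[OF S U] by blast
  define K where "K = 4 * c1 + c2 + 1"
  have "Conj_fun C W S n \<le> K * max (Conj_fun C B T (K * n))
    ((Psi_fun C B T (K * n) * Conj_fun C A U (Psi_fun C B T (K * n) * (K * n))) ^ (Psi_fun C B T (K * n) ^ 3))" for n
  proof (cases "n = 0")
    \<comment> \<open>Scaling the argument by K gives no room at 0, but there the ball is trivial.\<close>
    case True
    have "1 * 1 \<le> K * max (Conj_fun C B T (K * n))
      ((Psi_fun C B T (K * n) * Conj_fun C A U (Psi_fun C B T (K * n) * (K * n))) ^ (Psi_fun C B T (K * n) ^ 3))"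
      by (rule mult_le_mono) (use Conj_fun_ge_1[OF B.is_group T, of C "K * n"] in \<open>auto simp: K_def\<close>)
    moreover have "Conj_fun C W S n \<le> 1 * 1" using Conj_fun_0[OF wreath_group S, of C] True by simp
    ultimately show ?thesis by (rule order_trans[rotated])
  next
    case False
    then have n: "1 \<le> n" by simp
    let ?Q = "RG_fun C B T (3 * (c1 * n)) * Cyclic_fun C B T (4 * (c1 * n)) ^ (c1 * n + 2 * (c1 * n) * (c1 * n))"
    let ?p = "Psi_fun C B T (K * n)"
    let ?a = "Conj_fun C A U (?p * (K * n))"
    let ?e = "Conj_fun C A U (c2 * n)"
    have p1: "1 \<le> ?p" by (rule Psi_fun_ge_1[OF B.is_group T C(1) cB])
    have a1: "1 \<le> ?a" "1 \<le> ?e" by (rule Conj_fun_ge_1[OF A.is_group U])+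
    have step: "Conj_fun C W S n \<le> max (Conj_fun C B T (c1 * n)) ((?e ^ (1 + c1 * n)) ^ ?Q * ?Q)"
    proof (rule abelian_bound_step[OF C cB yB T S c1 _ order_refl])
      show "1 \<le> ?e ^ (1 + c1 * n)" using a1(2) by (rule one_le_power)
      fix f b f' b' J L P assume w: "(f, b) \<in> word_ball W S n" "(f', b') \<in> word_ball W S n"
        and t: "test_data f b f' b' (c1 * n) J L P"
      show "\<exists>N\<in>class_normals C A. quot_card A N \<le> ?e ^ (1 + c1 * n) \<and> (\<forall>(p, q)\<in>P. proj A N p \<noteq> proj A N q)"
        by (rule base_quotient_bound[OF C(1) cA U c2[OF w(1)] c2[OF w(2)] t])
    qed
    have Q: "?Q * 2 ^ c2 \<le> ?p" and q: "1 + c1 * n \<le> ?p"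
      by (rule Psi_fun_absorbs[OF B.is_group T C(1) cB yB \<open>carrier B \<noteq> {\<one>}\<close> n, where l = c2], simp add: K_def)+
    have "?Q * 1 \<le> ?Q * 2 ^ c2" by (intro mult_le_mono2) simp
    then have Q1: "?Q \<le> ?p" using Q unfolding mult_1_right by (rule order_trans)
    have "c2 * n \<le> 1 * (K * n)" by (simp add: K_def algebra_simps)
    also have "\<dots> \<le> ?p * (K * n)" using p1 by (rule mult_le_mono1)
    finally have aa: "?e \<le> ?a" using cA by (rule Conj_fun_mono[OF A.is_group U])
    have "?p * ?p * 1 \<le> ?p * ?p * ?p" using p1 by (rule mult_le_mono2)
    then have p3: "?p * ?p \<le> ?p ^ 3" by (simp add: power3_eq_cube)
    have "(?e ^ (1 + c1 * n)) ^ ?Q = ?e ^ ((1 + c1 * n) * ?Q)" by (simp only: power_mult)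
    also have "\<dots> \<le> ?e ^ (?p ^ 3)"
      by (rule power_increasing[OF order_trans[OF mult_le_mono[OF q Q1] p3] a1(2)])
    also have "\<dots> \<le> ?a ^ (?p ^ 3)" using aa by (rule power_mono) simp
    finally have 1: "(?e ^ (1 + c1 * n)) ^ ?Q \<le> ?a ^ (?p ^ 3)" .
    have "?p \<le> ?p ^ (?p ^ 3)" by (rule self_le_power[OF p1]) (use p1 in \<open>simp add: Suc_le_eq\<close>)
    then have 2: "?Q \<le> ?p ^ (?p ^ 3)" using Q1 by (rule order_trans[rotated])
    have "(?e ^ (1 + c1 * n)) ^ ?Q * ?Q \<le> ?a ^ (?p ^ 3) * ?p ^ (?p ^ 3)" using 1 2 by (rule mult_le_mono)
    also have "\<dots> = (?p * ?a) ^ (?p ^ 3)" by (simp only: power_mult_distrib mult.commute)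
    finally have 3: "(?e ^ (1 + c1 * n)) ^ ?Q * ?Q \<le> (?p * ?a) ^ (?p ^ 3)" .
    have 4: "Conj_fun C B T (c1 * n) \<le> Conj_fun C B T (K * n)"
      by (rule Conj_fun_mono[OF B.is_group T _ cB]) (simp add: K_def algebra_simps)
    have "Conj_fun C W S n \<le> max (Conj_fun C B T (K * n)) ((?p * ?a) ^ (?p ^ 3))"
      using step max.mono[OF 4 3] by (rule order_trans)
    also have "\<dots> \<le> K * max (Conj_fun C B T (K * n)) ((?p * ?a) ^ (?p ^ 3))" by (simp add: K_def)
    finally show ?thesis .
  qed
  then show ?thesis unfolding preceq_def by blast
qed

end

section \<open>The criterion and the bounds\<close>

theorem theorem2:
  fixes C :: "nat monoid set"
    and A :: "('a, 'm) monoid_scheme"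
    and B :: "('b, 'n) monoid_scheme"
  assumes "pseudovariety C" and "extension_closed C"
    and "group A" and "group B"
    and "conjugacy_separable C A" and "conjugacy_separable C B"
  shows
    "(\<not> trivial_group A \<longrightarrow>
        (conjugacy_separable C (wreath A B) \<longleftrightarrow>
          in_class C B \<or> (comm_group A \<and> cyclic_subgroup_separable C B)))
     \<and>
     (in_class C B \<or> (comm_group A \<and> cyclic_subgroup_separable C B) \<longrightarrow>
        conjugacy_separable C (wreath A B))
     \<and>
     (\<forall>S\<^sub>A S\<^sub>W. in_class C B \<and> fin_gen_set A S\<^sub>A \<and> fin_gen_set (wreath A B) S\<^sub>W \<longrightarrow>
        Conj_fun C (wreath A B) S\<^sub>W \<preceq> (\<lambda>n. (Conj_fun C A S\<^sub>A n) ^ (order B ^ 3)))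
     \<and>
     (\<forall>S\<^sub>A S\<^sub>B S\<^sub>W. comm_group A \<and> infinite (carrier A) \<and> cyclic_subgroup_separable C B \<and>
          fin_gen_set A S\<^sub>A \<and> fin_gen_set B S\<^sub>B \<and> fin_gen_set (wreath A B) S\<^sub>W \<longrightarrow>
        Conj_fun C (wreath A B) S\<^sub>W \<preceq>
          (\<lambda>n. max (Conj_fun C B S\<^sub>B n)
            ((Psi_fun C B S\<^sub>B n * Conj_fun C A S\<^sub>A (Psi_fun C B S\<^sub>B n * n)) ^ ((Psi_fun C B S\<^sub>B n) ^ 3))))
     \<and>
     (\<forall>S\<^sub>B S\<^sub>W. comm_group A \<and> finite (carrier A) \<and> cyclic_subgroup_separable C B \<and>
          fin_gen_set B S\<^sub>B \<and> fin_gen_set (wreath A B) S\<^sub>W \<longrightarrow>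
        Conj_fun C (wreath A B) S\<^sub>W \<preceq>
          (\<lambda>n. max (Conj_fun C B S\<^sub>B n) (Psi_fun C B S\<^sub>B n * 2 ^ Psi_fun C B S\<^sub>B n)))"
proof -
  interpret W: wreath_pair A B using assms(3,4) by (rule wreath_pair.intro)
  have ab: "wreath_abelian A B" if "comm_group A"
    by (rule wreath_abelian.intro[OF W.wreath_pair_axioms wreath_abelian_axioms.intro[OF that]])
  have suff: "conjugacy_separable C (wreath A B)" if "in_class C B \<or> (comm_group A \<and> cyclic_subgroup_separable C B)"
    using that W.finite_top_sufficient[OF assms(1,2,5)] wreath_abelian.abelian_sufficient[OF ab assms(1,2,5,6)] by blast
  have nec: "in_class C B \<or> (comm_group A \<and> cyclic_subgroup_separable C B)"
    if nt: "\<not> trivial_group A" and W: "conjugacy_separable C (wreath A B)"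
  proof (cases "comm_group A")
    case False
    then show ?thesis using W.nonabelian_necessary[OF assms(1) W assms(6)] by simp
  next
    case True
    have "\<exists>a\<in>carrier A. a \<noteq> \<one>\<^bsub>A\<^esub>"
      using nt assms(3) W.A.one_closed unfolding trivial_group_def by blast
    then show ?thesis using wreath_abelian.abelian_necessary[OF ab[OF True] assms(1) W] True by blast
  qed
  show ?thesis
  proof (intro conjI impI allI)
    assume "\<not> trivial_group A"
    then show "conjugacy_separable C (wreath A B) \<longleftrightarrow>
          in_class C B \<or> (comm_group A \<and> cyclic_subgroup_separable C B)" using suff nec by blast
  next
    assume "in_class C B \<or> (comm_group A \<and> cyclic_subgroup_separable C B)"
    then show "conjugacy_separable C (wreath A B)" by (rule suff)
  next
    fix S\<^sub>A S\<^sub>W assume "in_class C B \<and> fin_gen_set A S\<^sub>A \<and> fin_gen_set (wreath A B) S\<^sub>W"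
    then show "Conj_fun C (wreath A B) S\<^sub>W \<preceq> (\<lambda>n. (Conj_fun C A S\<^sub>A n) ^ (order B ^ 3))"
      using W.finite_top_bound[OF assms(1,2,5)] by blast
  next
    fix S\<^sub>A S\<^sub>B S\<^sub>W assume h: "comm_group A \<and> infinite (carrier A) \<and> cyclic_subgroup_separable C B \<and>
          fin_gen_set A S\<^sub>A \<and> fin_gen_set B S\<^sub>B \<and> fin_gen_set (wreath A B) S\<^sub>W"
    then interpret wreath_abelian A B by (intro ab) blast
    show "Conj_fun C (wreath A B) S\<^sub>W \<preceq>
          (\<lambda>n. max (Conj_fun C B S\<^sub>B n)
            ((Psi_fun C B S\<^sub>B n * Conj_fun C A S\<^sub>A (Psi_fun C B S\<^sub>B n * n)) ^ ((Psi_fun C B S\<^sub>B n) ^ 3)))"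
      by (rule abelian_base_bound[OF assms(1,2,5,6)]) (use h in blast)+
  next
    fix S\<^sub>B S\<^sub>W assume h: "comm_group A \<and> finite (carrier A) \<and> cyclic_subgroup_separable C B \<and>
          fin_gen_set B S\<^sub>B \<and> fin_gen_set (wreath A B) S\<^sub>W"
    then interpret wreath_abelian A B by (intro ab) blast
    show "Conj_fun C (wreath A B) S\<^sub>W \<preceq>
          (\<lambda>n. max (Conj_fun C B S\<^sub>B n) (Psi_fun C B S\<^sub>B n * 2 ^ Psi_fun C B S\<^sub>B n))"
      by (rule finite_base_bound[OF assms(1,2,5,6)]) (use h in blast)+
  qed
qed

end
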